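(* Let $\mathcal{X},\mathcal{Y}$ be finite alphabets, and let $X_1,X_2,\dots$ be i.i.d. with distribution $P$ having full support on $\mathcal{X}$. Let $d:\mathcal{X}\times\mathcal{Y}\to\mathbb{R}_+$ be a distortion function with $d(x,y)\le D_{\max}$ for all $x,y$ and some finite $D_{\max}$, let $D\ge D_{\min}=\max_{x\in\mathcal{X}}\min_{y\in\mathcal{Y}}d(x,y)$, let $\alpha>0$ (the case $\alpha=\infty$ being allowed), let $r>0$ be the key rate, and let the channel rate $R$ satisfy $R>\max_{Q:\,D(Q\|P)\le\alpha}R(Q,D)$. Then, with $\overrightarrow{R}=(R,r)$, $$L(P,D,\overrightarrow{R},\alpha)=\max_{Q:\,D(Q\|P)\le\alpha}\,[R(Q,D)-r]^+\quad\text{(bits)},$$ where $Q$ ranges over probability distributions on $\mathcal{X}$ and $[a]^+=\max\{0,a\}$.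
   Context: All logarithms in this statement are base 2 (relative entropy $D(Q\|P)$, mutual information, leakage). $R(Q,D)$ is the rate-distortion function of a source with distribution $Q$: the minimum of $I(X;Y)$ over conditional distributions $P_{Y|X}$ with $X\sim Q$ and $\mathbf{E}[d(X,Y)]\le D$. For sequences, $d(x^n,y^n)=\frac1n\sum_{i=1}^n d(x_i,y_i)$. Setup (Shannon cipher system with lossy communication). $K_n$ is uniform on $\{0,1\}^{nr}$ and independent of $X^n=(X_1,\dots,X_n)$ (integer parts of $nr$, $nR$ are understood). An encoder $f_n$ produces the public message $M_n=f_n(X^n,K_n)\in\{0,1\}^{nR}$; a decoder $g$ produces $Y^n=g(M_n,K_n)\in\mathcal{Y}^n$. Both may be randomized (using independent private randomness). $\mathcal{F}_n$ is the set of encoders $f_n$ for which there exists a decoder $g$ with $$\Pr\big(d(X^n,g(f_n(X^n,K_n),K_n))>D\big)\le2^{-n\alpha}$$ (with $2^{-\infty}=0$). The optimal limit is $$L(P,D,\overrightarrow{R},\alpha)=\lim_{n\to\infty}\min_{f_n\in\mathcal{F}_n}\frac1n\mathcal{L}(X^n\to f_n(X^n,K_n)).$$ Here $\mathcal{L}$ is the maximal leakage in bits: for random variables $X,M$, $$\mathcal{L}(X\to M)=\sup_{U-X-M-\hat U}\log_2\frac{\Pr(U=\hat U)}{\max_uP_U(u)},$$ the supremum being over all $U,\hat U$ forming the indicated Markov chain and taking values in the same finite, but arbitrary, alphabet. *)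

theory Defs
  imports "HOL-Probability.Probability"
begin

subsection \<open>Maximal leakage\<close>

(* The library has log 2 0 = 0; for probabilities the value at 0 is taken to be -infinity. *)
definition elog2 :: "real \<Rightarrow> ereal" where
  "elog2 p = (if p \<le> 0 then -\<infinity> else ereal (log 2 p))"

definition cond_indep_given ::
  "'s pmf \<Rightarrow> ('s \<Rightarrow> 'a) \<Rightarrow> ('s \<Rightarrow> 'b) \<Rightarrow> ('s \<Rightarrow> 'c) \<Rightarrow> bool" where
  "cond_indep_given K A B C \<longleftrightarrow> (\<forall>a b c.
     measure_pmf.prob K {s. A s = a \<and> B s = b \<and> C s = c} * measure_pmf.prob K {s. B s = b}
   = measure_pmf.prob K {s. A s = a \<and> B s = b} * measure_pmf.prob K {s. B s = b \<and> C s = c})"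

(* The chain A - B - C - E. *)
definition markov_chain4 ::
  "'s pmf \<Rightarrow> ('s \<Rightarrow> 'a) \<Rightarrow> ('s \<Rightarrow> 'b) \<Rightarrow> ('s \<Rightarrow> 'c) \<Rightarrow> ('s \<Rightarrow> 'e) \<Rightarrow> bool" where
  "markov_chain4 K A B C E \<longleftrightarrow>
     cond_indep_given K A B (\<lambda>s. (C s, E s)) \<and>
     cond_indep_given K (\<lambda>s. (A s, B s)) C E"

(* The joint laws of (U, X, M, V) for which (X, M) has law J, the variables U and V take values
   in the alphabet S, and U - X - M - V is a Markov chain. *)
definition guessing_laws ::
  "nat set \<Rightarrow> ('x \<times> 'm) pmf \<Rightarrow> (nat \<times> 'x \<times> 'm \<times> nat) pmf set" where
  "guessing_laws S J = {K.
     (\<forall>(u, x, m, v) \<in> set_pmf K. u \<in> S \<and> v \<in> S) \<and>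
     map_pmf (\<lambda>(u, x, m, v). (x, m)) K = J \<and>
     markov_chain4 K (\<lambda>(u, x, m, v). u) (\<lambda>(u, x, m, v). x)
                     (\<lambda>(u, x, m, v). m) (\<lambda>(u, x, m, v). v)}"

(* Every finite alphabet embeds into nat, so "finite, but arbitrary" alphabets are taken to be
   finite sets of naturals. *)
definition maximal_leakage :: "('x \<times> 'm) pmf \<Rightarrow> ereal" where
  "maximal_leakage J =
     (SUP S \<in> {S. finite S}. SUP K \<in> guessing_laws S J.
        elog2 (measure_pmf.prob K {(u, x, m, v). u = v}
               / (MAX u\<in>S. pmf (map_pmf fst K) u)))"


subsection \<open>Relative entropy and the rate-distortion function\<close>

(* D(Q || P): the library's KL_divergence takes the reference measure first. It is a real, and
   is meaningful only if the support of Q is contained in that of P. *)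
definition relative_entropy :: "'x pmf \<Rightarrow> 'x pmf \<Rightarrow> real" where
  "relative_entropy Q P = KL_divergence 2 (measure_pmf P) (measure_pmf Q)"

definition channel_joint :: "'x pmf \<Rightarrow> ('x \<Rightarrow> 'y pmf) \<Rightarrow> ('x \<times> 'y) pmf" where
  "channel_joint Q W = do {x \<leftarrow> Q; y \<leftarrow> W x; return_pmf (x, y)}"

definition mutual_info :: "('x \<times> 'y) pmf \<Rightarrow> real" where
  "mutual_info J =
     prob_space.mutual_information (measure_pmf J) 2 (count_space UNIV) (count_space UNIV) fst snd"

definition rate_distortion ::
  "('x \<Rightarrow> 'y \<Rightarrow> real) \<Rightarrow> 'x pmf \<Rightarrow> real \<Rightarrow> ereal" where
  "rate_distortion d Q D =
     (INF W \<in> {W. measure_pmf.expectation (channel_joint Q W) (\<lambda>(x, y). d x y) \<le> D}.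
        ereal (mutual_info (channel_joint Q W)))"


subsection \<open>The Shannon cipher system\<close>

definition bit_strings :: "real \<Rightarrow> bool list set" where
  "bit_strings t = {b. length b = nat \<lfloor>t\<rfloor>}"

definition seq_distortion ::
  "('x \<Rightarrow> 'y \<Rightarrow> real) \<Rightarrow> nat \<Rightarrow> 'x list \<Rightarrow> 'y list \<Rightarrow> real" where
  "seq_distortion d n xs ys = (1 / real n) * (\<Sum>i<n. d (xs ! i) (ys ! i))"

(* Randomized encoders and decoders are stochastic kernels: private randomness that is
   independent of everything else enters only through the conditional law of the output. *)
definition encoder ::
  "nat \<Rightarrow> real \<Rightarrow> real \<Rightarrow> ('x list \<Rightarrow> bool list \<Rightarrow> bool list pmf) \<Rightarrow> bool" where
  "encoder n R r f \<longleftrightarrow>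
     (\<forall>xs k. length xs = n \<longrightarrow> k \<in> bit_strings (real n * r) \<longrightarrow>
        set_pmf (f xs k) \<subseteq> bit_strings (real n * R))"

definition decoder ::
  "nat \<Rightarrow> real \<Rightarrow> real \<Rightarrow> (bool list \<Rightarrow> bool list \<Rightarrow> 'y list pmf) \<Rightarrow> bool" where
  "decoder n R r g \<longleftrightarrow>
     (\<forall>m \<in> bit_strings (real n * R). \<forall>k \<in> bit_strings (real n * r).
        set_pmf (g m k) \<subseteq> {ys. length ys = n})"

definition source_message_law ::
  "'x pmf \<Rightarrow> nat \<Rightarrow> real \<Rightarrow> ('x list \<Rightarrow> bool list \<Rightarrow> bool list pmf)
     \<Rightarrow> ('x list \<times> bool list) pmf" where
  "source_message_law P n r f = do {
     xs \<leftarrow> replicate_pmf n P;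
     k \<leftarrow> pmf_of_set (bit_strings (real n * r));
     m \<leftarrow> f xs k;
     return_pmf (xs, m)}"

definition source_reproduction_law ::
  "'x pmf \<Rightarrow> nat \<Rightarrow> real \<Rightarrow> ('x list \<Rightarrow> bool list \<Rightarrow> bool list pmf)
     \<Rightarrow> (bool list \<Rightarrow> bool list \<Rightarrow> 'y list pmf) \<Rightarrow> ('x list \<times> 'y list) pmf" where
  "source_reproduction_law P n r f g = do {
     xs \<leftarrow> replicate_pmf n P;
     k \<leftarrow> pmf_of_set (bit_strings (real n * r));
     m \<leftarrow> f xs k;
     ys \<leftarrow> g m k;
     return_pmf (xs, ys)}"

definition excess_bound :: "ereal \<Rightarrow> nat \<Rightarrow> real" where
  "excess_bound \<alpha> n = (if \<alpha> = \<infinity> then 0 else 2 powr (- (real n * real_of_ereal \<alpha>)))"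

definition admissible_encoders ::
  "'x pmf \<Rightarrow> ('x \<Rightarrow> 'y \<Rightarrow> real) \<Rightarrow> real \<Rightarrow> real \<Rightarrow> real \<Rightarrow> ereal \<Rightarrow> nat
     \<Rightarrow> ('x list \<Rightarrow> bool list \<Rightarrow> bool list pmf) set" where
  "admissible_encoders P d D R r \<alpha> n = {f. encoder n R r f \<and>
     (\<exists>g. decoder n R r g \<and>
        measure_pmf.prob (source_reproduction_law P n r f g)
          {(xs, ys). seq_distortion d n xs ys > D} \<le> excess_bound \<alpha> n)}"

(* The value is infinity for those n (if any) that have no admissible encoder. *)
definition min_leakage_rate ::
  "'x pmf \<Rightarrow> ('x \<Rightarrow> 'y \<Rightarrow> real) \<Rightarrow> real \<Rightarrow> real \<Rightarrow> real \<Rightarrow> ereal \<Rightarrow> nat \<Rightarrow> ereal" where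
  "min_leakage_rate P d D R r \<alpha> n =
     (INF f \<in> admissible_encoders P d D R r \<alpha> n.
        maximal_leakage (source_message_law P n r f) / ereal (real n))"

end

theory Submission
  imports Defs
begin

text \<open>Maximal leakage has the closed form \<open>log (\<Sum>\<^sub>m max\<^sub>x P(m|x))\<close>, so both directions are statements about
  the sum \<open>L = \<Sum>\<^sub>m max\<^sub>x P(m|x)\<close>.

  Converse: guessing the key at random, the adversary reproduces \<open>Y\<^sup>n\<close> with a channel that dominates \<open>2\<^sup>-\<^sup>n\<^sup>r\<close>
  times the true reproduction channel \<open>A\<close>, hence \<open>\<Sum>\<^sub>y max\<^sub>x A(y|x) \<le> 2\<^sup>n\<^sup>r L\<close>. By change of measure, \<open>A\<close> meets the
  distortion constraint with high probability under every i.i.d. source \<open>Q\<close> with \<open>D(Q||P) < \<alpha>\<close>, and one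
  application of Jensen's inequality bounds \<open>log (\<Sum>\<^sub>y max\<^sub>x A(y|x))\<close> below by \<open>n\<close> times the mutual information of
  the averaged single-letter law. Sources with \<open>D(Q||P) = \<alpha>\<close> are approximated by mixing in a little
  of \<open>P\<close>, and the rate-distortion function is lower semicontinuous in the source and the distortion level jointly.

  Achievability: near each \<open>Q\<close> in the divergence ball, a greedy covering argument gives about \<open>2^(n R(Q,D))\<close>
  codewords that serve all sequences whose type is close to \<open>Q\<close>. Compactness of the ball makes finitely many \<open>Q\<close>
  suffice, and also serves all types slightly outside the ball, which absorbs the polynomial factor
  in the excess probability. Encrypting \<open>n r\<close> bits of the codeword index with a one-time pad leaves only
  the remaining bits exposed.\<close>

subsection \<open>A closed form of maximal leakage\<close>

text \<open>Two boundary phenomena shape the argument. In the converse, the single-letter law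
  obtained from a code need not have first marginal exactly \<open>Q\<close> nor distortion at most
  \<open>D\<close>: the source is moved slightly, and the exceptional event adds a little
  distortion. One compactness argument with a common tolerance absorbs both. In achievability, a
  distortion constraint that holds with equality at \<open>Q\<close> is not stable under a small
  change of the type, and at the smallest admissible \<open>D\<close> there may be no slack to gain.
  The test channel is therefore chosen so that it either has strict slack at \<open>Q\<close> or
  respects the level \<open>D\<close> letter by letter, and the output law is made strictly
  positive. Every requirement on a sequence then becomes a strict linear inequality in its type, so
  one channel serves an open neighbourhood of \<open>Q\<close>. For \<alpha> = \<infinity> no error
  at all is allowed, but then the ball is the whole simplex, so no type lies outside the cover; and
  an event of probability zero under \<open>P\<close> has probability zero under every
  source.\<close>

lemma prob_eq_sum_superset:
  assumes "finite F" "set_pmf p \<subseteq> F"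
  shows "measure_pmf.prob p A = (\<Sum>s\<in>F. if s \<in> A then pmf p s else 0)"
proof -
  have "measure_pmf.prob p A = measure_pmf.prob p (A \<inter> F)"
    using assms(2) by (intro measure_prob_cong_0) (auto simp: pmf_eq_0_set_pmf)
  also have "\<dots> = sum (pmf p) (A \<inter> F)"
    using assms(1) by (intro measure_measure_pmf_finite) auto
  also have "\<dots> = (\<Sum>s\<in>F. if s \<in> A then pmf p s else 0)"
    using assms(1) by (simp add: Int_commute[of A] sum.inter_restrict)
  finally show ?thesis .
qed

text \<open>Its logarithm is Sibson's mutual information of order infinity. Conditional
  probabilities are quotients over the support of the first marginal, so no division by zero
  occurs.\<close>

definition leak_sum :: "('x \<times> 'm) pmf \<Rightarrow> real" where
  "leak_sum J = (\<Sum>m\<in>snd ` set_pmf J. MAX x\<in>fst ` set_pmf J. pmf J (x, m) / pmf (map_pmf fst J) x)"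

lemma elog2_mono: "a \<le> b \<Longrightarrow> elog2 a \<le> elog2 b"
  by (auto simp: elog2_def)

text \<open>The chain gives P(u,x,m,v) = P(u,x) P(m|x) P(v|m). Replacing P(m|x) by its maximum over
  x decouples x from m. Summing over x leaves P(u), which is at most the best blind guess, and
  summing P(v|m) over v = u gives at most 1 for each m.\<close>

lemma guessing_law_le:
  fixes J :: "('x \<times> 'm) pmf"
  assumes fin: "finite (set_pmf J)" "finite S" and K: "K \<in> guessing_laws S J"
  shows "measure_pmf.prob K {(u, x, m, v). u = v} / (MAX u\<in>S. pmf (map_pmf fst K) u) \<le> leak_sum J"
proof -
  define Xs where "Xs = fst ` set_pmf J"
  define Ms where "Ms = snd ` set_pmf J"
  have finX: "finite Xs" and finM: "finite Ms" using fin by (auto simp: Xs_def Ms_def)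
  define F where "F = S \<times> Xs \<times> Ms \<times> S"
  have finF: "finite F" using fin finX finM by (simp add: F_def)
  have JK: "map_pmf (\<lambda>(u, x, m, v). (x, m)) K = J"
    and US: "\<And>u x m v. (u, x, m, v) \<in> set_pmf K \<Longrightarrow> u \<in> S \<and> v \<in> S"
    and mc: "markov_chain4 K (\<lambda>(u, x, m, v). u) (\<lambda>(u, x, m, v). x)
                     (\<lambda>(u, x, m, v). m) (\<lambda>(u, x, m, v). v)"
    using K by (auto simp: guessing_laws_def)
  have KF: "set_pmf K \<subseteq> F"
  proof
    fix s assume s: "s \<in> set_pmf K"
    obtain u x m v where [simp]: "s = (u, x, m, v)" by (cases s)
    have "(x, m) \<in> set_pmf J" using s by (subst JK[symmetric]) force
    then show "s \<in> F" using US[of u x m v] s by (force simp: F_def Xs_def Ms_def)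
  qed
  let ?Pr = "measure_pmf.prob K"
  define k where "k u x m v = pmf K (u, x, m, v)" for u x m v
  have pr: "?Pr A = (\<Sum>u\<in>S. \<Sum>x\<in>Xs. \<Sum>m\<in>Ms. \<Sum>v\<in>S. if (u, x, m, v) \<in> A then k u x m v else 0)" for A
    by (subst prob_eq_sum_superset[OF finF KF]) (simp add: F_def k_def sum.cartesian_product split_beta cong: if_cong)
  define kux where "kux u x = ?Pr {s. fst s = u \<and> fst (snd s) = x}" for u x
  define kuxm where "kuxm u x m = ?Pr {s. fst s = u \<and> fst (snd s) = x \<and> fst (snd (snd s)) = m}" for u x m
  define kmv where "kmv m v = ?Pr {s. fst (snd (snd s)) = m \<and> snd (snd (snd s)) = v}" for m v
  define km where "km m = ?Pr {s. fst (snd (snd s)) = m}" for m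
  define kx where "kx x = ?Pr {s. fst (snd s) = x}" for x
  define ku where "ku u = ?Pr {s. fst s = u}" for u
  have nn: "0 \<le> kux u x" "0 \<le> kuxm u x m" "0 \<le> kmv m v" "0 \<le> km m" "0 \<le> kx x" "0 \<le> ku u" for u x m v
    by (simp_all add: kux_def kuxm_def kmv_def km_def kx_def ku_def)
  have kx: "kx x = pmf (map_pmf fst J) x" for x
    unfolding kx_def by (simp add: JK[symmetric] pmf_map map_pmf_comp vimage_def split_beta)
  have Jk: "pmf J (x, m) = ?Pr {s. fst (snd s) = x \<and> fst (snd (snd s)) = m}" for x m
    by (simp add: JK[symmetric] pmf_map vimage_def split_beta)
  \<comment> \<open>The first half of the chain condition concerns the pair (m, v); summing it over
    v leaves independence of u and m given x.\<close>
  have mc1: "kuxm u x m * kx x = kux u x * pmf J (x, m)" for u x m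
  proof -
    have 1: "?Pr {s. fst s = u \<and> fst (snd s) = x \<and> fst (snd (snd s)) = m \<and> snd (snd (snd s)) = v} * kx x
         = kux u x * ?Pr {s. fst (snd s) = x \<and> fst (snd (snd s)) = m \<and> snd (snd (snd s)) = v}" for v
      using mc unfolding markov_chain4_def cond_indep_given_def kx_def kux_def
      by (simp add: split_beta prod_eq_iff)
    have a: "kuxm u x m = (\<Sum>v\<in>S. ?Pr {s. fst s = u \<and> fst (snd s) = x \<and> fst (snd (snd s)) = m \<and> snd (snd (snd s)) = v})"
    proof -
      have "kuxm u x m = ?Pr (\<Union>v\<in>S. {s. fst s = u \<and> fst (snd s) = x \<and> fst (snd (snd s)) = m \<and> snd (snd (snd s)) = v})"
        unfolding kuxm_def by (rule measure_prob_cong_0) (use US in \<open>auto simp: pmf_eq_0_set_pmf\<close>)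
      also have "\<dots> = (\<Sum>v\<in>S. ?Pr {s. fst s = u \<and> fst (snd s) = x \<and> fst (snd (snd s)) = m \<and> snd (snd (snd s)) = v})"
        using fin by (intro measure_pmf.finite_measure_finite_Union) (auto simp: disjoint_family_on_def)
      finally show ?thesis .
    qed
    have b: "pmf J (x, m) = (\<Sum>v\<in>S. ?Pr {s. fst (snd s) = x \<and> fst (snd (snd s)) = m \<and> snd (snd (snd s)) = v})"
    proof -
      have "pmf J (x, m) = ?Pr (\<Union>v\<in>S. {s. fst (snd s) = x \<and> fst (snd (snd s)) = m \<and> snd (snd (snd s)) = v})"
        unfolding Jk by (rule measure_prob_cong_0) (use US in \<open>auto simp: pmf_eq_0_set_pmf\<close>)
      also have "\<dots> = (\<Sum>v\<in>S. ?Pr {s. fst (snd s) = x \<and> fst (snd (snd s)) = m \<and> snd (snd (snd s)) = v})"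
        using fin by (intro measure_pmf.finite_measure_finite_Union) (auto simp: disjoint_family_on_def)
      finally show ?thesis .
    qed
    show ?thesis unfolding a b by (simp only: sum_distrib_left sum_distrib_right 1)
  qed
  have mc2: "k u x m v * km m = kuxm u x m * kmv m v" for u x m v
  proof -
    have "?Pr {s. fst s = u \<and> fst (snd s) = x \<and> fst (snd (snd s)) = m \<and> snd (snd (snd s)) = v} * km m = kuxm u x m * kmv m v"
      using mc unfolding markov_chain4_def cond_indep_given_def km_def kuxm_def kmv_def
      by (simp add: split_beta)
    moreover have "{s. fst s = u \<and> fst (snd s) = x \<and> fst (snd (snd s)) = m \<and> snd (snd (snd s)) = v} = {(u, x, m, v)}"
      by (auto simp: prod_eq_iff)
    ultimately show ?thesis by (simp add: k_def measure_pmf_single)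
  qed
  define Wm where "Wm m = (MAX x\<in>Xs. pmf J (x, m) / pmf (map_pmf fst J) x)" for m
  have Wm: "pmf J (x, m) / pmf (map_pmf fst J) x \<le> Wm m" if "x \<in> Xs" for x m
    unfolding Wm_def using that finX by (intro Max_ge) auto
  have kxpos: "kx x > 0" if "x \<in> Xs" for x
    using that unfolding kx by (simp add: Xs_def pmf_positive)
  have kuxm_le: "kuxm u x m \<le> kux u x * Wm m" if "x \<in> Xs" for u x m
  proof -
    have "kuxm u x m = kux u x * (pmf J (x, m) / pmf (map_pmf fst J) x)"
      using mc1[of u x m] kxpos[OF that] by (simp add: kx field_simps)
    also have "\<dots> \<le> kux u x * Wm m" using Wm[OF that] nn by (intro mult_left_mono)
    finally show ?thesis .
  qed
  have kmpos: "km m > 0" if "m \<in> Ms" for m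
  proof -
    from that obtain x where x: "(x, m) \<in> set_pmf J" by (auto simp: Ms_def)
    have "0 < pmf J (x, m)" using x by (simp add: pmf_positive)
    also have "\<dots> \<le> km m" unfolding Jk km_def by (intro measure_pmf.finite_measure_mono) auto
    finally show ?thesis .
  qed
  have kux_sum: "(\<Sum>x\<in>Xs. kux u x) \<le> ku u" for u
  proof -
    have "(\<Sum>x\<in>Xs. kux u x) = ?Pr (\<Union>x\<in>Xs. {s. fst s = u \<and> fst (snd s) = x})"
      unfolding kux_def using finX
      by (intro measure_pmf.finite_measure_finite_Union[symmetric]) (auto simp: disjoint_family_on_def)
    also have "\<dots> \<le> ku u" unfolding ku_def by (intro measure_pmf.finite_measure_mono) auto
    finally show ?thesis .
  qed
  have kmv_sum: "(\<Sum>v\<in>S. kmv m v) \<le> km m" for m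
  proof -
    have "(\<Sum>v\<in>S. kmv m v) = ?Pr (\<Union>v\<in>S. {s. fst (snd (snd s)) = m \<and> snd (snd (snd s)) = v})"
      unfolding kmv_def using fin
      by (intro measure_pmf.finite_measure_finite_Union[symmetric]) (auto simp: disjoint_family_on_def)
    also have "\<dots> \<le> km m" unfolding km_def by (intro measure_pmf.finite_measure_mono) auto
    finally show ?thesis .
  qed
  have ku_pmf: "pmf (map_pmf fst K) u = ku u" for u
    by (simp add: ku_def pmf_map vimage_def split_beta)
  define pm where "pm = (MAX u\<in>S. pmf (map_pmf fst K) u)"
  have ku_le: "ku u \<le> pm" if "u \<in> S" for u
    unfolding pm_def ku_pmf[symmetric] using that fin by (intro Max_ge) auto
  obtain u0 x0 m0 v0 where s0: "(u0, x0, m0, v0) \<in> set_pmf K"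
    using set_pmf_not_empty[of K] by fast
  have "0 < pmf (map_pmf fst K) u0"
    by (rule pmf_positive) (use s0 in force)
  then have pmpos: "pm > 0" using ku_le[of u0] US[OF s0] by (simp add: ku_pmf)
  have Wnn: "0 \<le> Wm m" for m
  proof -
    have "x0 \<in> Xs" using KF s0 by (auto simp: F_def)
    from Wm[OF this, of m] show ?thesis by (rule order.trans[rotated]) simp
  qed
  have "?Pr {(u, x, m, v). u = v} = (\<Sum>u\<in>S. \<Sum>x\<in>Xs. \<Sum>m\<in>Ms. k u x m u)"
    unfolding pr using fin by (intro sum.cong refl) (auto simp: sum.delta' if_distrib)
  also have "\<dots> \<le> (\<Sum>u\<in>S. \<Sum>x\<in>Xs. \<Sum>m\<in>Ms. kux u x * (Wm m * (kmv m u / km m)))"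
  proof (intro sum_mono)
    fix u x m assume "x \<in> Xs" "m \<in> Ms"
    have "k u x m u = kuxm u x m * (kmv m u / km m)"
      using mc2[of u x m u] kmpos[OF \<open>m \<in> Ms\<close>] by (simp add: field_simps)
    also have "\<dots> \<le> (kux u x * Wm m) * (kmv m u / km m)"
      using nn by (intro mult_right_mono kuxm_le \<open>x \<in> Xs\<close>) auto
    finally show "k u x m u \<le> kux u x * (Wm m * (kmv m u / km m))" by (simp add: mult.assoc)
  qed
  also have "\<dots> = (\<Sum>u\<in>S. (\<Sum>x\<in>Xs. kux u x) * (\<Sum>m\<in>Ms. Wm m * (kmv m u / km m)))"
    by (simp add: sum_product)
  also have "\<dots> \<le> (\<Sum>u\<in>S. pm * (\<Sum>m\<in>Ms. Wm m * (kmv m u / km m)))"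
    by (intro sum_mono mult_right_mono order.trans[OF kux_sum ku_le] sum_nonneg) (use Wnn nn in auto)
  also have "\<dots> = pm * (\<Sum>m\<in>Ms. Wm m * ((\<Sum>u\<in>S. kmv m u) / km m))"
    by (subst sum_distrib_left[symmetric], subst sum.swap) (simp add: sum_distrib_left sum_divide_distrib)
  also have "\<dots> \<le> pm * (\<Sum>m\<in>Ms. Wm m * 1)"
    using pmpos Wnn kmv_sum kmpos by (intro mult_left_mono sum_mono) (auto simp: divide_le_eq_1)
  also have "\<dots> = pm * leak_sum J" by (simp add: leak_sum_def Wm_def Ms_def Xs_def)
  finally show ?thesis using pmpos by (simp add: pm_def[symmetric] pos_divide_le_eq mult.commute)
qed

text \<open>The supremum is attained by splitting each letter x into pieces: piece 0 has mass
  exactly q, the smallest letter probability, and the remainder is cut into pieces of mass at most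
  q. So U determines X, and no value of U has mass above q. The guesser who sees m names piece 0 of
  the letter maximising P(m|x), and is right with probability q times
  \<open>leak_sum J\<close>.\<close>

lemma exists_guessing_law:
  fixes J :: "('x \<times> 'm) pmf"
  assumes fin: "finite (set_pmf J)"
  obtains S K where "finite S" "K \<in> guessing_laws S J"
    "leak_sum J \<le> measure_pmf.prob K {(u, x, m, v). u = v} / (MAX u\<in>S. pmf (map_pmf fst K) u)"
proof -
  define Xs where "Xs = fst ` set_pmf J"
  define Ms where "Ms = snd ` set_pmf J"
  have finX: "finite Xs" and finM: "finite Ms" using fin by (auto simp: Xs_def Ms_def)
  have Xne: "Xs \<noteq> {}" by (simp add: Xs_def set_pmf_not_empty)
  define p where "p x = pmf (map_pmf fst J) x" for x
  have ppos: "p x > 0" if "x \<in> Xs" for x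
    using that by (simp add: Xs_def p_def pmf_positive)
  define q where "q = Min (p ` Xs)"
  have qle: "q \<le> p x" if "x \<in> Xs" for x using that finX by (simp add: q_def)
  have qpos: "q > 0" using finX Xne ppos by (simp add: q_def)
  \<comment> \<open>The remainder p(x) - q is at most 1, so \<open>L\<close> \<ge> 1/q equal pieces
    have mass at most q each. This works also when p(x) is not a multiple of q.\<close>
  define L where "L = Suc (nat \<lceil>1 / q\<rceil>)"
  have Lpos: "L > 0" by (simp add: L_def)
  have L: "1 / real L \<le> q"
  proof -
    have "1 / q \<le> real L" unfolding L_def by linarith
    then show ?thesis using qpos Lpos by (simp add: field_simps)
  qed
  define e where "e = to_nat_on Xs"
  have e_inj: "inj_on e Xs" using finX by (simp add: e_def countable_finite inj_on_to_nat_on)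
  \<comment> \<open>The law of U given X = x. The injection \<open>e\<close> together with the piece
    number encodes a piece as a natural number, as the alphabets of \<open>guessing_laws\<close>
    demand.\<close>
  define U where "U x = bind_pmf (bernoulli_pmf (q / p x))
     (\<lambda>b. if b then return_pmf (prod_encode (e x, 0))
          else map_pmf (\<lambda>i. prod_encode (e x, i)) (pmf_of_set {1..L}))" for x
  have setU: "set_pmf (U x) \<subseteq> (\<lambda>i. prod_encode (e x, i)) ` {0..L}" for x
    using Lpos by (auto simp: U_def split: if_splits)
  have qp: "0 \<le> q / p x" "q / p x \<le> 1" if "x \<in> Xs" for x
    using ppos[OF that] qle[OF that] qpos by auto
  have pmfU: "pmf (U x) (prod_encode (e x, i)) = (if i = 0 then q / p x else if i \<le> L then (1 - q / p x) / L else 0)"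
    if "x \<in> Xs" for x i
  proof -
    have inj: "inj (\<lambda>i. prod_encode (e x, i))" by (auto intro: injI)
    have "pmf (map_pmf (\<lambda>i. prod_encode (e x, i)) (pmf_of_set {1..L})) (prod_encode (e x, i)) = pmf (pmf_of_set {1..L}) i"
      by (rule pmf_map_inj'[OF inj])
    then show ?thesis
      using qp[OF that] Lpos by (auto simp: U_def pmf_bind indicator_def)
  qed
  have pU: "p x * pmf (U x) (prod_encode (e x, i)) \<le> q" if "x \<in> Xs" for x i
  proof -
    have "p x \<le> 1" by (simp add: p_def pmf_le_1)
    have "p x * ((1 - q / p x) / L) = (p x - q) * (1 / L)" using ppos[OF that] Lpos by (simp add: divide_simps)
    also have "\<dots> \<le> 1 * (1 / L)" using \<open>p x \<le> 1\<close> qpos Lpos by (intro mult_right_mono) auto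
    also have "\<dots> \<le> q" using L by simp
    finally show ?thesis using ppos[OF that] qpos by (auto simp: pmfU[OF that])
  qed
  define W where "W x m = pmf J (x, m) / p x" for x m
  have "\<exists>x\<in>Xs. (MAX x\<in>Xs. W x m) = W x m" for m
  proof -
    have "(MAX x\<in>Xs. W x m) \<in> (\<lambda>x. W x m) ` Xs" using finX Xne by (intro Max_in) auto
    then show ?thesis by (metis imageE)
  qed
  then obtain best where best: "\<And>m. best m \<in> Xs" "\<And>m. (MAX x\<in>Xs. W x m) = W (best m) m" by metis
  define V where "V m = prod_encode (e (best m), 0)" for m
  define K where "K = bind_pmf J (\<lambda>(x, m). map_pmf (\<lambda>u. (u, x, m, V m)) (U x))"
  define S where "S = prod_encode ` (e ` Xs \<times> {0..L})"
  have finS: "finite S" using finX by (simp add: S_def)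
  have VS: "V m \<in> S" for m using best by (auto simp: V_def S_def)
  have US: "set_pmf (U x) \<subseteq> S" if "x \<in> Xs" for x using setU[of x] that by (force simp: S_def)
  have prK: "measure_pmf.prob K A = measure_pmf.expectation J (\<lambda>(x, m). measure_pmf.prob (U x) {u. (u, x, m, V m) \<in> A})" for A
  proof -
    have "measure_pmf.prob K A = measure_pmf.expectation J
       (\<lambda>z. measure_pmf.prob (case z of (x, m) \<Rightarrow> map_pmf (\<lambda>u. (u, x, m, V m)) (U x)) A)"
      unfolding K_def measure_pmf_bind
      by (subst measure_pmf.measure_bind[where N="count_space UNIV"])
         (auto simp: space_subprob_algebra intro!: prob_space_imp_subprob_space measure_pmf.prob_space_axioms)
    then show ?thesis by (simp add: case_prod_unfold vimage_def)
  qed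
  \<comment> \<open>U is drawn from x alone and the guess is a function of m, so every event about
    (m, v) factors off. Both halves of the Markov condition are instances of this.\<close>
  have ev1: "measure_pmf.prob K {s. fst s = u \<and> fst (snd s) = x \<and> G (fst (snd (snd s))) (snd (snd (snd s)))}
      = pmf (U x) u * measure_pmf.prob J {z. fst z = x \<and> G (snd z) (V (snd z))}" for u x G
  proof -
    have "(\<lambda>(x', m). measure_pmf.prob (U x') {u'. (u', x', m, V m) \<in> {s. fst s = u \<and> fst (snd s) = x \<and> G (fst (snd (snd s))) (snd (snd (snd s)))}})
        = (\<lambda>z. pmf (U x) u * indicator {z. fst z = x \<and> G (snd z) (V (snd z))} z)"
      by (auto simp: fun_eq_iff indicator_def measure_pmf_single[symmetric])
    then show ?thesis unfolding prK by simp
  qed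
  have ev2: "measure_pmf.prob K {s. G (fst (snd s)) (fst (snd (snd s))) (snd (snd (snd s)))}
      = measure_pmf.prob J {z. G (fst z) (snd z) (V (snd z))}" for G
  proof -
    have "(\<lambda>(x', m). measure_pmf.prob (U x') {u'. (u', x', m, V m) \<in> {s. G (fst (snd s)) (fst (snd (snd s))) (snd (snd (snd s)))}})
        = (\<lambda>z. indicator {z. G (fst z) (snd z) (V (snd z))} z)"
      by (auto simp: fun_eq_iff indicator_def)
    then show ?thesis unfolding prK by simp
  qed
  have mc: "markov_chain4 K (\<lambda>(u, x, m, v). u) (\<lambda>(u, x, m, v). x)
                     (\<lambda>(u, x, m, v). m) (\<lambda>(u, x, m, v). v)"
    unfolding markov_chain4_def cond_indep_given_def
  proof (intro conjI allI)
    fix u x and c :: "'m \<times> nat"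
    obtain m v where [simp]: "c = (m, v)" by (cases c)
    show "measure_pmf.prob K {s. (case s of (u, x, m, v) \<Rightarrow> u) = u \<and> (case s of (u, x, m, v) \<Rightarrow> x) = x
             \<and> (case s of (u, x, m, v) \<Rightarrow> m, case s of (u, x, m, v) \<Rightarrow> v) = c}
          * measure_pmf.prob K {s. (case s of (u, x, m, v) \<Rightarrow> x) = x}
        = measure_pmf.prob K {s. (case s of (u, x, m, v) \<Rightarrow> u) = u \<and> (case s of (u, x, m, v) \<Rightarrow> x) = x}
          * measure_pmf.prob K {s. (case s of (u, x, m, v) \<Rightarrow> x) = x
             \<and> (case s of (u, x, m, v) \<Rightarrow> m, case s of (u, x, m, v) \<Rightarrow> v) = c}"
      using ev1[of u x "\<lambda>m' v'. m' = m \<and> v' = v"] ev1[of u x "\<lambda>m' v'. True"]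
        ev2[of "\<lambda>x' m' v'. x' = x"] ev2[of "\<lambda>x' m' v'. x' = x \<and> m' = m \<and> v' = v"]
      by (simp add: split_beta prod_eq_iff)
  next
    fix a :: "nat \<times> 'x" and m v
    obtain u x where [simp]: "a = (u, x)" by (cases a)
    have i: "{z::'x\<times>'m. fst z = x \<and> snd z = m \<and> V m = v} = (if V m = v then {z. fst z = x \<and> snd z = m} else {})"
      "{z::'x\<times>'m. snd z = m \<and> V m = v} = (if V m = v then {z. snd z = m} else {})" by auto
    have j: "{z::'x\<times>'m. fst z = x \<and> snd z = m \<and> V (snd z) = v} = {z::'x\<times>'m. fst z = x \<and> snd z = m \<and> V m = v}"
      "{z::'x\<times>'m. snd z = m \<and> V (snd z) = v} = {z::'x\<times>'m. snd z = m \<and> V m = v}" by auto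
    show "measure_pmf.prob K {s. (case s of (u, x, m, v) \<Rightarrow> u, case s of (u, x, m, v) \<Rightarrow> x) = a
             \<and> (case s of (u, x, m, v) \<Rightarrow> m) = m \<and> (case s of (u, x, m, v) \<Rightarrow> v) = v}
          * measure_pmf.prob K {s. (case s of (u, x, m, v) \<Rightarrow> m) = m}
        = measure_pmf.prob K {s. (case s of (u, x, m, v) \<Rightarrow> u, case s of (u, x, m, v) \<Rightarrow> x) = a
             \<and> (case s of (u, x, m, v) \<Rightarrow> m) = m}
          * measure_pmf.prob K {s. (case s of (u, x, m, v) \<Rightarrow> m) = m \<and> (case s of (u, x, m, v) \<Rightarrow> v) = v}"
      using ev1[of u x "\<lambda>m' v'. m' = m \<and> v' = v"] ev1[of u x "\<lambda>m' v'. m' = m"]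
        ev2[of "\<lambda>x' m' v'. m' = m"] ev2[of "\<lambda>x' m' v'. m' = m \<and> v' = v"]
      by (auto simp add: split_beta prod_eq_iff conj_assoc i j)
  qed
  have KJ: "map_pmf (\<lambda>(u, x, m, v). (x, m)) K = J"
    by (simp add: K_def map_bind_pmf split_beta map_pmf_comp map_pmf_const bind_return_pmf')
  have setK: "\<forall>(u, x, m, v)\<in>set_pmf K. u \<in> S \<and> v \<in> S"
    using US VS by (force simp: K_def Xs_def)
  have Kg: "K \<in> guessing_laws S J" using mc KJ setK by (simp add: guessing_laws_def)
  \<comment> \<open>A piece belongs to one letter only, so the mass of u is a single product p(x)
    P(u|x).\<close>
  have pu: "pmf (map_pmf fst K) u \<le> q" if uS: "u \<in> S" for u
  proof -
    obtain x i where xi: "x \<in> Xs" "u = prod_encode (e x, i)" using uS by (auto simp: S_def)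
    have "pmf (map_pmf fst K) u = measure_pmf.prob K {s. fst s = u}"
      by (simp add: pmf_map vimage_def)
    also have "\<dots> = measure_pmf.prob K {s. fst s = u \<and> fst (snd s) = x \<and> True}"
    proof (rule measure_prob_cong_0)
      fix s :: "nat \<times> 'x \<times> 'm \<times> nat" assume s: "s \<in> {s. fst s = u} - {s. fst s = u \<and> fst (snd s) = x \<and> True}"
      show "pmf K s = 0"
      proof (rule ccontr)
        assume "pmf K s \<noteq> 0"
        then have "s \<in> set_pmf K" by (simp add: set_pmf_iff)
        then obtain x' m where z: "(x', m) \<in> set_pmf J" "fst (snd s) = x'" "fst s \<in> set_pmf (U x')"
          by (auto simp: K_def)
        then have "x' \<in> Xs" by (force simp: Xs_def)
        moreover obtain j where "u = prod_encode (e x', j)" using z s setU[of x'] by auto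
        ultimately have "x' = x" using xi e_inj by (auto dest: inj_onD)
        then show False using s z by auto
      qed
    qed auto
    also have "\<dots> = pmf (U x) u * measure_pmf.prob J {z. fst z = x}"
      using ev1[of u x "\<lambda>_ _. True"] by simp
    also have "measure_pmf.prob J {z. fst z = x} = p x" by (simp add: p_def pmf_map vimage_def)
    finally show ?thesis using pU[OF xi(1), of i] xi by (simp add: mult.commute)
  qed
  have "q * leak_sum J = (\<Sum>m\<in>Ms. q * W (best m) m)"
    by (simp add: leak_sum_def Ms_def[symmetric] Xs_def[symmetric] p_def[symmetric] best(2)[unfolded W_def] sum_distrib_left W_def)
  also have "\<dots> = (\<Sum>m\<in>Ms. measure_pmf.prob K {s. fst s = V m \<and> fst (snd s) = best m \<and> fst (snd (snd s)) = m})"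
  proof (rule sum.cong[OF refl])
    fix m assume "m \<in> Ms"
    have eq: "{z. fst z = best m \<and> snd z = m} = {(best m, m)}" by auto
    show "q * W (best m) m = measure_pmf.prob K {s. fst s = V m \<and> fst (snd s) = best m \<and> fst (snd (snd s)) = m}"
      using ev1[of "V m" "best m" "\<lambda>m' v'. m' = m"] pmfU[OF best(1)[of m], of 0]
      by (simp add: V_def W_def eq measure_pmf_single)
  qed
  also have "\<dots> = measure_pmf.prob K (\<Union>m\<in>Ms. {s. fst s = V m \<and> fst (snd s) = best m \<and> fst (snd (snd s)) = m})"
    using finM by (intro measure_pmf.finite_measure_finite_Union[symmetric]) (auto simp: disjoint_family_on_def)
  also have "\<dots> \<le> measure_pmf.prob K {(u, x, m, v). u = v}"
  proof (rule measure_pmf.finite_measure_mono_AE)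
    show "AE s in measure_pmf K. s \<in> (\<Union>m\<in>Ms. {s. fst s = V m \<and> fst (snd s) = best m \<and> fst (snd (snd s)) = m})
       \<longrightarrow> s \<in> {(u, x, m, v). u = v}"
      by (auto simp: AE_measure_pmf_iff K_def)
  qed auto
  finally have main: "q * leak_sum J \<le> measure_pmf.prob K {(u, x, m, v). u = v}" .
  define pm where "pm = (MAX u\<in>S. pmf (map_pmf fst K) u)"
  have "S \<noteq> {}" using VS by auto
  then have pmq: "pm \<le> q" unfolding pm_def using finS pu by simp
  have pmpos: "pm > 0"
  proof -
    obtain s where s: "s \<in> set_pmf K" using set_pmf_not_empty by fast
    then have "fst s \<in> S" using setK by (cases s) auto
    moreover have "pmf (map_pmf fst K) (fst s) > 0" using s by (intro pmf_positive) auto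
    ultimately show ?thesis unfolding pm_def using finS by (subst Max_gr_iff) auto
  qed
  have "leak_sum J \<le> measure_pmf.prob K {(u, x, m, v). u = v} / q"
    using main qpos by (simp add: field_simps)
  also have "\<dots> \<le> measure_pmf.prob K {(u, x, m, v). u = v} / pm"
    using pmq pmpos by (intro divide_left_mono) auto
  finally show thesis using that finS Kg unfolding pm_def by blast
qed

lemma maximal_leakage_eq:
  fixes J :: "('x \<times> 'm) pmf"
  assumes fin: "finite (set_pmf J)"
  shows "maximal_leakage J = elog2 (leak_sum J)"
proof (rule antisym)
  show "maximal_leakage J \<le> elog2 (leak_sum J)"
    unfolding maximal_leakage_def
    by (intro SUP_least elog2_mono guessing_law_le[OF fin]) auto
  obtain S K where "finite S" "K \<in> guessing_laws S J"
    "leak_sum J \<le> measure_pmf.prob K {(u, x, m, v). u = v} / (MAX u\<in>S. pmf (map_pmf fst K) u)"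
    by (rule exists_guessing_law[OF fin])
  then show "elog2 (leak_sum J) \<le> maximal_leakage J"
    unfolding maximal_leakage_def
    by (intro SUP_upper2[of S] SUP_upper2[of K] elog2_mono) auto
qed

subsection \<open>Mutual information and the rate-distortion function\<close>

text \<open>The tangent inequality ln t \<le> t - 1 at t = Z/S, taken term by term. Admitting any
  upper bound \<open>S\<close> on the mean avoids normalising Z, and terms with p a = 0 vanish
  whatever the value of Z.\<close>

lemma jensen_log:
  assumes "finite A" "\<And>a. a \<in> A \<Longrightarrow> 0 \<le> p a" "sum p A = 1"
    and Z: "\<And>a. a \<in> A \<Longrightarrow> p a > 0 \<Longrightarrow> Z a > 0"
    and S: "(\<Sum>a\<in>A. p a * Z a) \<le> S" and Spos: "S > 0"
  shows "(\<Sum>a\<in>A. p a * log 2 (Z a)) \<le> log 2 S"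
proof -
  have "p a * log 2 (Z a) \<le> p a * log 2 S + (p a * Z a / S - p a) / ln 2" if a: "a \<in> A" for a
  proof (cases "p a = 0")
    case False
    then have pz: "p a > 0" "Z a > 0" using assms(2)[OF a] Z[OF a] by auto
    have "ln (Z a / S) \<le> Z a / S - 1" using pz Spos by (intro ln_le_minus_one) auto
    then have "ln (Z a) \<le> ln S + (Z a / S - 1)" using pz Spos by (simp add: ln_div)
    then have "ln (Z a) / ln 2 \<le> (ln S + (Z a / S - 1)) / ln 2" by (intro divide_right_mono) auto
    then have "p a * (ln (Z a) / ln 2) \<le> p a * ((ln S + (Z a / S - 1)) / ln 2)"
      using pz by (intro mult_left_mono) auto
    then show ?thesis by (simp add: log_def add_divide_distrib diff_divide_distrib algebra_simps)
  qed auto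
  then have "(\<Sum>a\<in>A. p a * log 2 (Z a)) \<le> (\<Sum>a\<in>A. p a * log 2 S + (p a * Z a / S - p a) / ln 2)"
    by (rule sum_mono)
  also have "\<dots> = log 2 S + ((\<Sum>a\<in>A. p a * Z a) / S - 1) / ln 2"
    using assms(3) by (simp add: sum.distrib sum_divide_distrib[symmetric] sum_distrib_right[symmetric] sum_subtractf)
  also have "\<dots> \<le> log 2 S"
    using S Spos by (simp add: divide_nonpos_pos)
  finally show ?thesis .
qed

text \<open>Jensen applied to the ratios q/p. The reference weights may sum to less than 1.\<close>

lemma gibbs:
  assumes "finite A" "\<And>a. a \<in> A \<Longrightarrow> 0 \<le> p a" "sum p A = 1"
    and q: "\<And>a. a \<in> A \<Longrightarrow> 0 \<le> q a" "\<And>a. a \<in> A \<Longrightarrow> p a > 0 \<Longrightarrow> q a > 0" "sum q A \<le> 1"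
  shows "0 \<le> (\<Sum>a\<in>A. p a * log 2 (p a / q a))"
proof -
  have "(\<Sum>a\<in>A. p a * log 2 (q a / p a)) \<le> log 2 1"
  proof (rule jensen_log[OF assms(1-3)])
    have "(\<Sum>a\<in>A. p a * (q a / p a)) \<le> (\<Sum>a\<in>A. q a)" by (rule sum_mono) (use q(1) in auto)
    then show "(\<Sum>a\<in>A. p a * (q a / p a)) \<le> 1" using q by linarith
  qed (use q in auto)
  moreover have "p a * log 2 (q a / p a) = - (p a * log 2 (p a / q a))" if "a \<in> A" for a
    using q(2)[OF that] assms(2)[OF that] by (cases "p a = 0") (auto simp: log_divide algebra_simps)
  ultimately show ?thesis by (simp add: sum_negf)
qed

text \<open>Joint laws are plain real functions here, so that they can be perturbed and passed to
  limits as vectors indexed by pairs.\<close>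

definition margX :: "('x \<times> 'y::finite \<Rightarrow> real) \<Rightarrow> 'x \<Rightarrow> real" where
  "margX J x = (\<Sum>y\<in>UNIV. J (x, y))"

definition margY :: "('x::finite \<times> 'y \<Rightarrow> real) \<Rightarrow> 'y \<Rightarrow> real" where
  "margY J y = (\<Sum>x\<in>UNIV. J (x, y))"

text \<open>Terms with J (x, y) = 0 vanish because of the factor in front, which is the convention 0
  log 0 = 0.\<close>

definition mi :: "('x::finite \<times> 'y::finite \<Rightarrow> real) \<Rightarrow> real" where
  "mi J = (\<Sum>(x, y)\<in>UNIV. J (x, y) * log 2 (J (x, y) / (margX J x * margY J y)))"

lemma sum_UNIV_pair:
  fixes f :: "'a::finite \<times> 'b::finite \<Rightarrow> 'c::comm_monoid_add"
  shows "(\<Sum>z\<in>UNIV. f z) = (\<Sum>x\<in>UNIV. \<Sum>y\<in>UNIV. f (x, y))"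
  by (simp add: sum.cartesian_product UNIV_Times_UNIV[symmetric] del: UNIV_Times_UNIV)

lemma marg_ge:
  fixes J :: "'x::finite \<times> 'y::finite \<Rightarrow> real"
  assumes "\<And>z. 0 \<le> J z"
  shows "J (x, y) \<le> margX J x" "J (x, y) \<le> margY J y"
  unfolding margX_def margY_def using assms
  by (auto intro: member_le_sum[of y UNIV "\<lambda>y. J (x, y)"] member_le_sum[of x UNIV "\<lambda>x. J (x, y)"])

lemma sum_marg:
  fixes J :: "'x::finite \<times> 'y::finite \<Rightarrow> real"
  shows "sum (margX J) UNIV = sum J UNIV" "sum (margY J) UNIV = sum J UNIV"
proof -
  show "sum (margX J) UNIV = sum J UNIV" by (simp add: margX_def sum_UNIV_pair)
  show "sum (margY J) UNIV = sum J UNIV"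
    unfolding margY_def sum_UNIV_pair by (rule sum.swap)
qed

lemma mi_nonneg:
  fixes J :: "'x::finite \<times> 'y::finite \<Rightarrow> real"
  assumes "\<And>z. 0 \<le> J z" "sum J UNIV = 1"
  shows "0 \<le> mi J"
proof -
  have "0 \<le> (\<Sum>z\<in>UNIV. J z * log 2 (J z / (margX J (fst z) * margY J (snd z))))"
  proof (rule gibbs)
    show "(\<Sum>z\<in>UNIV. margX J (fst z) * margY J (snd z)) \<le> 1"
      unfolding sum_UNIV_pair[of "\<lambda>z. margX J (fst z) * margY J (snd z)"]
      by (simp add: sum_distrib_left[symmetric] sum_distrib_right[symmetric] sum_marg assms)
    fix z :: "'x \<times> 'y"
    obtain x y where [simp]: "z = (x, y)" by (cases z)
    show "0 \<le> margX J (fst z) * margY J (snd z)"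
      using assms(1) by (auto simp: margX_def margY_def intro!: mult_nonneg_nonneg sum_nonneg)
    show "0 < margX J (fst z) * margY J (snd z)" if "0 < J z"
      using that marg_ge[of J x y, OF assms(1)] by (auto intro!: mult_pos_pos)
  qed (use assms in auto)
  then show ?thesis by (simp add: mi_def split_beta)
qed

section \<open>Continuity of mutual information up to the boundary of the simplex\<close>

definition xlog :: "real \<Rightarrow> real" where "xlog t = t * log 2 t"

lemma continuous_on_xlog: "continuous_on {0..} xlog"
proof -
  have "continuous (at t within {0..}) xlog" if "t \<in> {0..}" for t
  proof (cases "t = 0")
    case True
    have "((\<lambda>t. t * log 2 t) \<longlongrightarrow> 0) (at_right 0)" by real_asymp
    then have "(xlog \<longlongrightarrow> xlog 0) (at_right 0)" by (simp add: xlog_def[abs_def])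
    moreover have "at (0::real) within {0..} = at_right 0"
      by (rule at_within_nhd[of _ "{-1<..<1}"]) auto
    ultimately show ?thesis using True by (simp add: continuous_within)
  next
    case False
    then have "isCont xlog t" using that unfolding xlog_def[abs_def] by (intro continuous_intros) auto
    then show ?thesis by (rule continuous_at_imp_continuous_at_within)
  qed
  then show ?thesis by (simp add: continuous_on_eq_continuous_within)
qed

text \<open>This is H(X) + H(Y) - H(X,Y). The ratio inside \<open>mi\<close> misbehaves where a
  marginal vanishes, whereas each entropy term is continuous on the closed orthant.\<close>

lemma mi_eq_xlog:
  fixes J :: "'x::finite \<times> 'y::finite \<Rightarrow> real"
  assumes nn: "\<And>z. 0 \<le> J z"
  shows "mi J = (\<Sum>z\<in>UNIV. xlog (J z)) - (\<Sum>x\<in>UNIV. xlog (margX J x)) - (\<Sum>y\<in>UNIV. xlog (margY J y))"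
proof -
  have "J (x, y) * log 2 (J (x, y) / (margX J x * margY J y))
     = xlog (J (x, y)) - J (x, y) * log 2 (margX J x) - J (x, y) * log 2 (margY J y)" for x y
  proof (cases "J (x, y) = 0")
    case False
    then have "J (x, y) > 0" using nn[of "(x, y)"] by auto
    then have "margX J x > 0" "margY J y > 0" "J (x, y) > 0"
      using marg_ge[of J x y, OF nn] by auto
    then show ?thesis by (simp add: log_divide log_mult xlog_def algebra_simps)
  qed (simp add: xlog_def)
  then have "mi J = (\<Sum>x\<in>UNIV. \<Sum>y\<in>UNIV. xlog (J (x, y)) - J (x, y) * log 2 (margX J x) - J (x, y) * log 2 (margY J y))"
    by (simp add: mi_def sum_UNIV_pair)
  also have "\<dots> = (\<Sum>x\<in>UNIV. \<Sum>y\<in>UNIV. xlog (J (x, y))) - (\<Sum>x\<in>UNIV. \<Sum>y\<in>UNIV. J (x, y) * log 2 (margX J x))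
       - (\<Sum>x\<in>UNIV. \<Sum>y\<in>UNIV. J (x, y) * log 2 (margY J y))"
    by (simp add: sum_subtractf)
  also have "(\<Sum>x\<in>UNIV. \<Sum>y\<in>UNIV. J (x, y) * log 2 (margY J y)) = (\<Sum>y\<in>UNIV. xlog (margY J y))"
    by (subst sum.swap) (simp add: xlog_def margY_def sum_distrib_right)
  also have "(\<Sum>x\<in>UNIV. \<Sum>y\<in>UNIV. J (x, y) * log 2 (margX J x)) = (\<Sum>x\<in>UNIV. xlog (margX J x))"
    by (simp add: xlog_def margX_def sum_distrib_right)
  finally show ?thesis by (simp add: sum_UNIV_pair)
qed

lemma continuous_on_xlog_comp:
  assumes "continuous_on S f" "\<And>v. v \<in> S \<Longrightarrow> 0 \<le> f v"
  shows "continuous_on S (\<lambda>v. xlog (f v))"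
  by (rule continuous_on_compose2[OF continuous_on_xlog assms(1)]) (use assms in auto)

lemma continuous_on_mi:
  "continuous_on {v::real^('x::finite \<times> 'y::finite). \<forall>z. 0 \<le> v $ z} (\<lambda>v. mi (($) v))"
proof -
  let ?S = "{v::real^('x \<times> 'y). \<forall>z. 0 \<le> v $ z}"
  have "continuous_on ?S (\<lambda>v. (\<Sum>z\<in>UNIV. xlog (v $ z)) - (\<Sum>x\<in>UNIV. xlog (margX (($) v) x)) - (\<Sum>y\<in>UNIV. xlog (margY (($) v) y)))"
    unfolding margX_def margY_def
    by (intro continuous_intros continuous_on_xlog_comp) (auto intro: sum_nonneg)
  then show ?thesis
    by (rule continuous_on_eq) (subst mi_eq_xlog, simp_all del: split_paired_All)
qed

section \<open>Divergence, mutual information and rate-distortion as finite sums\<close>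

lemma KL_divergence_pmf:
  fixes P Q :: "'a::finite pmf"
  assumes "\<And>x. pmf P x = 0 \<Longrightarrow> pmf Q x = 0"
  shows "KL_divergence 2 (measure_pmf P) (measure_pmf Q) = (\<Sum>x\<in>UNIV. pmf Q x * log 2 (pmf Q x / pmf P x))"
proof -
  interpret sigma_finite_measure "count_space (UNIV::'a set)"
    by (rule sigma_finite_measure_count_space_finite) simp
  have "KL_divergence 2 (measure_pmf P) (measure_pmf Q)
      = (\<integral>x. pmf Q x * log 2 (pmf Q x / pmf P x) \<partial>count_space UNIV)"
    unfolding measure_pmf_eq_density[of P] measure_pmf_eq_density[of Q]
    by (rule KL_density_density) (use assms in \<open>auto simp: AE_count_space\<close>)
  then show ?thesis by (simp add: lebesgue_integral_count_space_finite)
qed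

definition kl :: "('x::finite \<Rightarrow> real) \<Rightarrow> ('x \<Rightarrow> real) \<Rightarrow> real" where
  "kl q p = (\<Sum>x\<in>UNIV. q x * log 2 (q x / p x))"

lemma relative_entropy_eq:
  fixes P Q :: "'x::finite pmf"
  assumes "set_pmf P = UNIV"
  shows "relative_entropy Q P = kl (pmf Q) (pmf P)"
  unfolding relative_entropy_def kl_def
  by (rule KL_divergence_pmf) (use assms in \<open>auto simp: pmf_eq_0_set_pmf\<close>)

lemma pmf_map_fst: "pmf (map_pmf fst (J :: ('x::finite \<times> 'y::finite) pmf)) x = margX (pmf J) x"
proof -
  have "pmf (map_pmf fst J) x = sum (pmf J) (fst -` {x})"
    by (simp add: pmf_map measure_measure_pmf_finite)
  also have "fst -` {x} = (\<lambda>y. (x, y)) ` (UNIV :: 'y set)" by auto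
  finally show ?thesis by (simp add: margX_def sum.reindex inj_on_def)
qed

lemma pmf_map_snd: "pmf (map_pmf snd (J :: ('x::finite \<times> 'y::finite) pmf)) y = margY (pmf J) y"
proof -
  have "pmf (map_pmf snd J) y = sum (pmf J) (snd -` {y})"
    by (simp add: pmf_map measure_measure_pmf_finite)
  also have "snd -` {y} = (\<lambda>x. (x, y)) ` (UNIV :: 'x set)" by auto
  finally show ?thesis by (simp add: margY_def sum.reindex inj_on_def)
qed

text \<open>Mutual information is by definition the divergence of the joint law from the product of
  the marginals. The work lies in identifying the product measure with a \<open>pair_pmf\<close>;
  absolute continuity holds because a joint mass is at most either of its marginals.\<close>

lemma mutual_info_eq:
  fixes J :: "('x::finite \<times> 'y::finite) pmf"
  shows "mutual_info J = mi (pmf J)"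
proof -
  have f: "distr (measure_pmf J) (count_space UNIV) g = measure_pmf (map_pmf g J)" for g :: "'x \<times> 'y \<Rightarrow> 'c"
    by (simp add: map_pmf_rep_eq)
  have cs: "count_space (UNIV::'x set) \<Otimes>\<^sub>M count_space (UNIV::'y set) = count_space UNIV"
    by (simp add: pair_measure_countable)
  have pp: "measure_pmf (map_pmf fst J) \<Otimes>\<^sub>M measure_pmf (map_pmf snd J) = measure_pmf (pair_pmf (map_pmf fst J) (map_pmf snd J))"
    (is "?L = ?R")
  proof (rule measure_eqI_countable[of _ UNIV])
    have "sets ?L = sets (count_space (UNIV::'x set) \<Otimes>\<^sub>M count_space (UNIV::'y set))"
      by (intro sets_pair_measure_cong) auto
    then show "sets ?L = Pow UNIV" unfolding cs by simp
    fix a :: "'x \<times> 'y"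
    obtain x y where [simp]: "a = (x, y)" by (cases a)
    have "emeasure ?L ({x} \<times> {y}) = emeasure (map_pmf fst J) {x} * emeasure (map_pmf snd J) {y}"
      by (intro sigma_finite_measure.emeasure_pair_measure_Times measure_pmf.sigma_finite_measure_axioms) auto
    then show "emeasure ?L {a} = emeasure ?R {a}"
      by (simp add: emeasure_pmf_single pmf_pair ennreal_mult)
  qed auto
  have "mutual_info J = KL_divergence 2 (measure_pmf (pair_pmf (map_pmf fst J) (map_pmf snd J))) (measure_pmf J)"
    unfolding mutual_info_def prob_space.mutual_information_def[OF measure_pmf.prob_space_axioms] by (simp add: f cs pp)
  also have "\<dots> = (\<Sum>z\<in>UNIV. pmf J z * log 2 (pmf J z / pmf (pair_pmf (map_pmf fst J) (map_pmf snd J)) z))"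
  proof (rule KL_divergence_pmf)
    fix z :: "'x \<times> 'y" assume 0: "pmf (pair_pmf (map_pmf fst J) (map_pmf snd J)) z = 0"
    obtain x y where [simp]: "z = (x, y)" by (cases z)
    show "pmf J z = 0"
      using 0 marg_ge[of "pmf J" x y] pmf_nonneg[of J z] by (auto simp: pmf_pair pmf_map_fst pmf_map_snd)
  qed
  also have "\<dots> = mi (pmf J)"
    unfolding mi_def by (intro sum.cong refl) (auto simp: pmf_pair pmf_map_fst pmf_map_snd)
  finally show ?thesis .
qed

lemma pmf_bind_pair:
  "pmf (bind_pmf p (\<lambda>x. bind_pmf (W x) (\<lambda>y. return_pmf (x, y)))) (x, y) = pmf p x * pmf (W x) y"
proof -
  have m: "pmf (map_pmf (Pair a) (W a)) (x, y) = pmf (W x) y * indicator {x} a" for a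
  proof (cases "a = x")
    case True
    then have "pmf (map_pmf (Pair a) (W a)) (x, y) = pmf (W a) y"
      using pmf_map_inj'[of "Pair a" "W a" y] by (simp add: inj_on_def)
    then show ?thesis using True by simp
  next
    case False
    then have "Pair a -` {(x, y)} = {}" by auto
    then show ?thesis using False by (simp add: pmf_map)
  qed
  have "pmf (bind_pmf p (\<lambda>x. bind_pmf (W x) (\<lambda>y. return_pmf (x, y)))) (x, y)
      = (\<integral>a. pmf (map_pmf (Pair a) (W a)) (x, y) \<partial>p)"
    by (simp add: pmf_bind map_pmf_def[symmetric])
  also have "\<dots> = pmf (W x) y * pmf p x" unfolding m by (simp add: measure_pmf_single)
  finally show ?thesis by simp
qed

lemma pmf_channel_joint: "pmf (channel_joint Q W) (x, y) = pmf Q x * pmf (W x) y"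
  unfolding channel_joint_def by (rule pmf_bind_pair)

lemma expectation_channel_joint:
  fixes Q :: "'x::finite pmf" and W :: "'x \<Rightarrow> 'y::finite pmf"
  shows "measure_pmf.expectation (channel_joint Q W) (\<lambda>(x, y). d x y) = (\<Sum>(x, y)\<in>UNIV. pmf Q x * pmf (W x) y * d x y)"
proof -
  have "measure_pmf.expectation (channel_joint Q W) (\<lambda>(x, y). d x y)
      = (\<Sum>z\<in>UNIV. (case z of (x, y) \<Rightarrow> d x y) * pmf (channel_joint Q W) z)"
    by (rule integral_measure_pmf_real) auto
  also have "\<dots> = (\<Sum>(x, y)\<in>UNIV. pmf Q x * pmf (W x) y * d x y)"
    by (rule sum.cong[OF refl]) (clarsimp simp: pmf_channel_joint)
  finally show ?thesis .
qed

lemma exists_pmf: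
  fixes w :: "'a::finite \<Rightarrow> real"
  assumes "\<And>a. 0 \<le> w a" "sum w UNIV = 1"
  obtains p where "pmf p = w"
proof -
  have "(\<integral>\<^sup>+ x. ennreal (w x) \<partial>count_space UNIV) = 1"
    using assms by (simp add: nn_integral_count_space_finite sum_ennreal)
  then have "pmf (embed_pmf w) x = w x" for x by (intro pmf_embed_pmf assms(1))
  then show thesis using that by blast
qed

text \<open>A joint law with first marginal \<open>Q\<close> disintegrates into \<open>Q\<close> and
  a channel. At a letter with pmf Q x = 0 the row of \<open>J\<close> vanishes, so any output law
  can stand there.\<close>

lemma rate_distortion_le:
  fixes Q :: "'x::finite pmf" and J :: "'x \<times> 'y::finite \<Rightarrow> real"
  assumes nn: "\<And>z. 0 \<le> J z" and marg: "margX J = pmf Q"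
    and dist: "(\<Sum>(x, y)\<in>UNIV. J (x, y) * d x y) \<le> D"
  shows "rate_distortion d Q D \<le> ereal (mi J)"
proof -
  have "\<exists>w. \<forall>y. J (x, y) = pmf Q x * pmf w y" for x
  proof (cases "pmf Q x = 0")
    case True
    then have "J (x, y) = 0" for y using marg_ge(1)[of J x y] nn[of "(x, y)"] by (simp add: marg nn)
    then show ?thesis using True by auto
  next
    case False
    then have pos: "pmf Q x > 0" by (simp add: pmf_nonneg order.strict_iff_order)
    obtain w where "pmf w = (\<lambda>y. J (x, y) / pmf Q x)"
    proof (rule exists_pmf[of "\<lambda>y. J (x, y) / pmf Q x"])
      show "(\<Sum>y\<in>UNIV. J (x, y) / pmf Q x) = 1"
        using fun_cong[OF marg, of x] pos by (simp add: margX_def sum_divide_distrib[symmetric])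
    qed (use nn in auto)
    then show ?thesis using pos by (intro exI[of _ w]) auto
  qed
  then obtain W where W: "\<And>x y. J (x, y) = pmf Q x * pmf (W x) y" by metis
  have J: "pmf (channel_joint Q W) = J" by (auto simp: fun_eq_iff pmf_channel_joint W)
  have "measure_pmf.expectation (channel_joint Q W) (\<lambda>(x, y). d x y) \<le> D"
    using dist by (simp add: expectation_channel_joint W)
  then show ?thesis unfolding rate_distortion_def
    by (intro INF_lower2[of W]) (auto simp: mutual_info_eq J)
qed

lemma rate_distortion_lessE:
  fixes Q :: "'x::finite pmf" and d :: "'x \<Rightarrow> 'y::finite \<Rightarrow> real"
  assumes "rate_distortion d Q D < ereal c"
  obtains W where "(\<Sum>(x, y)\<in>UNIV. pmf Q x * pmf (W x) y * d x y) \<le> D"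
    "mi (\<lambda>(x, y). pmf Q x * pmf (W x) y) < c"
proof -
  obtain W where W: "measure_pmf.expectation (channel_joint Q W) (\<lambda>(x, y). d x y) \<le> D"
      "mutual_info (channel_joint Q W) < c"
    using assms by (auto simp: rate_distortion_def INF_less_iff)
  have "pmf (channel_joint Q W) = (\<lambda>(x, y). pmf Q x * pmf (W x) y)"
    by (auto simp: fun_eq_iff pmf_channel_joint)
  then show thesis using that[of W] W by (simp add: expectation_channel_joint mutual_info_eq)
qed

lemma rate_distortion_nonneg:
  fixes Q :: "'x::finite pmf" and d :: "'x \<Rightarrow> 'y::finite \<Rightarrow> real"
  shows "0 \<le> rate_distortion d Q D"
  unfolding rate_distortion_def
  by (intro INF_greatest) (auto simp: mutual_info_eq sum_pmf_eq_1 intro!: mi_nonneg)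

section \<open>Compactness of the simplex and semicontinuity of the rate-distortion function\<close>

definition prob_simplex :: "(real^'a::finite) set" where
  "prob_simplex = {v. (\<forall>i. 0 \<le> v $ i) \<and> (\<Sum>i\<in>UNIV. v $ i) = 1}"

lemma compact_prob_simplex: "compact (prob_simplex :: (real^'a::finite) set)"
proof -
  have "norm v \<le> 1" if "v \<in> prob_simplex" for v :: "real^'a"
    using norm_le_l1_cart[of v] that by (simp add: prob_simplex_def)
  then have "bounded (prob_simplex :: (real^'a) set)" by (auto simp: bounded_iff)
  moreover have "closed (prob_simplex :: (real^'a) set)"
  proof -
    have "prob_simplex = (\<Inter>i. {v::real^'a. 0 \<le> v $ i}) \<inter> {v. (\<Sum>i\<in>UNIV. v $ i) = 1}"
      by (auto simp: prob_simplex_def)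
    also have "closed \<dots>"
      by (auto intro!: closed_Int closed_INT closed_Collect_le closed_Collect_eq continuous_intros)
    finally show ?thesis .
  qed
  ultimately show ?thesis by (simp add: compact_eq_bounded_closed)
qed

text \<open>If no tolerance worked, joint laws violating the bound with tolerances 1/(n+1) would
  have a limit point in the simplex. That limit has marginal exactly \<open>Q\<close>, distortion at
  most \<open>D\<close> and, by continuity, mutual information at most c, which contradicts the
  choice of c. The same \<eta> relaxes the source and the distortion level.\<close>

lemma rate_distortion_lsc:
  fixes Q :: "'x::finite pmf" and d :: "'x \<Rightarrow> 'y::finite \<Rightarrow> real"
  assumes c: "ereal c < rate_distortion d Q D"
  obtains \<eta> where "\<eta> > 0" "\<And>J. (\<And>z. 0 \<le> J z) \<Longrightarrow> sum J UNIV = 1 \<Longrightarrow> (\<And>x. \<bar>margX J x - pmf Q x\<bar> \<le> \<eta>)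
      \<Longrightarrow> (\<Sum>(x, y)\<in>UNIV. J (x, y) * d x y) \<le> D + \<eta> \<Longrightarrow> c \<le> mi J"
proof (rule ccontr)
  assume no: "\<not> thesis"
  have ex: "\<exists>J. (\<forall>z. 0 \<le> J z) \<and> sum J UNIV = 1 \<and> (\<forall>x. \<bar>margX J x - pmf Q x\<bar> \<le> inverse (real (Suc n)))
      \<and> (\<Sum>(x, y)\<in>UNIV. J (x, y) * d x y) \<le> D + inverse (real (Suc n)) \<and> mi J < c" for n
  proof (rule ccontr)
    assume neg: "\<nexists>J. (\<forall>z. 0 \<le> J z) \<and> sum J UNIV = 1 \<and> (\<forall>x. \<bar>margX J x - pmf Q x\<bar> \<le> inverse (real (Suc n)))
      \<and> (\<Sum>(x, y)\<in>UNIV. J (x, y) * d x y) \<le> D + inverse (real (Suc n)) \<and> mi J < c"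
    have thesis
    proof (rule that)
      fix J :: "'x \<times> 'y \<Rightarrow> real"
      assume "\<And>z. 0 \<le> J z" "sum J UNIV = 1" "\<And>x. \<bar>margX J x - pmf Q x\<bar> \<le> inverse (real (Suc n))"
        "(\<Sum>(x, y)\<in>UNIV. J (x, y) * d x y) \<le> D + inverse (real (Suc n))"
      then show "c \<le> mi J" using neg not_le by blast
    qed simp
    then show False using no by simp
  qed
  from ex have "\<forall>n. \<exists>J. (\<forall>z. 0 \<le> J z) \<and> sum J UNIV = 1 \<and> (\<forall>x. \<bar>margX J x - pmf Q x\<bar> \<le> inverse (real (Suc n)))
      \<and> (\<Sum>(x, y)\<in>UNIV. J (x, y) * d x y) \<le> D + inverse (real (Suc n)) \<and> mi J < c"
    by (intro allI)
  from choice[OF this] obtain J where J': "\<forall>n. (\<forall>z. 0 \<le> J n z) \<and> sum (J n) UNIV = 1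
      \<and> (\<forall>x. \<bar>margX (J n) x - pmf Q x\<bar> \<le> inverse (real (Suc n)))
      \<and> (\<Sum>(x, y)\<in>UNIV. J n (x, y) * d x y) \<le> D + inverse (real (Suc n)) \<and> mi (J n) < c"
    by (elim exE)
  have J: "\<And>n z. 0 \<le> J n z" "\<And>n. sum (J n) UNIV = 1"
    "\<And>n x. \<bar>margX (J n) x - pmf Q x\<bar> \<le> inverse (real (Suc n))"
    "\<And>n. (\<Sum>(x, y)\<in>UNIV. J n (x, y) * d x y) \<le> D + inverse (real (Suc n))"
    "\<And>n. mi (J n) < c" using J' by blast+
  define v where "v n = (\<chi> z. J n z)" for n
  have "v n \<in> prob_simplex" for n using J by (simp add: v_def prob_simplex_def)
  then obtain l s where l: "l \<in> prob_simplex" "strict_mono s" "(v \<circ> s) \<longlonglongrightarrow> l"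
    using compact_prob_simplex[unfolded compact_def] by blast
  have lim: "(\<lambda>n. J (s n) z) \<longlonglongrightarrow> l $ z" for z
    using tendsto_vec_nth[OF l(3), of z] by (simp add: v_def)
  have inv0: "(\<lambda>n. inverse (real (Suc (s n)))) \<longlonglongrightarrow> 0"
    using LIMSEQ_subseq_LIMSEQ[OF LIMSEQ_inverse_real_of_nat l(2)] by (simp add: o_def)
  let ?L = "($) l"
  have nn: "0 \<le> ?L z" for z using l(1) by (simp add: prob_simplex_def del: split_paired_All)
  have marg: "margX ?L x = pmf Q x" for x
  proof -
    have "(\<lambda>n. margX (J (s n)) x) \<longlonglongrightarrow> margX ?L x"
      unfolding margX_def by (intro tendsto_sum lim)
    moreover have "(\<lambda>n. margX (J (s n)) x - pmf Q x) \<longlonglongrightarrow> 0"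
      by (rule Lim_null_comparison[OF _ inv0]) (use J(3) in simp)
    then have "(\<lambda>n. margX (J (s n)) x) \<longlonglongrightarrow> pmf Q x" by (simp add: LIM_zero_iff)
    ultimately show ?thesis by (rule LIMSEQ_unique)
  qed
  have dist: "(\<Sum>(x, y)\<in>UNIV. ?L (x, y) * d x y) \<le> D"
  proof (rule LIMSEQ_le)
    show "(\<lambda>n. \<Sum>(x, y)\<in>UNIV. J (s n) (x, y) * d x y) \<longlonglongrightarrow> (\<Sum>(x, y)\<in>UNIV. ?L (x, y) * d x y)"
      unfolding split_beta by (intro tendsto_sum tendsto_mult_right) (simp add: lim)
    show "(\<lambda>n. D + inverse (real (Suc (s n)))) \<longlonglongrightarrow> D"
      using tendsto_add[OF tendsto_const inv0, of D] by simp
  qed (use J(4) in auto)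
  have "(\<lambda>n. mi (($) ((v \<circ> s) n))) \<longlonglongrightarrow> mi ?L"
    by (rule continuous_on_tendsto_compose[OF continuous_on_mi l(3)])
      (use nn J in \<open>auto simp: v_def\<close>)
  moreover have "mi (($) ((v \<circ> s) n)) \<le> c" for n
  proof -
    have "($) ((v \<circ> s) n) = J (s n)" by (simp add: v_def fun_eq_iff del: split_paired_All)
    then show ?thesis using J(5)[of "s n"] by simp
  qed
  ultimately have "mi ?L \<le> c" by (blast intro: LIMSEQ_le_const2)
  moreover have "rate_distortion d Q D \<le> ereal (mi ?L)"
    by (rule rate_distortion_le) (use nn marg dist in auto)
  ultimately show False using c by (meson ereal_less_eq(3) leD order_trans)
qed

subsection \<open>Sequences, concentration and types\<close>

abbreviation words :: "nat \<Rightarrow> 'a list set" where "words n \<equiv> {xs. length xs = n}"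

lemma finite_words: "finite (words n :: 'a::finite list set)"
  using finite_lists_length_eq[of "UNIV :: 'a set" n] by simp

lemma card_words: "card (words n :: 'a::finite list set) = CARD('a) ^ n"
  using card_lists_length_eq[of "UNIV :: 'a set" n] by simp

lemma sum_words_Suc:
  fixes f :: "'a::finite list \<Rightarrow> 'c::comm_monoid_add"
  shows "(\<Sum>xs\<in>words (Suc n). f xs) = (\<Sum>x\<in>UNIV. \<Sum>xs\<in>words n. f (x # xs))"
proof -
  have eq: "words (Suc n) = (\<lambda>(x, xs). x # xs) ` (UNIV \<times> (words n :: 'a list set))"
    by (force simp: length_Suc_conv)
  have "inj_on (\<lambda>(x, xs). x # xs) (UNIV \<times> (words n :: 'a list set))" by (auto simp: inj_on_def)
  then have "(\<Sum>xs\<in>words (Suc n). f xs) = (\<Sum>(x, xs)\<in>UNIV \<times> words n. f (x # xs))"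
    unfolding eq by (subst sum.reindex) (auto simp: split_beta)
  then show ?thesis by (simp add: sum.cartesian_product)
qed

text \<open>The memoryless extension of the channel \<open>W\<close>, evaluated at a pair of words.
  Zipping truncates to the shorter word, hence the equal-length hypotheses in what follows.\<close>

definition wprod :: "('a \<Rightarrow> 'b \<Rightarrow> real) \<Rightarrow> 'a list \<Rightarrow> 'b list \<Rightarrow> real" where
  "wprod W xs ys = prod_list (map2 W xs ys)"

definition wsum :: "('a \<Rightarrow> 'b \<Rightarrow> real) \<Rightarrow> 'a list \<Rightarrow> 'b list \<Rightarrow> real" where
  "wsum h xs ys = sum_list (map2 h xs ys)"

lemma wprod_simps [simp]:
  "wprod W [] ys = 1" "wprod W (x # xs) (y # ys) = W x y * wprod W xs ys"
  by (simp_all add: wprod_def)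

lemma wsum_simps [simp]:
  "wsum h [] ys = 0" "wsum h (x # xs) (y # ys) = h x y + wsum h xs ys"
  by (simp_all add: wsum_def)

lemma wprod_nonneg: "(\<And>x y. 0 \<le> W x y) \<Longrightarrow> 0 \<le> wprod W xs ys"
  unfolding wprod_def by (intro prod_list_nonneg) auto

lemma sum_wprod:
  fixes W :: "'a \<Rightarrow> 'b::finite \<Rightarrow> real"
  assumes "\<And>x. (\<Sum>y\<in>UNIV. W x y) = 1"
  shows "(\<Sum>ys\<in>words (length xs). wprod W xs ys) = 1"
  by (induction xs) (simp_all add: sum_words_Suc sum_distrib_left[symmetric] assms)

text \<open>Given xs, the coordinates are independent and centred, so variances add. Both moments go
  through one induction because the vanishing first moment removes the cross term from the
  second.\<close>

lemma wprod_moments: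
  fixes W g :: "'a \<Rightarrow> 'b::finite \<Rightarrow> real"
  assumes W: "\<And>x y. 0 \<le> W x y" "\<And>x. (\<Sum>y\<in>UNIV. W x y) = 1"
    and g: "\<And>x. (\<Sum>y\<in>UNIV. W x y * g x y) = 0" "\<And>x y. \<bar>g x y\<bar> \<le> B"
  shows "(\<Sum>ys\<in>words (length xs). wprod W xs ys * wsum g xs ys) = 0 \<and>
    (\<Sum>ys\<in>words (length xs). wprod W xs ys * (wsum g xs ys)\<^sup>2) \<le> real (length xs) * B\<^sup>2"
proof (induction xs)
  case (Cons x xs)
  let ?w = "\<lambda>ys. wprod W xs ys" and ?s = "\<lambda>ys. wsum g xs ys" and ?A = "words (length xs)"
  have 1: "(\<Sum>ys\<in>?A. ?w ys) = 1" by (rule sum_wprod[OF W(2)])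
  have "(\<Sum>ys\<in>words (length (x # xs)). wprod W (x # xs) ys * wsum g (x # xs) ys)
     = (\<Sum>y\<in>UNIV. \<Sum>ys\<in>?A. W x y * g x y * ?w ys + W x y * (?w ys * ?s ys))"
    by (simp add: sum_words_Suc algebra_simps)
  also have "\<dots> = (\<Sum>y\<in>UNIV. W x y * g x y * 1 + W x y * 0)"
    using Cons 1 by (simp add: sum.distrib sum_distrib_left[symmetric])
  also have "\<dots> = 0" using g by simp
  finally have fst: "(\<Sum>ys\<in>words (length (x # xs)). wprod W (x # xs) ys * wsum g (x # xs) ys) = 0" .
  have "(\<Sum>ys\<in>words (length (x # xs)). wprod W (x # xs) ys * (wsum g (x # xs) ys)\<^sup>2)
     = (\<Sum>y\<in>UNIV. \<Sum>ys\<in>?A. W x y * (g x y)\<^sup>2 * ?w ys + 2 * W x y * g x y * (?w ys * ?s ys)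
          + W x y * (?w ys * (?s ys)\<^sup>2))"
    by (simp add: sum_words_Suc power2_eq_square algebra_simps)
  also have "\<dots> = (\<Sum>y\<in>UNIV. W x y * (g x y)\<^sup>2 + W x y * (\<Sum>ys\<in>?A. ?w ys * (?s ys)\<^sup>2))"
    using Cons 1 by (simp add: sum.distrib sum_distrib_left[symmetric])
  also have "\<dots> \<le> (\<Sum>y\<in>UNIV. W x y * B\<^sup>2 + W x y * (real (length xs) * B\<^sup>2))"
    using Cons g(2) W by (intro sum_mono add_mono mult_left_mono) (auto simp: abs_le_square_iff[symmetric] intro: order.trans[OF _ abs_ge_self])
  also have "\<dots> = real (length (x # xs)) * B\<^sup>2"
    by (simp add: sum.distrib sum_distrib_right[symmetric] W) (simp add: algebra_simps)
  finally show ?case using fst by blast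
qed simp

lemma wsum_diff:
  assumes "length xs = length ys"
  shows "wsum (\<lambda>x y. h x y - m x) xs ys = wsum h xs ys - sum_list (map m xs)"
  using assms by (induction xs ys rule: list_induct2) auto

text \<open>Chebyshev for independent coordinates that are not identically distributed, since xs is
  arbitrary. The bound depends on xs through its length only, so it holds uniformly over
  words.\<close>

lemma chebyshev_wprod:
  fixes W h :: "'a \<Rightarrow> 'b::finite \<Rightarrow> real"
  assumes W: "\<And>x y. 0 \<le> W x y" "\<And>x. (\<Sum>y\<in>UNIV. W x y) = 1"
    and h: "\<And>x y. \<bar>h x y - (\<Sum>y\<in>UNIV. W x y * h x y)\<bar> \<le> B"
    and n: "length xs = n" "n > 0" and t: "t > 0"
  shows "(\<Sum>ys\<in>{ys \<in> words n. wsum h xs ys \<ge> (\<Sum>x\<leftarrow>xs. \<Sum>y\<in>UNIV. W x y * h x y) + real n * t}. wprod W xs ys)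
    \<le> B\<^sup>2 / (real n * t\<^sup>2)"
proof -
  define m where "m x = (\<Sum>y\<in>UNIV. W x y * h x y)" for x
  define g where "g x y = h x y - m x" for x y
  let ?E = "{ys \<in> words n. wsum h xs ys \<ge> sum_list (map m xs) + real n * t}"
  have g0: "(\<Sum>y\<in>UNIV. W x y * g x y) = 0" for x
    by (simp add: g_def right_diff_distrib sum_subtractf sum_distrib_right[symmetric] W m_def)
  have "(\<Sum>ys\<in>?E. wprod W xs ys) * (real n * t)\<^sup>2 = (\<Sum>ys\<in>?E. wprod W xs ys * (real n * t)\<^sup>2)"
    by (simp add: sum_distrib_right)
  also have "\<dots> \<le> (\<Sum>ys\<in>?E. wprod W xs ys * (wsum g xs ys)\<^sup>2)"
  proof (intro sum_mono mult_left_mono wprod_nonneg W power_mono)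
    fix ys assume "ys \<in> ?E"
    then show "real n * t \<le> wsum g xs ys"
      unfolding g_def[abs_def] using n by (subst wsum_diff) auto
  qed (use t in auto)
  also have "\<dots> \<le> (\<Sum>ys\<in>words n. wprod W xs ys * (wsum g xs ys)\<^sup>2)"
    by (intro sum_mono2 finite_words) (auto intro!: mult_nonneg_nonneg wprod_nonneg W)
  also have "\<dots> \<le> real n * B\<^sup>2"
    using wprod_moments[of W g B xs, OF W g0] h n by (simp add: g_def m_def)
  finally have "(\<Sum>ys\<in>?E. wprod W xs ys) * (real n * t)\<^sup>2 \<le> real n * B\<^sup>2" .
  then show ?thesis using n t unfolding m_def by (simp add: field_simps power2_eq_square)
qed

lemma seq_distortion_eq_wsum:
  assumes "length xs = n" "length ys = n"
  shows "seq_distortion d n xs ys = wsum d xs ys / real n"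
  using assms by (simp add: seq_distortion_def wsum_def sum_list_sum_nth atLeast0LessThan)

lemma pmf_replicate_pmf:
  fixes P :: "'a::finite pmf"
  assumes "length xs = n"
  shows "pmf (replicate_pmf n P) xs = prod_list (map (pmf P) xs)"
  using assms
proof (induction n arbitrary: xs)
  case (Suc n)
  then obtain x ys where xs: "xs = x # ys" "length ys = n" by (cases xs) auto
  have m: "pmf (map_pmf (Cons a) (replicate_pmf n P)) (x # ys) = (if a = x then pmf (replicate_pmf n P) ys else 0)" for a
  proof (cases "a = x")
    case True
    then show ?thesis using pmf_map_inj'[of "Cons a" "replicate_pmf n P" ys] by (simp add: inj_on_def)
  next
    case False
    then have "Cons a -` {x # ys} = {}" by auto
    then show ?thesis using False by (simp add: pmf_map)
  qed
  have "replicate_pmf (Suc n) P = bind_pmf P (\<lambda>a. map_pmf (Cons a) (replicate_pmf n P))"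
    by (simp add: map_pmf_def)
  then have "pmf (replicate_pmf (Suc n) P) xs = (\<Sum>a\<in>UNIV. pmf (map_pmf (Cons a) (replicate_pmf n P)) xs * pmf P a)"
    by (simp only: pmf_bind) (rule integral_measure_pmf_real, auto)
  also have "\<dots> = (\<Sum>a\<in>UNIV. if a = x then pmf (replicate_pmf n P) ys * pmf P x else 0)"
    unfolding xs m by (rule sum.cong) auto
  finally show ?case using Suc.IH[OF xs(2)] by (simp add: xs(1))
qed simp

section \<open>Types of words and the product laws they induce\<close>

definition emp :: "'a list \<Rightarrow> 'a \<Rightarrow> real" where
  "emp xs a = real (count_list xs a) / real (length xs)"

lemma emp_nonneg: "0 \<le> emp xs a"
  by (simp add: emp_def)

text \<open>Any additive functional of a word is linear in its type. This is what turns requirements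
  on words into half-spaces of types.\<close>

lemma sum_list_eq_emp:
  fixes f :: "'a::finite \<Rightarrow> real"
  shows "sum_list (map f xs) = real (length xs) * (\<Sum>a\<in>UNIV. emp xs a * f a)"
proof -
  have "sum_list (map f xs) = (\<Sum>a\<in>UNIV. real (count_list xs a) * f a)"
  proof (induction xs)
    case (Cons x xs)
    have "(\<Sum>a\<in>UNIV. real (count_list (x # xs) a) * f a)
        = (\<Sum>a\<in>UNIV. real (count_list xs a) * f a + (if a = x then f x else 0))"
      by (intro sum.cong) (auto simp: algebra_simps)
    then show ?case using Cons by (simp add: sum.distrib)
  qed simp
  then show ?thesis by (cases "xs = []") (auto simp: emp_def sum_distrib_left)
qed

lemma sum_emp:
  fixes xs :: "'a::finite list"
  assumes "xs \<noteq> []" shows "(\<Sum>a\<in>UNIV. emp xs a) = 1"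
proof -
  have "real (length xs) * (\<Sum>a\<in>UNIV. emp xs a) = real (length xs)"
    using sum_list_eq_emp[of "\<lambda>_. 1" xs] by (simp add: sum_list_triv)
  then show ?thesis using assms by simp
qed

lemma prod_list_eq_powr:
  assumes "\<And>x. x \<in> set xs \<Longrightarrow> 0 < f x"
  shows "prod_list (map f xs) = 2 powr (\<Sum>x\<leftarrow>xs. log 2 (f x))"
  using assms by (induction xs) (auto simp: powr_add)

text \<open>The basic identity of the method of types: a word's probability under p is 2 to the
  power -n D(type || p) times its probability under its own type. Only letters that occur enter, and
  there the type is positive.\<close>

lemma prod_list_type:
  fixes p :: "'a::finite \<Rightarrow> real"
  assumes p: "\<And>x. 0 < p x"
  shows "prod_list (map p xs) = 2 powr (- (real (length xs) * kl (emp xs) p)) * prod_list (map (emp xs) xs)"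
proof -
  have e: "0 < emp xs x" if "x \<in> set xs" for x
  proof -
    have "count_list xs x \<noteq> 0" using that by (simp add: count_list_0_iff)
    moreover have "xs \<noteq> []" using that by auto
    ultimately show ?thesis by (simp add: emp_def)
  qed
  have "(\<Sum>x\<leftarrow>xs. log 2 (p x)) = (\<Sum>x\<leftarrow>xs. log 2 (emp xs x) - log 2 (emp xs x / p x))"
  proof (intro arg_cong[of _ _ sum_list] map_cong refl)
    fix x assume "x \<in> set xs"
    then show "log 2 (p x) = log 2 (emp xs x) - log 2 (emp xs x / p x)"
      using e[of x] p[of x] by (simp add: log_divide)
  qed
  also have "\<dots> = (\<Sum>x\<leftarrow>xs. log 2 (emp xs x)) - (\<Sum>x\<leftarrow>xs. log 2 (emp xs x / p x))"
    by (simp add: sum_list_subtractf)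
  also have "(\<Sum>x\<leftarrow>xs. log 2 (emp xs x / p x)) = real (length xs) * kl (emp xs) p"
    unfolding kl_def by (rule sum_list_eq_emp)
  finally show ?thesis
    by (simp add: prod_list_eq_powr[of xs p] prod_list_eq_powr[of xs "emp xs"] e p powr_diff powr_minus divide_inverse mult.commute)
qed

lemma sum_prod_list:
  fixes p :: "'a::finite \<Rightarrow> real"
  assumes "sum p UNIV = 1"
  shows "(\<Sum>xs\<in>words n. prod_list (map p xs)) = 1"
  by (induction n) (simp_all add: sum_words_Suc sum_distrib_left[symmetric] assms)

text \<open>For a fixed type q, the product law of q has total mass 1, and there are at most
  (n+1)^|X| types, one for each vector of letter counts. This stands in for an estimate of the size
  of type classes.\<close>

lemma sum_prod_emp_le:
  assumes "n > 0"
  shows "(\<Sum>xs\<in>(words n :: 'a::finite list set). prod_list (map (emp xs) xs)) \<le> real ((n + 1) ^ CARD('a))"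
proof -
  let ?W = "words n :: 'a list set"
  define T where "T = (emp :: 'a list \<Rightarrow> _) ` ?W"
  have finT: "finite T" unfolding T_def by (intro finite_imageI finite_words)
  have "T \<subseteq> (\<lambda>c a. real (c a) / real n) ` (UNIV \<rightarrow>\<^sub>E {..n})"
  proof
    fix q assume "q \<in> T"
    then obtain xs where xs: "length xs = n" "q = emp xs" by (auto simp: T_def)
    have "count_list xs \<in> UNIV \<rightarrow>\<^sub>E {..n}" using xs by (auto simp: count_le_length)
    moreover have "q = (\<lambda>a. real (count_list xs a) / real n)" using xs by (auto simp: emp_def fun_eq_iff)
    ultimately show "q \<in> (\<lambda>c a. real (c a) / real n) ` (UNIV \<rightarrow>\<^sub>E {..n})" by blast
  qed
  then have "card T \<le> card ((\<lambda>c a. real (c a) / real n) ` ((UNIV :: 'a set) \<rightarrow>\<^sub>E {..n}))"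
    by (intro card_mono finite_imageI finite_PiE) auto
  also have "\<dots> \<le> card ((UNIV :: 'a set) \<rightarrow>\<^sub>E {..n})" by (intro card_image_le finite_PiE) auto
  also have "\<dots> = (n + 1) ^ CARD('a)" by (simp add: card_PiE)
  finally have cT: "card T \<le> (n + 1) ^ CARD('a)" .
  have "(\<Sum>xs\<in>?W. prod_list (map (emp xs) xs)) \<le> (\<Sum>xs\<in>?W. \<Sum>q\<in>T. prod_list (map q xs))"
  proof (rule sum_mono)
    fix xs :: "'a list" assume "xs \<in> ?W"
    then show "prod_list (map (emp xs) xs) \<le> (\<Sum>q\<in>T. prod_list (map q xs))"
      by (intro member_le_sum[of "emp xs" T "\<lambda>q. prod_list (map q xs)"] finT)
        (auto simp: T_def emp_nonneg intro!: prod_list_nonneg)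
  qed
  also have "\<dots> = (\<Sum>q\<in>T. \<Sum>xs\<in>?W. prod_list (map q xs))" by (rule sum.swap)
  also have "\<dots> = (\<Sum>q\<in>T. 1)"
  proof (intro sum.cong refl sum_prod_list)
    fix q assume "q \<in> T"
    then obtain xs where "length xs = n" "q = emp xs" by (auto simp: T_def)
    then show "sum q UNIV = 1" using sum_emp[of xs] assms by auto
  qed
  also have "\<dots> \<le> real ((n + 1) ^ CARD('a))" using cT by (simp only: sum_constant mult_1_right of_nat_le_iff)
  finally show ?thesis .
qed

subsection \<open>Message and reproduction laws of a cipher system\<close>

lemma bit_strings_words: "bit_strings t = words (nat \<lfloor>t\<rfloor>)"
  by (simp add: bit_strings_def)

lemma finite_bit_strings: "finite (bit_strings t)"
  by (simp add: bit_strings_words finite_words)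

lemma card_bit_strings: "card (bit_strings t) = 2 ^ nat \<lfloor>t\<rfloor>"
  by (simp add: bit_strings_words card_words)

lemma bit_strings_nonempty: "bit_strings t \<noteq> {}"
proof -
  have "card (bit_strings t) \<noteq> 0" by (simp add: card_bit_strings)
  then show ?thesis by (metis card.empty)
qed

definition msg_prob :: "nat \<Rightarrow> real \<Rightarrow> ('x list \<Rightarrow> bool list \<Rightarrow> bool list pmf) \<Rightarrow> 'x list \<Rightarrow> bool list \<Rightarrow> real" where
  "msg_prob n r f xs m = (\<Sum>k\<in>bit_strings (real n * r). pmf (f xs k) m) / card (bit_strings (real n * r))"

definition max_msg_prob where
  "max_msg_prob n r f m = (MAX xs\<in>words n. msg_prob n r f xs m)"

lemma words_nonempty: "words n \<noteq> {}"
  using Ex_list_of_length[of n] by (simp add: set_eq_iff)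

lemma msg_prob_le_max:
  fixes f :: "'x::finite list \<Rightarrow> bool list \<Rightarrow> bool list pmf"
  shows "length xs = n \<Longrightarrow> msg_prob n r f xs m \<le> max_msg_prob n r f m"
  unfolding max_msg_prob_def by (intro Max_ge finite_imageI finite_words) auto

text \<open>Full support makes every word of length n possible, so the maximum runs over all words
  and the value is free of \<open>P\<close>. Messages that are never sent contribute 0 and may be
  added to the sum.\<close>

lemma maximal_leakage_source_message:
  fixes P :: "'x::finite pmf"
  assumes P: "set_pmf P = UNIV" and f: "encoder n R r f"
  shows "maximal_leakage (source_message_law P n r f) = elog2 (\<Sum>m\<in>bit_strings (real n * R). max_msg_prob n r f m)"
proof -
  let ?J = "source_message_law P n r f" and ?K = "bit_strings (real n * r)" and ?B = "bit_strings (real n * R)"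
  define W where "W xs = bind_pmf (pmf_of_set ?K) (f xs)" for xs
  have J: "?J = bind_pmf (replicate_pmf n P) (\<lambda>xs. bind_pmf (W xs) (\<lambda>m. return_pmf (xs, m)))"
    by (simp add: source_message_law_def W_def bind_assoc_pmf)
  have W: "pmf (W xs) m = msg_prob n r f xs m" for xs m
    unfolding W_def msg_prob_def
    by (rule pmf_bind_pmf_of_set) (simp_all add: finite_bit_strings bit_strings_nonempty)
  have fstJ: "map_pmf fst ?J = replicate_pmf n P"
    by (simp add: J map_bind_pmf bind_return_pmf')
  have setW: "set_pmf (W xs) \<subseteq> ?B" if "length xs = n" for xs
    using f that by (auto simp: W_def encoder_def finite_bit_strings bit_strings_nonempty)
  have setP: "set_pmf (replicate_pmf n P) = words n" by (auto simp: set_replicate_pmf P)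
  have setJ: "set_pmf ?J = (SIGMA xs:words n. set_pmf (W xs))" by (auto simp: J setP)
  have fin: "finite (set_pmf ?J)"
    unfolding setJ by (intro finite_SigmaI finite_words finite_subset[OF setW finite_bit_strings]) simp
  have fsts: "fst ` set_pmf ?J = words n"
    using set_map_pmf[of fst ?J] by (simp add: fstJ setP)
  have snds: "snd ` set_pmf ?J \<subseteq> ?B" 
  proof
    fix m assume "m \<in> snd ` set_pmf ?J"
    then obtain xs where "length xs = n" "m \<in> set_pmf (W xs)" by (auto simp: setJ)
    then show "m \<in> ?B" using setW by blast
  qed
  have Ppos: "pmf (replicate_pmf n P) xs > 0" if "length xs = n" for xs
    using that by (intro pmf_positive) (simp add: setP)
  have "leak_sum ?J = (\<Sum>m\<in>snd ` set_pmf ?J. max_msg_prob n r f m)"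
    unfolding leak_sum_def fsts fstJ max_msg_prob_def
  proof (intro sum.cong refl arg_cong[of _ _ Max] image_cong)
    fix xs :: "'x list" and m assume "xs \<in> words n"
    then show "pmf ?J (xs, m) / pmf (replicate_pmf n P) xs = msg_prob n r f xs m"
      using Ppos[of xs] by (simp add: J pmf_bind_pair W)
  qed
  also have "\<dots> = (\<Sum>m\<in>?B. max_msg_prob n r f m)"
  proof (rule sum.mono_neutral_left[OF finite_bit_strings snds], intro ballI)
    fix m assume m: "m \<in> ?B - snd ` set_pmf ?J"
    have "msg_prob n r f xs m = 0" if "xs \<in> words n" for xs
    proof -
      have "m \<notin> set_pmf (W xs)" using m that unfolding setJ by force
      then show ?thesis by (simp add: W[symmetric] pmf_eq_0_set_pmf)
    qed
    then have "(\<lambda>xs. msg_prob n r f xs m) ` words n = {0}" using words_nonempty[of n] by auto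
    then show "max_msg_prob n r f m = 0" by (simp add: max_msg_prob_def)
  qed
  finally show ?thesis by (simp add: maximal_leakage_eq[OF fin])
qed

definition repro_prob :: "nat \<Rightarrow> real \<Rightarrow> real \<Rightarrow> ('x list \<Rightarrow> bool list \<Rightarrow> bool list pmf)
    \<Rightarrow> (bool list \<Rightarrow> bool list \<Rightarrow> 'y list pmf) \<Rightarrow> 'x list \<Rightarrow> 'y list \<Rightarrow> real" where
  "repro_prob n R r f g xs ys = (\<Sum>k\<in>bit_strings (real n * r). \<Sum>m\<in>bit_strings (real n * R).
      pmf (f xs k) m * pmf (g m k) ys) / card (bit_strings (real n * r))"

lemma repro_prob_nonneg: "0 \<le> repro_prob n R r f g xs ys"
  by (simp add: repro_prob_def sum_nonneg)

lemma sum_decoder: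
  fixes g :: "bool list \<Rightarrow> bool list \<Rightarrow> 'y::finite list pmf"
  assumes "decoder n R r g" "m \<in> bit_strings (real n * R)" "k \<in> bit_strings (real n * r)"
  shows "(\<Sum>ys\<in>words n. pmf (g m k) ys) = 1"
  using assms by (intro sum_pmf_eq_1 finite_words) (auto simp: decoder_def)

lemma sum_encoder:
  assumes "encoder n R r f" "length xs = n" "k \<in> bit_strings (real n * r)"
  shows "(\<Sum>m\<in>bit_strings (real n * R). pmf (f xs k) m) = 1"
  using assms by (intro sum_pmf_eq_1 finite_bit_strings) (auto simp: encoder_def)

lemma sum_repro_prob:
  fixes g :: "bool list \<Rightarrow> bool list \<Rightarrow> 'y::finite list pmf"
  assumes "encoder n R r f" "decoder n R r g" "length xs = n"
  shows "(\<Sum>ys\<in>words n. repro_prob n R r f g xs ys) = 1"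
proof -
  let ?K = "bit_strings (real n * r)" and ?B = "bit_strings (real n * R)"
  have "(\<Sum>ys\<in>words n. repro_prob n R r f g xs ys)
      = (\<Sum>k\<in>?K. \<Sum>m\<in>?B. pmf (f xs k) m * (\<Sum>ys\<in>words n. pmf (g m k) ys)) / card ?K"
    unfolding repro_prob_def sum_divide_distrib[symmetric] sum_distrib_left
    by (subst sum.swap, subst (2) sum.swap) (rule refl)
  also have "\<dots> = (\<Sum>k\<in>?K. \<Sum>m\<in>?B. pmf (f xs k) m) / card ?K"
    using sum_decoder[OF assms(2)] by simp
  also have "\<dots> = 1" using sum_encoder[OF assms(1,3)] by (simp add: card_bit_strings)
  finally show ?thesis .
qed

text \<open>The maxima dominate the message law of any single word. This keeps \<open>elog2\<close>
  away from minus infinity and makes the leakage nonnegative, which is the zero branch of the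
  positive part.\<close>

lemma sum_max_msg_prob_ge_1:
  fixes f :: "'x::finite list \<Rightarrow> bool list \<Rightarrow> bool list pmf"
  assumes "encoder n R r f"
  shows "1 \<le> (\<Sum>m\<in>bit_strings (real n * R). max_msg_prob n r f m)"
proof -
  let ?K = "bit_strings (real n * r)" and ?B = "bit_strings (real n * R)"
  obtain xs :: "'x list" where xs: "length xs = n" using Ex_list_of_length by blast
  have "(\<Sum>m\<in>?B. msg_prob n r f xs m) = (\<Sum>k\<in>?K. \<Sum>m\<in>?B. pmf (f xs k) m) / card ?K"
    unfolding msg_prob_def sum_divide_distrib[symmetric] by (subst sum.swap) (rule refl)
  also have "\<dots> = 1" using sum_encoder[OF assms xs] by (simp add: card_bit_strings)
  finally show ?thesis
    using sum_mono[of ?B "msg_prob n r f xs" "max_msg_prob n r f"] msg_prob_le_max[OF xs, of r f] by simp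
qed

lemma prob_source_reproduction:
  fixes P :: "'x::finite pmf" and g :: "bool list \<Rightarrow> bool list \<Rightarrow> 'y::finite list pmf"
  assumes f: "encoder n R r f" and g: "decoder n R r g"
  shows "measure_pmf.prob (source_reproduction_law P n r f g) E
    = (\<Sum>(xs, ys)\<in>words n \<times> words n. if (xs, ys) \<in> E then prod_list (map (pmf P) xs) * repro_prob n R r f g xs ys else 0)"
proof -
  let ?J = "source_reproduction_law P n r f g" and ?K = "bit_strings (real n * r)" and ?B = "bit_strings (real n * R)"
  define W where "W xs = bind_pmf (pmf_of_set ?K) (\<lambda>k. bind_pmf (f xs k) (\<lambda>m. g m k))" for xs
  have J: "?J = bind_pmf (replicate_pmf n P) (\<lambda>xs. bind_pmf (W xs) (\<lambda>m. return_pmf (xs, m)))"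
    by (simp add: source_reproduction_law_def W_def bind_assoc_pmf)
  have setW: "set_pmf (W xs) \<subseteq> words n" if "length xs = n" for xs
    using f g that unfolding W_def encoder_def decoder_def
    by (force simp: finite_bit_strings bit_strings_nonempty)
  have W: "pmf (W xs) ys = repro_prob n R r f g xs ys" if xs: "length xs = n" for xs ys
  proof -
    have "pmf (W xs) ys = (\<Sum>k\<in>?K. pmf (bind_pmf (f xs k) (\<lambda>m. g m k)) ys) / card ?K"
      unfolding W_def by (rule pmf_bind_pmf_of_set) (simp_all add: finite_bit_strings bit_strings_nonempty)
    also have "(\<Sum>k\<in>?K. pmf (bind_pmf (f xs k) (\<lambda>m. g m k)) ys) = (\<Sum>k\<in>?K. \<Sum>m\<in>?B. pmf (f xs k) m * pmf (g m k) ys)"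
    proof (rule sum.cong[OF refl])
      fix k assume k: "k \<in> ?K"
      have "pmf (bind_pmf (f xs k) (\<lambda>m. g m k)) ys = (\<Sum>m\<in>?B. pmf (g m k) ys * pmf (f xs k) m)"
        unfolding pmf_bind
        by (rule integral_measure_pmf_real) (use f xs k in \<open>auto simp: encoder_def finite_bit_strings\<close>)
      then show "pmf (bind_pmf (f xs k) (\<lambda>m. g m k)) ys = (\<Sum>m\<in>?B. pmf (f xs k) m * pmf (g m k) ys)"
        by (simp add: mult.commute)
    qed
    finally show ?thesis by (simp add: repro_prob_def)
  qed
  have sub: "set_pmf ?J \<subseteq> words n \<times> words n"
    using setW by (auto simp: J set_replicate_pmf)
  have "pmf ?J (xs, ys) = prod_list (map (pmf P) xs) * repro_prob n R r f g xs ys" if "length xs = n" for xs ys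
    using W[OF that] pmf_replicate_pmf[OF that] by (simp add: J pmf_bind_pair)
  then show ?thesis
    by (subst prob_eq_sum_superset[OF _ sub]) (auto simp: finite_words simp del: mem_Collect_eq intro!: sum.cong)
qed

text \<open>A guesser who draws a fresh key, independent of the true one, and runs the decoder hits the
  true key with probability \<open>1 / N\<close>. So the reproduction law is dominated by \<open>N\<close> times the law of
  this guess, whose leakage is at most that of the message.\<close>

lemma repro_prob_le:
  fixes f :: "'x::finite list \<Rightarrow> bool list \<Rightarrow> bool list pmf"
  assumes "length xs = n"
  shows "repro_prob n R r f g xs ys
    \<le> (\<Sum>m\<in>bit_strings (real n * R). max_msg_prob n r f m * (\<Sum>k\<in>bit_strings (real n * r). pmf (g m k) ys))"
proof -
  let ?K = "bit_strings (real n * r)" and ?B = "bit_strings (real n * R)"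
  have "repro_prob n R r f g xs ys = (\<Sum>m\<in>?B. (\<Sum>k\<in>?K. pmf (f xs k) m * pmf (g m k) ys) / card ?K)"
    unfolding repro_prob_def sum_divide_distrib by (rule sum.swap)
  also have "\<dots> \<le> (\<Sum>m\<in>?B. max_msg_prob n r f m * (\<Sum>k\<in>?K. pmf (g m k) ys))"
  proof (rule sum_mono)
    fix m assume "m \<in> ?B"
    \<comment> \<open>Summing over all keys in place of the true one decouples the decoder from the
      encoder: averaging over k then touches \<open>f\<close> alone and gives
      \<open>msg_prob\<close>.\<close>
    have "(\<Sum>k\<in>?K. pmf (f xs k) m * pmf (g m k) ys) \<le> (\<Sum>k\<in>?K. pmf (f xs k) m * (\<Sum>k'\<in>?K. pmf (g m k') ys))"
    proof (intro sum_mono mult_left_mono)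
      fix k assume "k \<in> ?K"
      then show "pmf (g m k) ys \<le> (\<Sum>k'\<in>?K. pmf (g m k') ys)"
        by (intro member_le_sum[of k ?K "\<lambda>k. pmf (g m k) ys"] finite_bit_strings) auto
    qed auto
    then have "(\<Sum>k\<in>?K. pmf (f xs k) m * pmf (g m k) ys) / card ?K
        \<le> (\<Sum>k\<in>?K. pmf (f xs k) m * (\<Sum>k'\<in>?K. pmf (g m k') ys)) / card ?K"
      by (intro divide_right_mono) auto
    also have "\<dots> = msg_prob n r f xs m * (\<Sum>k\<in>?K. pmf (g m k) ys)"
      by (simp add: msg_prob_def sum_distrib_right)
    also have "\<dots> \<le> max_msg_prob n r f m * (\<Sum>k\<in>?K. pmf (g m k) ys)"
      using assms by (intro mult_right_mono msg_prob_le_max sum_nonneg) auto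
    finally show "(\<Sum>k\<in>?K. pmf (f xs k) m * pmf (g m k) ys) / card ?K
        \<le> max_msg_prob n r f m * (\<Sum>k\<in>?K. pmf (g m k) ys)" .
  qed
  finally show ?thesis .
qed

text \<open>Each decoder row has mass 1 over the reproduction words, so summing over ys counts the
  keys.\<close>

lemma sum_repro_bound:
  fixes f :: "'x::finite list \<Rightarrow> bool list \<Rightarrow> bool list pmf" and g :: "bool list \<Rightarrow> bool list \<Rightarrow> 'y::finite list pmf"
  assumes "decoder n R r g"
  shows "(\<Sum>ys\<in>words n. \<Sum>m\<in>bit_strings (real n * R). max_msg_prob n r f m * (\<Sum>k\<in>bit_strings (real n * r). pmf (g m k) ys))
    = 2 ^ nat \<lfloor>real n * r\<rfloor> * (\<Sum>m\<in>bit_strings (real n * R). max_msg_prob n r f m)"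
proof -
  let ?K = "bit_strings (real n * r)" and ?B = "bit_strings (real n * R)"
  have "(\<Sum>ys\<in>words n. \<Sum>m\<in>?B. max_msg_prob n r f m * (\<Sum>k\<in>?K. pmf (g m k) ys))
      = (\<Sum>m\<in>?B. max_msg_prob n r f m * (\<Sum>k\<in>?K. \<Sum>ys\<in>words n. pmf (g m k) ys))"
    by (subst sum.swap, simp only: sum_distrib_left[symmetric], subst sum.swap) (rule refl)
  also have "\<dots> = (\<Sum>m\<in>?B. max_msg_prob n r f m * card ?K)"
    using sum_decoder[OF assms] by simp
  finally show ?thesis by (simp only: card_bit_strings sum_distrib_right[symmetric]) (simp add: mult.commute)
qed

subsection \<open>The converse\<close>

text \<open>Needed for the backward channel of a joint law, whose rows sum to 0 at outputs without
  mass.\<close>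

lemma sum_wprod_le:
  fixes W :: "'a \<Rightarrow> 'b::finite \<Rightarrow> real"
  assumes "\<And>x y. 0 \<le> W x y" "\<And>x. (\<Sum>y\<in>UNIV. W x y) \<le> 1"
  shows "(\<Sum>ys\<in>words (length xs). wprod W xs ys) \<le> 1"
proof (induction xs)
  case (Cons x xs)
  have "(\<Sum>ys\<in>words (length (x # xs)). wprod W (x # xs) ys)
      = (\<Sum>y\<in>UNIV. W x y) * (\<Sum>ys\<in>words (length xs). wprod W xs ys)"
    by (simp add: sum_words_Suc sum_product)
  also have "\<dots> \<le> 1 * 1"
    using Cons assms by (intro mult_mono sum_nonneg wprod_nonneg) auto
  finally show ?case by simp
qed simp

lemma wprod_mult:
  "length xs = length ys \<Longrightarrow> wprod (\<lambda>x y. f x y * g x y) xs ys = wprod f xs ys * wprod g xs ys"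
  by (induction xs ys rule: list_induct2) auto

lemma wprod_fst: "length xs = length ys \<Longrightarrow> wprod (\<lambda>x y. f x) xs ys = prod_list (map f xs)"
  by (induction xs ys rule: list_induct2) auto

lemma wprod_flip: "length xs = length ys \<Longrightarrow> wprod (\<lambda>y x. f x y) ys xs = wprod f xs ys"
  by (induction xs ys rule: list_induct2) auto

lemma wsum_fst: "length xs = length ys \<Longrightarrow> wsum (\<lambda>x y. f x) xs ys = sum_list (map f xs)"
  by (induction xs ys rule: list_induct2) auto

lemma wprod_pos_iff:
  assumes "\<And>x y. 0 \<le> W x y" "length xs = length ys"
  shows "0 < wprod W xs ys \<longleftrightarrow> (\<forall>(x, y)\<in>set (zip xs ys). 0 < W x y)"
  using assms(2)
proof (induction xs ys rule: list_induct2)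
  case (Cons x xs y ys)
  have "0 \<le> W x y" "0 \<le> wprod W xs ys" using assms(1) by (auto intro: wprod_nonneg)
  then show ?case using Cons by (auto simp: zero_less_mult_iff)
qed simp

lemma log_wprod:
  assumes "length xs = length ys" "\<forall>(x, y)\<in>set (zip xs ys). 0 < W x y"
  shows "log 2 (wprod W xs ys) = wsum (\<lambda>x y. log 2 (W x y)) xs ys \<and> 0 < wprod W xs ys"
  using assms by (induction xs ys rule: list_induct2) (auto simp: log_mult)

lemma wsum_nonneg: "(\<And>x y. 0 \<le> h x y) \<Longrightarrow> 0 \<le> wsum h xs ys"
  unfolding wsum_def by (intro sum_list_nonneg) auto

lemma wsum_le: "(\<And>x y. h x y \<le> c) \<Longrightarrow> length xs = n \<Longrightarrow> length ys = n \<Longrightarrow> wsum h xs ys \<le> real n * c"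
proof (induction xs arbitrary: ys n)
  case (Cons x xs)
  then obtain y zs where ys: "ys = y # zs" by (cases ys) auto
  have "wsum h xs zs \<le> real (length xs) * c" using Cons.prems ys by (intro Cons.IH) auto
  then show ?case using Cons.prems(1)[of x y] Cons.prems(2) ys by (auto simp: algebra_simps)
qed simp

lemma wsum_indicators:
  fixes h :: "'x::finite \<Rightarrow> 'y::finite \<Rightarrow> real"
  assumes "length xs = length ys"
  shows "wsum h xs ys = (\<Sum>z\<in>UNIV. h (fst z) (snd z) * wsum (\<lambda>x y. of_bool ((x, y) = z)) xs ys)"
  using assms
proof (induction xs ys rule: list_induct2)
  case (Cons x xs y ys)
  have "(\<Sum>z\<in>UNIV. h (fst z) (snd z) * of_bool ((x, y) = z)) = (\<Sum>z\<in>UNIV. if (x, y) = z then h x y else 0)"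
    by (intro sum.cong) auto
  also have "\<dots> = h x y" by (simp add: sum.delta)
  finally show ?case using Cons by (simp add: algebra_simps sum.distrib del: of_bool_eq_1_iff)
qed simp

lemma wsum_indicator_pos:
  assumes "length xs = length ys" "(a, b) \<in> set (zip xs ys)"
  shows "1 \<le> wsum (\<lambda>x y. of_bool ((x, y) = (a, b))) xs ys"
  using assms
proof (induction xs ys rule: list_induct2)
  case (Cons x xs y ys)
  have "0 \<le> wsum (\<lambda>x y. of_bool ((x, y) = (a, b)) :: real) xs ys" by (rule wsum_nonneg) auto
  then show ?case using Cons by (auto simp: add_nonneg_nonneg)
qed simp

lemma sum_prod_list_sum_list:
  fixes q :: "'a::finite \<Rightarrow> real"
  assumes "sum q UNIV = 1"
  shows "(\<Sum>xs\<in>words n. prod_list (map q xs) * sum_list (map f xs)) = real n * (\<Sum>a\<in>UNIV. q a * f a)"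
proof (induction n)
  case (Suc n)
  have "(\<Sum>xs\<in>words (Suc n). prod_list (map q xs) * sum_list (map f xs))
     = (\<Sum>x\<in>UNIV. \<Sum>xs\<in>words n. q x * f x * prod_list (map q xs) + q x * (prod_list (map q xs) * sum_list (map f xs)))"
    by (simp add: sum_words_Suc algebra_simps)
  also have "\<dots> = (\<Sum>x\<in>UNIV. q x * f x * 1 + q x * (real n * (\<Sum>a\<in>UNIV. q a * f a)))"
    using Suc by (simp add: sum.distrib sum_distrib_left[symmetric] sum_prod_list[OF assms])
  also have "\<dots> = real (Suc n) * (\<Sum>a\<in>UNIV. q a * f a)"
    by (simp add: sum.distrib sum_distrib_right[symmetric] assms) (simp add: algebra_simps)
  finally show ?case .
qed simp

text \<open>Single-letterisation in one Jensen step: with \<open>J\<close> the average of the laws of the pairs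
  \<open>(X_i, Y_i)\<close>, the number \<open>n I(J)\<close> is the expectation of \<open>log Z\<close>, where \<open>Z\<close> is the product of the
  ratios \<open>J(x_i | y_i) / q(x_i)\<close>; and \<open>Z\<close> itself has expectation at most \<open>sum M\<close>.\<close>

lemma single_letter:
  fixes q :: "'x::finite \<Rightarrow> real" and A :: "'x list \<Rightarrow> 'y::finite list \<Rightarrow> real"
  assumes n: "n > 0" and q: "\<And>x. 0 \<le> q x" "sum q UNIV = 1"
    and A: "\<And>xs ys. 0 \<le> A xs ys" "\<And>xs. length xs = n \<Longrightarrow> (\<Sum>ys\<in>words n. A xs ys) = 1"
    and M: "\<And>xs ys. length xs = n \<Longrightarrow> length ys = n \<Longrightarrow> A xs ys \<le> M ys"
  obtains J where "\<And>z. 0 \<le> J z" "sum J UNIV = 1" "margX J = q"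
    "\<And>h. real n * (\<Sum>(x, y)\<in>UNIV. J (x, y) * h x y) = (\<Sum>xs\<in>words n. \<Sum>ys\<in>words n. prod_list (map q xs) * A xs ys * wsum h xs ys)"
    "real n * mi J \<le> log 2 (\<Sum>ys\<in>words n. M ys)"
proof -
  define p where "p xs ys = prod_list (map q xs) * A xs ys" for xs ys
  have pnn: "0 \<le> p xs ys" for xs ys
    unfolding p_def using q A by (intro mult_nonneg_nonneg prod_list_nonneg) auto
  \<comment> \<open>The expected fraction of positions at which the letter pair equals z.\<close>
  define J where "J z = (\<Sum>xs\<in>words n. \<Sum>ys\<in>words n. p xs ys * wsum (\<lambda>x y. of_bool ((x, y) = z)) xs ys) / real n" for z
  have Jnn: "0 \<le> J z" for z
    unfolding J_def by (intro divide_nonneg_nonneg sum_nonneg mult_nonneg_nonneg pnn wsum_nonneg) auto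
  have Jh': "real n * (\<Sum>z\<in>UNIV. J z * h (fst z) (snd z)) = (\<Sum>xs\<in>words n. \<Sum>ys\<in>words n. p xs ys * wsum h xs ys)" for h
  proof -
    have "real n * (\<Sum>z\<in>UNIV. J z * h (fst z) (snd z))
        = (\<Sum>z\<in>UNIV. \<Sum>xs\<in>words n. \<Sum>ys\<in>words n. p xs ys * (h (fst z) (snd z) * wsum (\<lambda>x y. of_bool ((x, y) = z)) xs ys))"
    proof -
      have nJ: "real n * J z = (\<Sum>xs\<in>words n. \<Sum>ys\<in>words n. p xs ys * wsum (\<lambda>x y. of_bool ((x, y) = z)) xs ys)" for z
        using n by (simp add: J_def)
      have "real n * (\<Sum>z\<in>UNIV. J z * h (fst z) (snd z)) = (\<Sum>z\<in>UNIV. (real n * J z) * h (fst z) (snd z))"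
        by (simp add: sum_distrib_left mult.assoc)
      then show ?thesis unfolding nJ sum_distrib_right by (simp only: mult_ac)
    qed
    also have "\<dots> = (\<Sum>xs\<in>words n. \<Sum>z\<in>UNIV. \<Sum>ys\<in>words n. p xs ys * (h (fst z) (snd z) * wsum (\<lambda>x y. of_bool ((x, y) = z)) xs ys))"
      by (rule sum.swap)
    also have "\<dots> = (\<Sum>xs\<in>words n. \<Sum>ys\<in>words n. \<Sum>z\<in>UNIV. p xs ys * (h (fst z) (snd z) * wsum (\<lambda>x y. of_bool ((x, y) = z)) xs ys))"
      by (intro sum.cong refl sum.swap)
    also have "\<dots> = (\<Sum>xs\<in>words n. \<Sum>ys\<in>words n. p xs ys * wsum h xs ys)"
    proof (intro sum.cong refl)
      fix xs :: "'x list" and ys :: "'y list" assume "xs \<in> words n" "ys \<in> words n"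
      then have "length xs = length ys" by simp
      from wsum_indicators[OF this, of h]
      show "(\<Sum>z\<in>UNIV. p xs ys * (h (fst z) (snd z) * wsum (\<lambda>x y. of_bool ((x, y) = z)) xs ys)) = p xs ys * wsum h xs ys"
        by (simp add: sum_distrib_left)
    qed
    finally show ?thesis .
  qed
  have pX: "(\<Sum>ys\<in>words n. p xs ys) = prod_list (map q xs)" if "length xs = n" for xs
    using A(2)[OF that] by (simp add: p_def sum_distrib_left[symmetric])
  have marg: "margX J a = q a" for a
  proof -
    have "real n * margX J a = real n * (\<Sum>z\<in>UNIV. J z * of_bool (fst z = a))"
      by (simp add: margX_def sum_UNIV_pair sum_distrib_right[symmetric])
    also have "\<dots> = (\<Sum>xs\<in>words n. \<Sum>ys\<in>words n. p xs ys * wsum (\<lambda>x y. of_bool (x = a)) xs ys)"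
      by (rule Jh')
    also have "\<dots> = (\<Sum>xs\<in>words n. \<Sum>ys\<in>words n. p xs ys * sum_list (map (\<lambda>x. of_bool (x = a)) xs))"
      by (intro sum.cong refl) (simp add: wsum_fst)
    also have "\<dots> = (\<Sum>xs\<in>words n. prod_list (map q xs) * sum_list (map (\<lambda>x. of_bool (x = a)) xs))"
      by (intro sum.cong refl) (simp add: sum_distrib_right[symmetric] pX)
    also have "\<dots> = real n * q a"
      by (simp add: sum_prod_list_sum_list[OF q(2)])
    finally show ?thesis using n by simp
  qed
  have sumJ: "sum J UNIV = 1" using sum_marg(1)[of J] q(2) by (simp add: marg[abs_def] fun_eq_iff)
  define Z where "Z a b = J (a, b) / (margX J a * margY J b)" for a b
  have Znn: "0 \<le> Z a b" for a b
    unfolding Z_def margX_def margY_def by (intro divide_nonneg_nonneg mult_nonneg_nonneg sum_nonneg Jnn)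
  have Zpos: "\<forall>(x, y)\<in>set (zip xs ys). 0 < Z x y" if len: "length xs = n" "length ys = n" and p: "p xs ys > 0" for xs ys
  proof clarify
    fix a b assume ab: "(a, b) \<in> set (zip xs ys)"
    have "0 < p xs ys * wsum (\<lambda>x y. of_bool ((x, y) = (a, b))) xs ys"
      using wsum_indicator_pos[OF _ ab] len p by (intro mult_pos_pos) auto
    also have "\<dots> \<le> (\<Sum>ys\<in>words n. p xs ys * wsum (\<lambda>x y. of_bool ((x, y) = (a, b))) xs ys)"
      using len by (intro member_le_sum[of ys "words n" "\<lambda>ys. p xs ys * wsum (\<lambda>x y. of_bool ((x, y) = (a, b))) xs ys"] finite_words)
        (auto intro!: mult_nonneg_nonneg pnn wsum_nonneg)
    also have "\<dots> \<le> (\<Sum>xs\<in>words n. \<Sum>ys\<in>words n. p xs ys * wsum (\<lambda>x y. of_bool ((x, y) = (a, b))) xs ys)"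
      using len by (intro member_le_sum[of xs "words n" "\<lambda>xs. \<Sum>ys\<in>words n. p xs ys * wsum (\<lambda>x y. of_bool ((x, y) = (a, b))) xs ys"] finite_words)
        (auto intro!: sum_nonneg mult_nonneg_nonneg pnn wsum_nonneg)
    finally have "0 < J (a, b)" unfolding J_def using n by simp
    then show "0 < Z a b" using marg_ge[of J a b, OF Jnn] by (auto simp: Z_def intro!: divide_pos_pos mult_pos_pos)
  qed
  \<comment> \<open>The product q a * Z a b is the backward channel J(a|b). Its sum over a is 1, or
    0 when b has no mass, since division by zero yields 0.\<close>
  have qZ: "(\<Sum>a\<in>UNIV. q a * Z a b) \<le> 1" for b
  proof -
    have "q a * Z a b = J (a, b) / margY J b" for a
      using marg_ge(1)[of J a b, OF Jnn] Jnn[of "(a, b)"] by (cases "q a = 0") (auto simp: Z_def marg)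
    then have "(\<Sum>a\<in>UNIV. q a * Z a b) = margY J b / margY J b"
      by (simp only: margY_def sum_divide_distrib)
    then show ?thesis by simp
  qed
  have psum: "(\<Sum>z\<in>words n \<times> words n. p (fst z) (snd z)) = 1"
  proof -
    have "(\<Sum>z\<in>words n \<times> words n. p (fst z) (snd z)) = (\<Sum>xs\<in>words n. \<Sum>ys\<in>words n. p xs ys)"
      by (simp add: sum.cartesian_product split_beta)
    then show ?thesis by (simp add: pX sum_prod_list[OF q(2)])
  qed
  let ?S = "\<Sum>ys\<in>words n. M ys"
  have Mnn: "0 \<le> M ys" if "length ys = n" for ys
    using M[of "replicate n undefined" ys] A(1)[of "replicate n undefined" ys] that by simp
  have Spos: "?S > 0"
  proof -
    have "1 = (\<Sum>ys\<in>words n. A (replicate n undefined) ys)" using A(2)[of "replicate n undefined"] by simp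
    also have "\<dots> \<le> ?S" by (intro sum_mono M) auto
    finally show ?thesis by simp
  qed
  have "(\<Sum>z\<in>words n \<times> words n. p (fst z) (snd z) * log 2 (wprod Z (fst z) (snd z))) \<le> log 2 ?S"
  proof (rule jensen_log[OF _ _ psum])
    fix z :: "'x list \<times> 'y list" assume z: "z \<in> words n \<times> words n" "p (fst z) (snd z) > 0"
    then show "wprod Z (fst z) (snd z) > 0" using log_wprod[of "fst z" "snd z" Z] Zpos[of "fst z" "snd z"] by auto
  next
    have "(\<Sum>z\<in>words n \<times> words n. p (fst z) (snd z) * wprod Z (fst z) (snd z))
        = (\<Sum>ys\<in>words n. \<Sum>xs\<in>words n. p xs ys * wprod Z xs ys)"
      by (subst sum.swap) (simp add: sum.cartesian_product split_beta)
    \<comment> \<open>Replacing A by the bound \<open>M\<close>, which is free of xs, leaves the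
      memoryless backward channel; for each fixed ys its total mass over xs is at most 1.\<close>
    also have "\<dots> \<le> (\<Sum>ys\<in>words n. \<Sum>xs\<in>words n. M ys * wprod (\<lambda>b a. q a * Z a b) ys xs)"
    proof (intro sum_mono)
      fix xs :: "'x list" and ys :: "'y list" assume len: "xs \<in> words n" "ys \<in> words n"
      have "wprod (\<lambda>b a. q a * Z a b) ys xs = wprod (\<lambda>a b. q a * Z a b) xs ys"
        using len by (intro wprod_flip) simp
      also have "\<dots> = prod_list (map q xs) * wprod Z xs ys"
        using len by (simp add: wprod_mult wprod_fst)
      finally have e: "wprod (\<lambda>b a. q a * Z a b) ys xs = prod_list (map q xs) * wprod Z xs ys" .
      have "A xs ys * (prod_list (map q xs) * wprod Z xs ys) \<le> M ys * (prod_list (map q xs) * wprod Z xs ys)"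
        using len q Znn by (intro mult_right_mono M mult_nonneg_nonneg prod_list_nonneg wprod_nonneg) auto
      then show "p xs ys * wprod Z xs ys \<le> M ys * wprod (\<lambda>b a. q a * Z a b) ys xs"
        unfolding e p_def by (simp add: mult_ac)
    qed
    also have "\<dots> \<le> (\<Sum>ys\<in>words n. M ys * 1)"
    proof (rule sum_mono)
      fix ys :: "'y list" assume ys: "ys \<in> words n"
      have "(\<Sum>xs\<in>words (length ys). wprod (\<lambda>b a. q a * Z a b) ys xs) \<le> 1"
        using q Znn qZ by (intro sum_wprod_le) auto
      then show "(\<Sum>xs\<in>words n. M ys * wprod (\<lambda>b a. q a * Z a b) ys xs) \<le> M ys * 1"
        using ys Mnn[of ys] by (subst sum_distrib_left[symmetric], intro mult_left_mono) auto
    qed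
    finally show "(\<Sum>z\<in>words n \<times> words n. p (fst z) (snd z) * wprod Z (fst z) (snd z)) \<le> ?S" by simp
  qed (use pnn Spos in \<open>auto intro!: finite_cartesian_product finite_words\<close>)
  also have "(\<Sum>z\<in>words n \<times> words n. p (fst z) (snd z) * log 2 (wprod Z (fst z) (snd z)))
      = (\<Sum>xs\<in>words n. \<Sum>ys\<in>words n. p xs ys * log 2 (wprod Z xs ys))"
    by (simp add: sum.cartesian_product split_beta)
  also have "\<dots> = (\<Sum>xs\<in>words n. \<Sum>ys\<in>words n. p xs ys * wsum (\<lambda>x y. log 2 (Z x y)) xs ys)"
  proof (intro sum.cong refl)
    fix xs :: "'x list" and ys :: "'y list" assume len: "xs \<in> words n" "ys \<in> words n"
    show "p xs ys * log 2 (wprod Z xs ys) = p xs ys * wsum (\<lambda>x y. log 2 (Z x y)) xs ys"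
    proof (cases "p xs ys = 0")
      case False
      then have "p xs ys > 0" using pnn[of xs ys] by simp
      then show ?thesis using log_wprod[of xs ys Z] Zpos[of xs ys] len by simp
    qed simp
  qed
  also have "\<dots> = real n * mi J"
    unfolding Jh'[symmetric] mi_def Z_def by (simp add: split_beta)
  finally have "real n * mi J \<le> log 2 ?S" .
  moreover have "real n * (\<Sum>(x, y)\<in>UNIV. J (x, y) * h x y) = (\<Sum>xs\<in>words n. \<Sum>ys\<in>words n. prod_list (map q xs) * A xs ys * wsum h xs ys)" for h
    using Jh'[of h] by (simp add: split_beta p_def)
  ultimately show thesis using that[of J] Jnn sumJ marg by (auto simp: fun_eq_iff)
qed

text \<open>An i.i.d. word is the output of a memoryless channel whose input alphabet is a single
  letter.\<close>

lemma sum_list_chebyshev: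
  fixes q h :: "'x::finite \<Rightarrow> real"
  assumes q: "\<And>x. 0 \<le> q x" "sum q UNIV = 1" and n: "n > 0" and t: "t > 0"
    and B: "\<And>x. \<bar>h x - (\<Sum>x\<in>UNIV. q x * h x)\<bar> \<le> B"
  shows "(\<Sum>xs\<in>{xs \<in> words n. (\<Sum>x\<leftarrow>xs. h x) \<ge> real n * ((\<Sum>x\<in>UNIV. q x * h x) + t)}. prod_list (map q xs))
    \<le> B\<^sup>2 / (real n * t\<^sup>2)"
proof -
  let ?u = "replicate n ()"
  have wp: "wprod (\<lambda>u. q) (replicate (length xs) ()) xs = prod_list (map q xs)"
    and ws: "wsum (\<lambda>u. h) (replicate (length xs) ()) xs = sum_list (map h xs)" for xs
    by (induction xs) auto
  have "(\<Sum>xs\<in>{xs \<in> words n. wsum (\<lambda>u. h) ?u xs \<ge> (\<Sum>u\<leftarrow>?u. \<Sum>x\<in>UNIV. q x * h x) + real n * t}. wprod (\<lambda>u. q) ?u xs)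
    \<le> B\<^sup>2 / (real n * t\<^sup>2)"
    by (rule chebyshev_wprod) (use assms in auto)
  also have "(\<Sum>xs\<in>{xs \<in> words n. wsum (\<lambda>u. h) ?u xs \<ge> (\<Sum>u\<leftarrow>?u. \<Sum>x\<in>UNIV. q x * h x) + real n * t}. wprod (\<lambda>u. q) ?u xs)
    = (\<Sum>xs\<in>{xs \<in> words n. (\<Sum>x\<leftarrow>xs. h x) \<ge> real n * ((\<Sum>x\<in>UNIV. q x * h x) + t)}. prod_list (map q xs))"
    by (rule sum.cong) (auto simp: wp ws sum_list_replicate algebra_simps)
  finally show ?thesis .
qed

section \<open>Transfer of small error probability from one source to another\<close>

definition channel_prob :: "nat \<Rightarrow> ('x \<Rightarrow> real) \<Rightarrow> ('x list \<Rightarrow> 'y list \<Rightarrow> real) \<Rightarrow> ('x list \<times> 'y list) set \<Rightarrow> real" where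
  "channel_prob n q A E = (\<Sum>xs\<in>words n. \<Sum>ys\<in>words n. prod_list (map q xs) * A xs ys * of_bool ((xs, ys) \<in> E))"

text \<open>Where the log-likelihood ratio of q against p stays below n(kl q p + t), the product law
  of q is at most 2^(n(kl q p + t)) times that of p; the other words are rare under q by Chebyshev.
  The channel and the event are quantified after n because the code changes with n.\<close>

lemma change_of_measure:
  fixes p q :: "'x::finite \<Rightarrow> real"
  assumes p: "\<And>x. 0 < p x" and q: "\<And>x. 0 \<le> q x" "sum q UNIV = 1"
    and a: "kl q p < a" and \<eta>: "\<eta> > 0"
  shows "\<forall>\<^sub>F n in sequentially. \<forall>(A :: 'x list \<Rightarrow> 'y::finite list \<Rightarrow> real) E. (\<forall>xs ys. 0 \<le> A xs ys) \<longrightarrow>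
    (\<forall>xs. length xs = n \<longrightarrow> (\<Sum>ys\<in>words n. A xs ys) = 1) \<longrightarrow>
    channel_prob n p A E \<le> 2 powr (- (real n * a)) \<longrightarrow> channel_prob n q A E \<le> \<eta>"
proof -
  \<comment> \<open>Half of the gap goes to the fluctuation of the log-likelihood ratio; the other
    half remains as the decay rate 2^(-nt).\<close>
  define t where "t = (a - kl q p) / 2"
  have t: "t > 0" using a by (simp add: t_def)
  define h where "h x = log 2 (q x / p x)" for x
  have klh: "kl q p = (\<Sum>x\<in>UNIV. q x * h x)" by (simp add: kl_def h_def)
  define B where "B = (MAX x. \<bar>h x - kl q p\<bar>)"
  have B: "\<bar>h x - kl q p\<bar> \<le> B" for x unfolding B_def by (intro Max_ge) auto
  have "((\<lambda>n::nat. B\<^sup>2 / (real n * t\<^sup>2) + 2 powr (- (real n * t))) \<longlongrightarrow> 0) sequentially"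
    using t by real_asymp
  then have "\<forall>\<^sub>F n in sequentially. B\<^sup>2 / (real n * t\<^sup>2) + 2 powr (- (real n * t)) < \<eta>"
    using \<eta> by (simp add: order_tendsto_iff)
  then show ?thesis using eventually_gt_at_top[of "0::nat"]
  proof eventually_elim
    case (elim n)
    show ?case
    proof (intro allI impI)
      fix A :: "'x list \<Rightarrow> 'y list \<Rightarrow> real" and E
      assume Ann: "\<forall>xs ys. 0 \<le> A xs ys" and As: "\<forall>xs. length xs = n \<longrightarrow> (\<Sum>ys\<in>words n. A xs ys) = 1"
        and pE: "channel_prob n p A E \<le> 2 powr (- (real n * a))"
      define bad where "bad = {xs \<in> words n. (\<Sum>x\<leftarrow>xs. h x) \<ge> real n * (kl q p + t)}"
      define e where "e xs = (\<Sum>ys\<in>words n. A xs ys * of_bool ((xs, ys) \<in> E))" for xs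
      have e0: "0 \<le> e xs" for xs unfolding e_def using Ann by (intro sum_nonneg) auto
      have e1: "e xs \<le> 1" if "length xs = n" for xs
      proof -
        have "e xs \<le> (\<Sum>ys\<in>words n. A xs ys)" unfolding e_def using Ann by (intro sum_mono) auto
        then show ?thesis using As that by simp
      qed
      have cp: "channel_prob n g A E = (\<Sum>xs\<in>words n. prod_list (map g xs) * e xs)" for g
        by (simp add: channel_prob_def e_def sum_distrib_left mult.assoc)
      have le: "prod_list (map q xs) * e xs \<le> prod_list (map q xs) * of_bool (xs \<in> bad)
          + 2 powr (real n * (kl q p + t)) * (prod_list (map p xs) * e xs)" if xs: "xs \<in> words n" for xs
      proof (cases "xs \<in> bad")
        case True
        have "prod_list (map q xs) * e xs \<le> prod_list (map q xs) * 1"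
          using q e1[of xs] xs by (intro mult_left_mono prod_list_nonneg) auto
        moreover have "0 \<le> 2 powr (real n * (kl q p + t)) * (prod_list (map p xs) * e xs)"
          using p by (intro mult_nonneg_nonneg prod_list_nonneg e0) (auto intro: less_imp_le)
        ultimately show ?thesis using True by simp
      next
        case False
        have "prod_list (map q xs) \<le> 2 powr (real n * (kl q p + t)) * prod_list (map p xs)"
        \<comment> \<open>Words containing a letter of q-mass 0 are treated apart: there h uses the
          default value log 2 0 = 0 and says nothing about the likelihood ratio.\<close>
        proof (cases "\<exists>x\<in>set xs. q x = 0")
          case True
          then have "prod_list (map q xs) = 0" by (force simp: prod_list_zero_iff)
          moreover have "0 \<le> prod_list (map p xs)" using p by (intro prod_list_nonneg) (auto intro: less_imp_le)
          ultimately show ?thesis by simp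
        next
          case F: False
          then have qp: "q x > 0" if "x \<in> set xs" for x using q(1)[of x] that by force
          have "prod_list (map q xs) = 2 powr (\<Sum>x\<leftarrow>xs. log 2 (q x))"
            by (rule prod_list_eq_powr) (use qp in auto)
          also have "(\<Sum>x\<leftarrow>xs. log 2 (q x)) = (\<Sum>x\<leftarrow>xs. h x + log 2 (p x))"
          proof (intro arg_cong[of _ _ sum_list] map_cong refl)
            fix x assume "x \<in> set xs"
            then show "log 2 (q x) = h x + log 2 (p x)"
              using qp[of x] p[of x] by (simp add: h_def log_divide)
          qed
          also have "2 powr (\<Sum>x\<leftarrow>xs. h x + log 2 (p x)) = 2 powr (\<Sum>x\<leftarrow>xs. h x) * prod_list (map p xs)"
            using p by (simp add: sum_list_addf powr_add prod_list_eq_powr)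
          also have "\<dots> \<le> 2 powr (real n * (kl q p + t)) * prod_list (map p xs)"
            using False xs p by (intro mult_right_mono prod_list_nonneg) (auto simp: bad_def intro: less_imp_le)
          finally show ?thesis .
        qed
        then have "prod_list (map q xs) * e xs \<le> 2 powr (real n * (kl q p + t)) * prod_list (map p xs) * e xs"
          by (intro mult_right_mono e0)
        then show ?thesis using False by (simp add: mult.assoc)
      qed
      have "channel_prob n q A E \<le> (\<Sum>xs\<in>words n. prod_list (map q xs) * of_bool (xs \<in> bad)
          + 2 powr (real n * (kl q p + t)) * (prod_list (map p xs) * e xs))"
        unfolding cp by (rule sum_mono[OF le])
      also have "\<dots> = (\<Sum>xs\<in>bad. prod_list (map q xs)) + 2 powr (real n * (kl q p + t)) * channel_prob n p A E"
      proof -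
        have "(\<Sum>xs\<in>words n. prod_list (map q xs) * of_bool (xs \<in> bad)) = (\<Sum>xs\<in>bad. prod_list (map q xs))"
          by (rule sum.mono_neutral_cong_right) (auto simp: finite_words bad_def)
        then show ?thesis by (simp add: cp sum.distrib sum_distrib_left)
      qed
      also have "\<dots> \<le> B\<^sup>2 / (real n * t\<^sup>2) + 2 powr (real n * (kl q p + t)) * 2 powr (- (real n * a))"
      proof (intro add_mono mult_left_mono pE)
        show "(\<Sum>xs\<in>bad. prod_list (map q xs)) \<le> B\<^sup>2 / (real n * t\<^sup>2)"
          unfolding bad_def klh
          by (rule sum_list_chebyshev) (use q elim t B in \<open>auto simp: klh\<close>)
      qed auto
      also have "2 powr (real n * (kl q p + t)) * 2 powr (- (real n * a)) = 2 powr (- (real n * t))"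
        unfolding powr_add[symmetric] by (rule arg_cong[of _ _ "\<lambda>z. 2 powr z"]) (simp add: t_def field_simps)
      finally show "channel_prob n q A E \<le> \<eta>" using elim by linarith
    qed
  qed
qed

text \<open>Convexity of divergence in its first argument, with kl p p = 0, read off from the
  identity kl m p = (1 - t)(kl q p - kl q m) - t kl p m for the mixture m.\<close>

lemma kl_mix_le:
  fixes p q :: "'x::finite \<Rightarrow> real"
  assumes p: "\<And>x. 0 < p x" "sum p UNIV = 1" and q: "\<And>x. 0 \<le> q x" "sum q UNIV = 1"
    and t: "0 < t" "t < 1"
  shows "kl (\<lambda>x. (1 - t) * q x + t * p x) p \<le> (1 - t) * kl q p"
proof -
  define m where "m x = (1 - t) * q x + t * p x" for x
  have m: "m x > 0" for x unfolding m_def using p(1)[of x] q(1)[of x] t by (intro add_nonneg_pos) auto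
  have ms: "sum m UNIV = 1" by (simp add: m_def sum.distrib sum_distrib_left[symmetric] p q)
  have "0 \<le> kl q m" unfolding kl_def by (rule gibbs) (use q m ms in \<open>auto intro: less_imp_le\<close>)
  moreover have "0 \<le> kl p m" unfolding kl_def by (rule gibbs) (use p m ms in \<open>auto intro: less_imp_le\<close>)
  moreover have "kl m p = (1 - t) * (kl q p - kl q m) - t * kl p m"
  proof -
    have "m x * log 2 (m x / p x) = (1 - t) * (q x * log 2 (q x / p x) - q x * log 2 (q x / m x)) - t * (p x * log 2 (p x / m x))" for x
    proof -
      have "q x * log 2 (q x / p x) - q x * log 2 (q x / m x) = q x * log 2 (m x / p x)"
        using q(1)[of x] p(1)[of x] m[of x] by (cases "q x = 0") (auto simp: log_divide algebra_simps)
      moreover have "p x * log 2 (p x / m x) = - (p x * log 2 (m x / p x))"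
        using p(1)[of x] m[of x] by (simp add: log_divide algebra_simps)
      ultimately show ?thesis by (simp only:) (simp add: m_def algebra_simps)
    qed
    then show ?thesis by (simp add: kl_def sum_subtractf sum_distrib_left[symmetric])
  qed
  ultimately have "kl m p \<le> (1 - t) * kl q p"
    using t by (smt (verit) mult_left_mono mult_nonneg_nonneg)
  then show ?thesis by (simp add: m_def[abs_def])
qed

text \<open>For finite \<alpha>, mixing in a fraction t of \<open>P\<close> scales the divergence by
  at most 1 - t and brings it strictly below \<alpha>. For \<alpha> = \<infinity> the error event is
  null under \<open>P\<close>, hence null under \<open>Q\<close> itself by full support, and no
  mixing takes place.\<close>

lemma perturbed_source:
  fixes P Q :: "'x::finite pmf"
  assumes P: "set_pmf P = UNIV" and Q: "ereal (relative_entropy Q P) \<le> \<alpha>" and \<alpha>: "\<alpha> > 0"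
    and \<eta>: "\<eta> > 0" and \<epsilon>: "\<epsilon> > 0"
  obtains q where "\<And>x. 0 \<le> q x" "sum q UNIV = 1" "\<And>x. \<bar>q x - pmf Q x\<bar> \<le> \<eta>"
    "\<forall>\<^sub>F n in sequentially. \<forall>(A :: 'x list \<Rightarrow> 'y::finite list \<Rightarrow> real) E. (\<forall>xs ys. 0 \<le> A xs ys) \<longrightarrow>
    (\<forall>xs. length xs = n \<longrightarrow> (\<Sum>ys\<in>words n. A xs ys) = 1) \<longrightarrow>
    channel_prob n (pmf P) A E \<le> excess_bound \<alpha> n \<longrightarrow> channel_prob n q A E \<le> \<epsilon>"
proof (cases "\<alpha> = \<infinity>")
  case True
  have "channel_prob n (pmf Q) A E \<le> \<epsilon>"
    if "\<forall>xs ys. 0 \<le> A xs ys" "channel_prob n (pmf P) A E \<le> excess_bound \<alpha> n" for n and A :: "'x list \<Rightarrow> 'y list \<Rightarrow> real" and E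
  proof -
    have pp: "0 < prod_list (map (pmf P) xs)" for xs
      using P by (induction xs) (auto simp: pmf_positive)
    have 0: "(\<Sum>z\<in>words n \<times> words n. prod_list (map (pmf P) (fst z)) * A (fst z) (snd z) * of_bool (z \<in> E)) \<le> 0"
      using that(2) True by (simp add: channel_prob_def excess_bound_def sum.cartesian_product split_beta)
    have nn: "0 \<le> prod_list (map (pmf P) (fst z)) * A (fst z) (snd z) * of_bool (z \<in> E)" for z
      using that(1) pp[of "fst z"] by (intro mult_nonneg_nonneg) (auto intro: less_imp_le)
    have "(\<Sum>z\<in>words n \<times> words n. prod_list (map (pmf P) (fst z)) * A (fst z) (snd z) * of_bool (z \<in> E)) = 0"
      using 0 nn by (intro antisym sum_nonneg) auto
    then have "\<forall>z\<in>words n \<times> words n. prod_list (map (pmf P) (fst z)) * A (fst z) (snd z) * of_bool (z \<in> E) = 0"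
      using nn by (subst (asm) sum_nonneg_eq_0_iff) (auto simp: finite_words simp del: split_paired_All)
    then have "A xs ys * of_bool ((xs, ys) \<in> E) = 0" if "length xs = n" "length ys = n" for xs ys
      using pp[of xs] that by fastforce
    then have "channel_prob n (pmf Q) A E = 0"
      unfolding channel_prob_def by (intro sum.neutral ballI) auto
    then show ?thesis using \<epsilon> by simp
  qed
  then show thesis using that[of "pmf Q"] \<eta> by (auto simp: sum_pmf_eq_1)
next
  case False
  then obtain a where a: "\<alpha> = ereal a" using \<alpha> by (cases \<alpha>) auto
  have a0: "a > 0" using \<alpha> a by simp
  have pos: "0 < pmf P x" for x using P by (simp add: pmf_positive)
  have sums: "sum (pmf P) UNIV = 1" "sum (pmf Q) UNIV = 1" by (simp_all add: sum_pmf_eq_1)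
  define t where "t = min \<eta> (1/2)"
  have t: "0 < t" "t < 1" "t \<le> \<eta>" using \<eta> by (auto simp: t_def)
  define q where "q x = (1 - t) * pmf Q x + t * pmf P x" for x
  have "kl q (pmf P) \<le> (1 - t) * kl (pmf Q) (pmf P)"
    unfolding q_def[abs_def] by (rule kl_mix_le) (use pos sums t in auto)
  also have "\<dots> \<le> (1 - t) * a"
    using Q t by (intro mult_left_mono) (auto simp: a relative_entropy_eq[OF P])
  also have "\<dots> < a" using t a0 by (simp add: algebra_simps)
  finally have kla: "kl q (pmf P) < a" .
  have q0: "0 \<le> q x" for x using t by (simp add: q_def)
  have q1: "sum q UNIV = 1" by (simp add: q_def sum.distrib sum_distrib_left[symmetric] sums)
  have qQ: "\<bar>q x - pmf Q x\<bar> \<le> \<eta>" for x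
  proof -
    have "q x - pmf Q x = t * (pmf P x - pmf Q x)" by (simp add: q_def algebra_simps)
    moreover have "\<bar>pmf P x - pmf Q x\<bar> \<le> 1" using pmf_le_1[of P x] pmf_le_1[of Q x] by (simp add: abs_le_iff) (smt (verit) pmf_nonneg)
    ultimately show ?thesis using t by (simp add: abs_mult) (smt (verit) mult_left_le)
  qed
  have e: "excess_bound \<alpha> n = 2 powr (- (real n * a))" for n by (simp add: excess_bound_def a)
  show thesis
    by (rule that[OF q0 q1 qQ]) (unfold e, rule change_of_measure[OF pos q0 q1 kla \<epsilon>])
qed

text \<open>The number c lies strictly below R(Q,D), and semicontinuity turns this gap into the
  tolerance \<eta>. The error probability and the shift of the source are then made small enough for
  the averaged letter law to stay within it.\<close>

lemma leakage_lower_bound: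
  fixes P Q :: "'x::finite pmf" and d :: "'x \<Rightarrow> 'y::finite \<Rightarrow> real"
  assumes P: "set_pmf P = UNIV" and d: "\<And>x y. 0 \<le> d x y" "\<And>x y. d x y \<le> D_max"
    and \<alpha>: "\<alpha> > 0" and Q: "ereal (relative_entropy Q P) \<le> \<alpha>" and r: "r > 0"
    and c: "ereal c < rate_distortion d Q D"
  shows "\<forall>\<^sub>F n in sequentially. ereal (max 0 (c - r)) \<le> min_leakage_rate P d D R r \<alpha> n"
proof -
  obtain \<eta> where \<eta>: "\<eta> > 0" and lsc: "\<And>J. (\<And>z. 0 \<le> J z) \<Longrightarrow> sum J UNIV = 1 \<Longrightarrow> (\<And>x. \<bar>margX J x - pmf Q x\<bar> \<le> \<eta>)
      \<Longrightarrow> (\<Sum>(x, y)\<in>UNIV. J (x, y) * d x y) \<le> D + \<eta> \<Longrightarrow> c \<le> mi J"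
    by (rule rate_distortion_lsc[OF c]) blast
  \<comment> \<open>On the error event the distortion exceeds \<open>D\<close> by at most
    \<open>C\<close>, so an error probability of \<eta> / C costs \<eta> in mean distortion. The
    summand 1 makes \<open>C\<close> positive.\<close>
  define C where "C = D_max + \<bar>D\<bar> + 1"
  have C: "C > 0" using order.trans[OF d(1) d(2)] by (simp add: C_def)
  have \<epsilon>: "\<eta> / C > 0" using \<eta> C by simp
  obtain q where q: "\<And>x. 0 \<le> q x" "sum q UNIV = 1" "\<And>x. \<bar>q x - pmf Q x\<bar> \<le> \<eta>"
    and ev: "\<forall>\<^sub>F n in sequentially. \<forall>(A :: 'x list \<Rightarrow> 'y list \<Rightarrow> real) E. (\<forall>xs ys. 0 \<le> A xs ys) \<longrightarrow>
    (\<forall>xs. length xs = n \<longrightarrow> (\<Sum>ys\<in>words n. A xs ys) = 1) \<longrightarrow>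
    channel_prob n (pmf P) A E \<le> excess_bound \<alpha> n \<longrightarrow> channel_prob n q A E \<le> \<eta> / C"
    by (rule perturbed_source[OF P Q \<alpha> \<eta> \<epsilon>]) blast
  show ?thesis using ev eventually_gt_at_top[of "0::nat"]
  proof eventually_elim
    case (elim n)
    show ?case unfolding min_leakage_rate_def
    proof (rule INF_greatest)
      fix f assume "f \<in> admissible_encoders P d D R r \<alpha> n"
      then obtain g where f: "encoder n R r f" and g: "decoder n R r g"
        and ex: "measure_pmf.prob (source_reproduction_law P n r f g)
          {(xs, ys). seq_distortion d n xs ys > D} \<le> excess_bound \<alpha> n"
        by (auto simp: admissible_encoders_def)
      define E where "E = {(xs, ys). seq_distortion d n xs ys > D}"
      define A where "A = repro_prob n R r f g"
      have A: "\<And>xs ys. 0 \<le> A xs ys" "\<And>xs. length xs = n \<Longrightarrow> (\<Sum>ys\<in>words n. A xs ys) = 1"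
        using sum_repro_prob[OF f g] by (auto simp: A_def repro_prob_nonneg)
      have "channel_prob n (pmf P) A E = measure_pmf.prob (source_reproduction_law P n r f g) E"
        unfolding prob_source_reproduction[OF f g] channel_prob_def
        by (simp add: sum.cartesian_product A_def) (intro sum.cong, auto)
      then have cpq: "channel_prob n q A E \<le> \<eta> / C"
        using elim(1) A ex by (simp add: E_def)
      define M where "M ys = (\<Sum>m\<in>bit_strings (real n * R). max_msg_prob n r f m * (\<Sum>k\<in>bit_strings (real n * r). pmf (g m k) ys))" for ys
      obtain J where J: "\<And>z. 0 \<le> J z" "sum J UNIV = 1" "margX J = q"
        and Jh: "\<And>h. real n * (\<Sum>(x, y)\<in>UNIV. J (x, y) * h x y) = (\<Sum>xs\<in>words n. \<Sum>ys\<in>words n. prod_list (map q xs) * A xs ys * wsum h xs ys)"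
        and Jmi: "real n * mi J \<le> log 2 (\<Sum>ys\<in>words n. M ys)"
        by (rule single_letter[of n q A M, OF elim(2) q(1,2) A])
          (auto simp: A_def M_def repro_prob_le)
      let ?L = "\<Sum>m\<in>bit_strings (real n * R). max_msg_prob n r f m"
      have L1: "1 \<le> ?L" by (rule sum_max_msg_prob_ge_1[OF f])
      have "real n * (\<Sum>(x, y)\<in>UNIV. J (x, y) * d x y)
          \<le> (\<Sum>xs\<in>words n. \<Sum>ys\<in>words n. real n * D * (prod_list (map q xs) * A xs ys)
               + real n * C * (prod_list (map q xs) * A xs ys * of_bool ((xs, ys) \<in> E)))"
        unfolding Jh
      proof (intro sum_mono)
        fix xs :: "'x list" and ys :: "'y list" assume len: "xs \<in> words n" "ys \<in> words n"
        have "wsum d xs ys \<le> real n * D + real n * C * of_bool ((xs, ys) \<in> E)"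
        proof (cases "(xs, ys) \<in> E")
          case True
          have "wsum d xs ys \<le> real n * D_max" using len d(2) by (intro wsum_le) auto
          also have "\<dots> \<le> real n * (D + C)" by (intro mult_left_mono) (auto simp: C_def)
          finally show ?thesis using True by (simp add: algebra_simps)
        next
          case False
          then have "wsum d xs ys / real n \<le> D"
            using len by (simp add: E_def seq_distortion_eq_wsum)
          then show ?thesis using False elim(2) by (simp add: field_simps)
        qed
        then have "prod_list (map q xs) * A xs ys * wsum d xs ys
            \<le> prod_list (map q xs) * A xs ys * (real n * D + real n * C * of_bool ((xs, ys) \<in> E))"
          using q A by (intro mult_left_mono mult_nonneg_nonneg prod_list_nonneg) auto
        then show "prod_list (map q xs) * A xs ys * wsum d xs ys
            \<le> real n * D * (prod_list (map q xs) * A xs ys)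
               + real n * C * (prod_list (map q xs) * A xs ys * of_bool ((xs, ys) \<in> E))"
          by (simp add: algebra_simps)
      qed
      also have "\<dots> = real n * D * (\<Sum>xs\<in>words n. prod_list (map q xs) * (\<Sum>ys\<in>words n. A xs ys)) + real n * C * channel_prob n q A E"
        by (simp add: sum.distrib sum_distrib_left channel_prob_def)
      also have "(\<Sum>xs\<in>words n. prod_list (map q xs) * (\<Sum>ys\<in>words n. A xs ys)) = 1"
        using A(2) by (simp add: sum_prod_list[OF q(2)])
      also have "real n * D * 1 + real n * C * channel_prob n q A E \<le> real n * D * 1 + real n * C * (\<eta> / C)"
        using C by (intro add_left_mono mult_left_mono cpq) auto
      also have "\<dots> = real n * (D + \<eta>)" using C by (simp add: algebra_simps)
      finally have "(\<Sum>(x, y)\<in>UNIV. J (x, y) * d x y) \<le> D + \<eta>" using elim(2) by simp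
      then have "c \<le> mi J" using lsc[of J] J q by auto
      then have "real n * c \<le> log 2 (\<Sum>ys\<in>words n. M ys)" using Jmi
        by (meson mult_left_mono of_nat_0_le_iff order.trans)
      also have "(\<Sum>ys\<in>words n. M ys) = 2 ^ nat \<lfloor>real n * r\<rfloor> * ?L"
        unfolding M_def by (rule sum_repro_bound[OF g])
      also have "log 2 \<dots> = real (nat \<lfloor>real n * r\<rfloor>) + log 2 ?L"
        using L1 by (subst log_mult) (auto simp: log_nat_power)
      \<comment> \<open>Rounding the key length down leaves fewer keys to guess, which favours the
        lower bound.\<close>
      also have "real (nat \<lfloor>real n * r\<rfloor>) \<le> real n * r" using r by simp
      finally have "real n * (c - r) \<le> log 2 ?L" by (simp add: algebra_simps)
      moreover have "0 \<le> log 2 ?L" using L1 by simp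
      ultimately have "max 0 (c - r) \<le> log 2 ?L / real n"
        using elim(2) by (simp add: field_simps)
      moreover have "maximal_leakage (source_message_law P n r f) = ereal (log 2 ?L)"
        using L1 by (simp add: maximal_leakage_source_message[OF P f] elog2_def)
      ultimately show "ereal (max 0 (c - r)) \<le> maximal_leakage (source_message_law P n r f) / ereal (real n)"
        using elim(2) by simp
    qed
  qed
qed

subsection \<open>Achievability\<close>

text \<open>Averaged over \<nu>, a point covers at least a fraction \<delta> of the elements still
  uncovered, so the best point does so as well. This is random coding with the codewords chosen one
  at a time.\<close>

lemma greedy_cover_step:
  fixes cov :: "'a \<Rightarrow> 'b \<Rightarrow> bool"
  assumes fin: "finite S" "finite Y" and \<nu>: "\<And>y. y \<in> Y \<Longrightarrow> 0 \<le> \<nu> y" "sum \<nu> Y \<le> 1"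
    and \<delta>: "0 < \<delta>" "\<delta> \<le> 1" and hit: "\<And>x. x \<in> S \<Longrightarrow> \<delta> \<le> (\<Sum>y\<in>{y \<in> Y. cov x y}. \<nu> y)"
  shows "\<exists>C\<subseteq>Y. finite C \<and> card C \<le> N \<and> real (card {x \<in> S. \<forall>y\<in>C. \<not> cov x y}) \<le> real (card S) * (1 - \<delta>) ^ N"
proof (induction N)
  case 0
  show ?case by (intro exI[of _ "{}"]) auto
next
  case (Suc N)
  then obtain C where C: "C \<subseteq> Y" "finite C" "card C \<le> N"
    "real (card {x \<in> S. \<forall>y\<in>C. \<not> cov x y}) \<le> real (card S) * (1 - \<delta>) ^ N" by blast
  let ?U = "{x \<in> S. \<forall>y\<in>C. \<not> cov x y}"
  have finU: "finite ?U" using fin by simp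
  show ?case
  proof (cases "?U = {}")
    case True
    show ?thesis by (rule exI[of _ C], unfold True) (use C \<delta> in auto)
  next
    case False
    then obtain x0 where x0: "x0 \<in> S" by blast
    have Yne: "Y \<noteq> {}" using hit[OF x0] \<delta> by auto
    define m where "m y = card {x \<in> ?U. cov x y}" for y
    have "Max (m ` Y) \<in> m ` Y" using fin Yne by (intro Max_in) auto
    then obtain y where y: "y \<in> Y" "m y = Max (m ` Y)" by auto
    have my: "m y' \<le> m y" if "y' \<in> Y" for y' unfolding y(2) using that fin by (intro Max_ge) auto
    have "\<delta> * card ?U = (\<Sum>x\<in>?U. \<delta>)" by simp
    also have "\<dots> \<le> (\<Sum>x\<in>?U. \<Sum>y\<in>Y. \<nu> y * of_bool (cov x y))"
    proof (rule sum_mono)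
      fix x assume "x \<in> ?U"
      then have "\<delta> \<le> (\<Sum>y\<in>{y \<in> Y. cov x y}. \<nu> y)" using hit by simp
      also have "\<dots> = (\<Sum>y\<in>Y. \<nu> y * of_bool (cov x y))"
        using fin by (intro sum.mono_neutral_cong_left) auto
      finally show "\<delta> \<le> (\<Sum>y\<in>Y. \<nu> y * of_bool (cov x y))" .
    qed
    also have "\<dots> = (\<Sum>y\<in>Y. \<nu> y * (\<Sum>x\<in>?U. of_bool (cov x y)))"
      by (subst sum.swap) (simp only: sum_distrib_left)
    also have "\<dots> = (\<Sum>y\<in>Y. \<nu> y * real (m y))"
    proof -
      have "(\<Sum>x\<in>?U. of_bool (cov x y)) = real (m y)" for y
        unfolding m_def using sum.inter_filter[OF finU, of "\<lambda>_. 1::real" "\<lambda>x. cov x y"]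
        by (simp add: of_bool_def)
      then show ?thesis by simp
    qed
    also have "\<dots> \<le> (\<Sum>y'\<in>Y. \<nu> y' * real (m y))"
      using \<nu> my by (intro sum_mono mult_left_mono) auto
    also have "\<dots> \<le> 1 * real (m y)" unfolding sum_distrib_right[symmetric] using \<nu> by (intro mult_right_mono) auto
    finally have hit_y: "\<delta> * card ?U \<le> m y" by simp
    have split: "{x \<in> S. \<forall>y'\<in>insert y C. \<not> cov x y'} = ?U - {x \<in> ?U. cov x y}" by auto
    have "real (card {x \<in> S. \<forall>y'\<in>insert y C. \<not> cov x y'}) = real (card ?U) - m y"
    proof -
      have sub: "{x \<in> ?U. cov x y} \<subseteq> ?U" by blast
      show ?thesis unfolding split m_def
        using card_Diff_subset[OF finite_subset[OF sub finU] sub] card_mono[OF finU sub] by (simp add: of_nat_diff)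
    qed
    also have "\<dots> \<le> real (card ?U) * (1 - \<delta>)" using hit_y by (simp add: algebra_simps)
    also have "\<dots> \<le> real (card S) * (1 - \<delta>) ^ N * (1 - \<delta>)"
      using C(4) \<delta> by (intro mult_right_mono) auto
    finally have "real (card {x \<in> S. \<forall>y'\<in>insert y C. \<not> cov x y'}) \<le> real (card S) * (1 - \<delta>) ^ Suc N"
      by (simp add: mult_ac)
    moreover have "card (insert y C) \<le> Suc N" using C card_insert_le_m1[of "Suc N" C y] by simp
    ultimately show ?thesis using C y by (intro exI[of _ "insert y C"]) auto
  qed
qed

text \<open>After N \<ge> ln(|S| + 1) / \<delta> steps at most |S| / (|S| + 1) elements remain
  uncovered, hence none. Adding 1 inside the logarithm makes the inequality strict and admits an
  empty S.\<close>

lemma greedy_cover: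
  fixes cov :: "'a \<Rightarrow> 'b \<Rightarrow> bool"
  assumes "finite S" "finite Y" and "\<And>y. y \<in> Y \<Longrightarrow> 0 \<le> \<nu> y" "sum \<nu> Y \<le> 1"
    and \<delta>: "0 < \<delta>" "\<delta> \<le> 1" and "\<And>x. x \<in> S \<Longrightarrow> \<delta> \<le> (\<Sum>y\<in>{y \<in> Y. cov x y}. \<nu> y)"
  shows "\<exists>C\<subseteq>Y. finite C \<and> real (card C) \<le> ln (real (card S) + 1) / \<delta> + 1 \<and> (\<forall>x\<in>S. \<exists>y\<in>C. cov x y)"
proof -
  define T where "T = ln (real (card S) + 1) / \<delta>"
  have T0: "0 \<le> T" unfolding T_def using \<delta> by (intro divide_nonneg_pos ln_ge_zero) auto
  define N where "N = nat \<lceil>T\<rceil>"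
  have N: "T \<le> real N" "real N \<le> T + 1" using T0 unfolding N_def by linarith+
  have "\<exists>C\<subseteq>Y. finite C \<and> card C \<le> N \<and> real (card {x \<in> S. \<forall>y\<in>C. \<not> cov x y}) \<le> real (card S) * (1 - \<delta>) ^ N"
    by (rule greedy_cover_step[where \<nu>=\<nu>]) (fact assms)+
  then obtain C where C: "C \<subseteq> Y" "finite C" "card C \<le> N"
    "real (card {x \<in> S. \<forall>y\<in>C. \<not> cov x y}) \<le> real (card S) * (1 - \<delta>) ^ N" by blast
  have "(1 - \<delta>) ^ N \<le> exp (- \<delta>) ^ N"
    using exp_ge_add_one_self[of "- \<delta>"] \<delta> by (intro power_mono) auto
  also have "\<dots> = exp (- (\<delta> * real N))"
    using exp_of_nat_mult[of N "- \<delta>"] by (simp add: mult.commute)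
  also have "\<dots> \<le> exp (- ln (real (card S) + 1))"
  proof -
    have "ln (real (card S) + 1) = \<delta> * T" using \<delta> by (simp add: T_def)
    also have "\<dots> \<le> \<delta> * real N" using N(1) \<delta> by (intro mult_left_mono) auto
    finally show ?thesis by (subst exp_le_cancel_iff) simp
  qed
  also have "\<dots> = 1 / (real (card S) + 1)" by (simp add: exp_minus divide_inverse)
  finally have "real (card S) * (1 - \<delta>) ^ N \<le> real (card S) * (1 / (real (card S) + 1))"
    by (intro mult_left_mono) auto
  also have "\<dots> < 1" by (simp add: field_simps)
  finally have "card {x \<in> S. \<forall>y\<in>C. \<not> cov x y} = 0" using C(4) by linarith
  moreover have "finite {x \<in> S. \<forall>y\<in>C. \<not> cov x y}" using assms(1) by simp
  ultimately have "\<forall>x\<in>S. \<exists>y\<in>C. cov x y" by (simp only: card_0_eq) blast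
  moreover have "real (card C) \<le> T + 1" using C(3) N(2) by linarith
  ultimately show ?thesis using C(1,2) unfolding T_def by blast
qed

text \<open>Under the test channel started at xs, the output meets the distortion level and has
  log-density against q of at most n(\<rho> + t) with probability at least 1/2. On that event the
  product law of q is at least 2^(-n(\<rho> + t)) times the channel law. The hypotheses see xs
  through its type only, so the threshold on n is common to all words.\<close>

lemma hitting_probability:
  fixes W :: "'x::finite \<Rightarrow> 'y::finite \<Rightarrow> real" and q :: "'y \<Rightarrow> real" and d :: "'x \<Rightarrow> 'y \<Rightarrow> real"
  assumes W: "\<And>x y. 0 \<le> W x y" "\<And>x. (\<Sum>y\<in>UNIV. W x y) = 1" and q: "\<And>y. 0 < q y"
    and t: "t > 0" and s: "s > 0"
  shows "\<forall>\<^sub>F n in sequentially. \<forall>xs \<in> words n.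
    (\<Sum>x\<in>UNIV. emp xs x * (\<Sum>y\<in>UNIV. W x y * log 2 (W x y / q y))) \<le> \<rho> \<longrightarrow>
    ((\<forall>x y. W x y > 0 \<longrightarrow> d x y \<le> D) \<or> (\<Sum>x\<in>UNIV. emp xs x * (\<Sum>y\<in>UNIV. W x y * d x y)) \<le> D - s) \<longrightarrow>
    1 / 2 * 2 powr (- (real n * (\<rho> + t))) \<le> (\<Sum>ys\<in>{ys \<in> words n. seq_distortion d n xs ys \<le> D}. prod_list (map q ys))"
proof -
  define h where "h x y = log 2 (W x y / q y)" for x y
  define B where "B = (MAX (x, y). \<bar>h x y - (\<Sum>y\<in>UNIV. W x y * h x y)\<bar>)"
  have B: "\<bar>h x y - (\<Sum>y\<in>UNIV. W x y * h x y)\<bar> \<le> B" for x y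
    unfolding B_def by (rule Max_ge) (auto intro: image_eqI[of _ _ "(x, y)"])
  define B' where "B' = (MAX (x, y). \<bar>d x y - (\<Sum>y\<in>UNIV. W x y * d x y)\<bar>)"
  have B': "\<bar>d x y - (\<Sum>y\<in>UNIV. W x y * d x y)\<bar> \<le> B'" for x y
    unfolding B'_def by (rule Max_ge) (auto intro: image_eqI[of _ _ "(x, y)"])
  have "((\<lambda>n::nat. B\<^sup>2 / (real n * t\<^sup>2)) \<longlongrightarrow> 0) sequentially" using t by real_asymp
  then have "\<forall>\<^sub>F n in sequentially. B\<^sup>2 / (real n * t\<^sup>2) < 1 / 4" by (rule order_tendstoD) simp
  moreover have "((\<lambda>n::nat. B'\<^sup>2 / (real n * s\<^sup>2)) \<longlongrightarrow> 0) sequentially" using s by real_asymp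
  then have "\<forall>\<^sub>F n in sequentially. B'\<^sup>2 / (real n * s\<^sup>2) < 1 / 4" by (rule order_tendstoD) simp
  ultimately show ?thesis using eventually_gt_at_top[of "0::nat"]
  proof eventually_elim
    case (elim n)
    show ?case
    proof (intro ballI impI)
      fix xs :: "'x list" assume xs: "xs \<in> words n"
        and rho: "(\<Sum>x\<in>UNIV. emp xs x * (\<Sum>y\<in>UNIV. W x y * log 2 (W x y / q y))) \<le> \<rho>"
        and dist: "(\<forall>x y. W x y > 0 \<longrightarrow> d x y \<le> D) \<or> (\<Sum>x\<in>UNIV. emp xs x * (\<Sum>y\<in>UNIV. W x y * d x y)) \<le> D - s"
      have len: "length xs = n" using xs by simp
      have mean: "(\<Sum>x\<leftarrow>xs. \<Sum>y\<in>UNIV. W x y * h x y) \<le> real n * \<rho>"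
        unfolding sum_list_eq_emp len h_def using rho by (intro mult_left_mono) auto
      let ?w = "wprod W xs"
      have wnn: "0 \<le> ?w ys" for ys by (rule wprod_nonneg[OF W(1)])
      have qne: "q y \<noteq> 0" for y using q[of y] by simp
      have qnn: "0 \<le> prod_list (map q ys)" for ys using q by (intro prod_list_nonneg) (auto intro: less_imp_le)
      define Bad1 where "Bad1 = {ys \<in> words n. wsum h xs ys \<ge> real n * (\<rho> + t)}"
      define Bad2 where "Bad2 = {ys \<in> words n. seq_distortion d n xs ys > D}"
      have fin: "finite (words n :: 'y list set)" by (rule finite_words)
      have b1: "sum ?w Bad1 \<le> 1 / 4"
      proof -
        have "sum ?w Bad1 \<le> (\<Sum>ys\<in>{ys \<in> words n. wsum h xs ys \<ge> (\<Sum>x\<leftarrow>xs. \<Sum>y\<in>UNIV. W x y * h x y) + real n * t}. ?w ys)"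
          using mean wnn fin by (intro sum_mono2) (auto simp: Bad1_def algebra_simps)
        also have "\<dots> \<le> B\<^sup>2 / (real n * t\<^sup>2)"
          by (rule chebyshev_wprod[OF W B len elim(3) t])
        finally show ?thesis using elim by linarith
      qed
      have b2: "sum ?w Bad2 \<le> 1 / 4"
      \<comment> \<open>A channel that respects the level letter by letter never violates it along a
        word; otherwise the slack s feeds Chebyshev.\<close>
      proof (cases "\<forall>x y. W x y > 0 \<longrightarrow> d x y \<le> D")
        case True
        have "?w ys = 0" if "ys \<in> Bad2" for ys
        proof (rule ccontr)
          assume "?w ys \<noteq> 0"
          then have "0 < ?w ys" using wnn[of ys] by simp
          have ly: "length ys = n" using that by (simp add: Bad2_def)
          have zp: "\<forall>(x, y)\<in>set (zip xs ys). d x y \<le> D"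
          proof -
            have "\<forall>(x, y)\<in>set (zip xs ys). 0 < W x y"
              using wprod_pos_iff[of W xs ys, OF W(1)] len ly \<open>0 < ?w ys\<close> by simp
            then show ?thesis using True by blast
          qed
          have "wsum d xs ys \<le> wsum (\<lambda>x y. D) xs ys"
            unfolding wsum_def using zp by (intro sum_list_mono) auto
          also have "\<dots> = real n * D" using len ly by (simp add: wsum_fst[of xs ys "\<lambda>_. D"] sum_list_triv)
          finally have "seq_distortion d n xs ys \<le> D"
            using len ly elim(3) by (simp add: seq_distortion_eq_wsum field_simps)
          then show False using that by (simp add: Bad2_def)
        qed
        then show ?thesis by simp
      next
        case False
        then have "(\<Sum>x\<leftarrow>xs. \<Sum>y\<in>UNIV. W x y * d x y) \<le> real n * (D - s)"
          unfolding sum_list_eq_emp len using dist by (intro mult_left_mono) auto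
        then have "sum ?w Bad2 \<le> (\<Sum>ys\<in>{ys \<in> words n. wsum d xs ys \<ge> (\<Sum>x\<leftarrow>xs. \<Sum>y\<in>UNIV. W x y * d x y) + real n * s}. ?w ys)"
          using wnn fin len elim(3)
          by (intro sum_mono2) (auto simp: Bad2_def seq_distortion_eq_wsum pos_less_divide_eq algebra_simps)
        also have "\<dots> \<le> B'\<^sup>2 / (real n * s\<^sup>2)"
          by (rule chebyshev_wprod[OF W B' len elim(3) s])
        finally show ?thesis using elim by linarith
      qed
      let ?G = "{ys \<in> words n. seq_distortion d n xs ys \<le> D}"
      have "1 = sum ?w (words n)" using sum_wprod[of W xs, OF W(2)] len by simp
      also have "\<dots> \<le> sum ?w ((?G - Bad1) \<union> (Bad1 \<union> Bad2))"
        using wnn fin by (intro sum_mono2) (auto simp: Bad1_def Bad2_def)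
      also have "\<dots> \<le> sum ?w (?G - Bad1) + sum ?w (Bad1 \<union> Bad2)"
        using wnn fin by (subst sum_Un) (auto simp: Bad1_def Bad2_def intro!: sum_nonneg)
      also have "sum ?w (Bad1 \<union> Bad2) \<le> sum ?w Bad1 + sum ?w Bad2"
        using wnn fin by (subst sum_Un) (auto simp: Bad1_def Bad2_def intro!: sum_nonneg)
      finally have "1 / 2 \<le> sum ?w (?G - Bad1)" using b1 b2 by linarith
      also have "\<dots> \<le> (\<Sum>ys\<in>?G - Bad1. 2 powr (real n * (\<rho> + t)) * prod_list (map q ys))"
      proof (rule sum_mono)
        fix ys assume ys: "ys \<in> ?G - Bad1"
        have qpos: "0 \<le> prod_list (map q ys)" using q by (intro prod_list_nonneg) (auto intro: less_imp_le)
        show "?w ys \<le> 2 powr (real n * (\<rho> + t)) * prod_list (map q ys)"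
        proof (cases "?w ys = 0")
          \<comment> \<open>Positivity of the product forces every factor W x y to be positive, so
            no logarithm in \<open>h\<close> takes its default value at 0.\<close>
          case False
          then have "0 < ?w ys" using wnn[of ys] by simp
          moreover have ly: "length xs = length ys" using ys len by simp
          ultimately have "\<forall>(x, y)\<in>set (zip xs ys). 0 < W x y / q y"
            using wprod_pos_iff[OF W(1) ly] q by (auto intro!: divide_pos_pos)
          from log_wprod[OF ly this] have lw: "log 2 (wprod (\<lambda>x y. W x y / q y) xs ys) = wsum h xs ys"
            and zp: "0 < wprod (\<lambda>x y. W x y / q y) xs ys" by (auto simp: h_def[abs_def])
          have "?w ys = wprod (\<lambda>x y. W x y / q y * q y) xs ys"
            using qne by simp
          also have "\<dots> = wprod (\<lambda>x y. W x y / q y) xs ys * wprod (\<lambda>x y. q y) xs ys"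
            by (rule wprod_mult[OF ly])
          also have "wprod (\<lambda>x y. q y) xs ys = prod_list (map q ys)"
            using wprod_flip[OF ly[symmetric], of "\<lambda>y x. q y"] wprod_fst[OF ly[symmetric], of q] by simp
          also have "wprod (\<lambda>x y. W x y / q y) xs ys = 2 powr (wsum h xs ys)"
            using zp by (simp add: lw[symmetric])
          also have "2 powr (wsum h xs ys) * prod_list (map q ys) \<le> 2 powr (real n * (\<rho> + t)) * prod_list (map q ys)"
            using ys qpos by (intro mult_right_mono) (auto simp: Bad1_def)
          finally show ?thesis .
        qed (use qpos in simp)
      qed
      also have "\<dots> \<le> (\<Sum>ys\<in>?G. 2 powr (real n * (\<rho> + t)) * prod_list (map q ys))"
        using fin qnn by (intro sum_mono2) auto
      finally have "1 / 2 \<le> 2 powr (real n * (\<rho> + t)) * (\<Sum>ys\<in>?G. prod_list (map q ys))"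
        by (simp add: sum_distrib_left)
      then have "2 powr (- (real n * (\<rho> + t))) * (1 / 2)
          \<le> 2 powr (- (real n * (\<rho> + t))) * (2 powr (real n * (\<rho> + t)) * (\<Sum>ys\<in>?G. prod_list (map q ys)))"
        by (intro mult_left_mono) auto
      also have "\<dots> = (\<Sum>ys\<in>?G. prod_list (map q ys))"
        unfolding mult.assoc[symmetric] powr_add[symmetric] by simp
      finally show "1 / 2 * 2 powr (- (real n * (\<rho> + t))) \<le> (\<Sum>ys\<in>?G. prod_list (map q ys))"
        by (simp only: mult.commute)
    qed
  qed
qed

text \<open>The true output marginal may vanish at letters that nearby types reach. Mixing in the
  uniform law makes every logarithm genuine at a small cost, and the strict inequality at
  \<open>Q\<close> then persists for types near \<open>Q\<close>.\<close>

lemma positive_output_law: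
  fixes Q :: "'x::finite \<Rightarrow> real" and W :: "'x \<Rightarrow> 'y::finite \<Rightarrow> real"
  assumes Q: "\<And>x. 0 \<le> Q x" "sum Q UNIV = 1" and W: "\<And>x y. 0 \<le> W x y" "\<And>x. (\<Sum>y\<in>UNIV. W x y) = 1"
    and c: "mi (\<lambda>(x, y). Q x * W x y) < c"
  obtains q where "\<And>y. 0 < q y" "sum q UNIV = 1"
    "(\<Sum>x\<in>UNIV. Q x * (\<Sum>y\<in>UNIV. W x y * log 2 (W x y / q y))) < c"
proof -
  let ?J = "\<lambda>(x, y). Q x * W x y"
  define o' where "o' y = margY ?J y" for y
  have Jnn: "0 \<le> ?J z" for z using Q W by (cases z) auto
  have mX: "margX ?J x = Q x" for x by (simp add: margX_def sum_distrib_left[symmetric] W)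
  have o0: "0 \<le> o' y" for y unfolding o'_def margY_def using Jnn by (intro sum_nonneg) auto
  have o1: "sum o' UNIV = 1"
    using sum_marg[of ?J] Q(2) by (simp add: o'_def[abs_def] mX[abs_def])
  define e where "e = (c - mi ?J) / 2"
  have e: "e > 0" using c by (simp add: e_def)
  \<comment> \<open>Chosen so that the penalty -log(1 - l) equals \<open>e\<close>, half of the gap
    below c.\<close>
  define l where "l = 1 - 2 powr (- e)"
  have l: "0 < l" "l < 1" "log 2 (1 - l) = - e" using e by (auto simp: l_def powr_less_one)
  define q where "q y = (1 - l) * o' y + l / CARD('y)" for y
  have qpos: "0 < q y" for y unfolding q_def using l o0[of y] by (intro add_nonneg_pos) auto
  have q1: "sum q UNIV = 1" by (simp add: q_def sum.distrib sum_distrib_left[symmetric] o1)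
  have "Q x * (W x y * log 2 (W x y / q y)) \<le> ?J (x, y) * log 2 (?J (x, y) / (margX ?J x * o' y)) + e * ?J (x, y)" for x y
  proof (cases "Q x * W x y = 0")
    case False
    then have pos: "Q x > 0" "W x y > 0" using Q(1)[of x] W(1)[of x y] by (auto simp: less_le)
    have "0 < ?J (x, y)" using pos by simp
    also have "\<dots> \<le> o' y" unfolding o'_def by (rule marg_ge(2)[OF Jnn])
    finally have opos: "0 < o' y" .
    have "(1 - l) * o' y \<le> q y" using l by (simp add: q_def)
    then have "log 2 ((1 - l) * o' y) \<le> log 2 (q y)" using l opos qpos by simp
    then have "- log 2 (q y) \<le> - log 2 (o' y) + e" using l opos by (simp add: log_mult)
    then have "log 2 (W x y / q y) \<le> log 2 (W x y / o' y) + e"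
      using pos qpos[of y] opos by (simp add: log_divide)
    moreover have "?J (x, y) / (margX ?J x * o' y) = W x y / o' y" using pos by (simp add: mX)
    ultimately have "Q x * W x y * log 2 (W x y / q y) \<le> Q x * W x y * (log 2 (?J (x, y) / (margX ?J x * o' y)) + e)"
      using pos by (intro mult_left_mono) auto
    then show ?thesis by (simp add: algebra_simps)
  qed auto
  then have "(\<Sum>x\<in>UNIV. \<Sum>y\<in>UNIV. Q x * (W x y * log 2 (W x y / q y)))
      \<le> (\<Sum>x\<in>UNIV. \<Sum>y\<in>UNIV. ?J (x, y) * log 2 (?J (x, y) / (margX ?J x * o' y)) + e * ?J (x, y))"
    by (intro sum_mono)
  also have "\<dots> = mi ?J + e * (\<Sum>x\<in>UNIV. \<Sum>y\<in>UNIV. ?J (x, y))"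
    by (simp add: mi_def o'_def sum.distrib sum_distrib_left sum_UNIV_pair)
  also have "(\<Sum>x\<in>UNIV. \<Sum>y\<in>UNIV. ?J (x, y)) = 1"
    by (simp add: sum_distrib_left[symmetric] W Q)
  also have "mi ?J + e * 1 < c" using c by (simp add: e_def field_simps)
  finally show thesis using that[of q] qpos q1 by (simp add: sum_distrib_left)
qed

text \<open>If choosing the best letter everywhere beats \<open>D\<close> on average, a little of
  that choice mixed into a near-optimal channel creates slack. If not, each letter charged by
  \<open>Q\<close> has minimal distortion exactly \<open>D\<close>, so a channel of mean distortion
  at most \<open>D\<close> uses letters of distortion \<open>D\<close> only.\<close>

lemma test_channel:
  fixes Q :: "'x::finite pmf" and d :: "'x \<Rightarrow> 'y::finite \<Rightarrow> real"
  assumes D: "D \<ge> (MAX x. MIN y. d x y)" and c: "rate_distortion d Q D < ereal c"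
  obtains W :: "'x \<Rightarrow> 'y \<Rightarrow> real" where "\<And>x y. 0 \<le> W x y" "\<And>x. (\<Sum>y\<in>UNIV. W x y) = 1"
    "mi (\<lambda>(x, y). pmf Q x * W x y) < c"
    "(\<forall>x y. W x y > 0 \<longrightarrow> d x y \<le> D) \<or> (\<Sum>x\<in>UNIV. pmf Q x * (\<Sum>y\<in>UNIV. W x y * d x y)) < D"
proof -
  obtain W0 where W0: "(\<Sum>(x, y)\<in>UNIV. pmf Q x * pmf (W0 x) y * d x y) \<le> D"
    "mi (\<lambda>(x, y). pmf Q x * pmf (W0 x) y) < c"
    using rate_distortion_lessE[OF c] by blast
  have dist0: "(\<Sum>x\<in>UNIV. pmf Q x * (\<Sum>y\<in>UNIV. pmf (W0 x) y * d x y)) \<le> D"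
    using W0(1) by (simp add: sum_UNIV_pair sum_distrib_left mult.assoc)
  have s0: "(\<Sum>y\<in>UNIV. pmf (W0 x) y) = 1" for x by (simp add: sum_pmf_eq_1)
  have sQ: "sum (pmf Q) UNIV = 1" by (simp add: sum_pmf_eq_1)
  have "\<exists>y. d x y = (MIN y. d x y)" for x
  proof -
    have "(MIN y. d x y) \<in> range (d x)" by (intro Min_in) auto
    then show ?thesis by (metis imageE)
  qed
  then obtain b where b: "\<And>x. d x (b x) = (MIN y. d x y)" by metis
  have b_le: "d x (b x) \<le> d x y" for x y unfolding b by (intro Min_le) auto
  have b_D: "d x (b x) \<le> D" for x
  proof -
    have "d x (b x) \<le> (MAX x. MIN y. d x y)" unfolding b by (intro Max_ge) auto
    then show ?thesis using D by (rule order.trans)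
  qed
  define \<beta> where "\<beta> x y = (of_bool (y = b x) :: real)" for x y
  have \<beta>s: "(\<Sum>y\<in>UNIV. \<beta> x y) = 1" "(\<Sum>y\<in>UNIV. \<beta> x y * d x y) = d x (b x)" for x
    by (simp_all add: \<beta>_def of_bool_def if_distrib[of "\<lambda>t. t * _"] cong: if_cong)
  show thesis
  proof (cases "(\<Sum>x\<in>UNIV. pmf Q x * d x (b x)) < D")
    case True
    define W where "W l x y = (1 - l) * pmf (W0 x) y + l * \<beta> x y" for l x y
    define v where "v l = (\<chi> z. pmf Q (fst z) * W l (fst z) (snd z))" for l
    have vW: "($) (v l) = (\<lambda>(x, y). pmf Q x * W l x y)" for l by (auto simp: v_def)
    have Wnn: "0 \<le> W l x y" if "0 \<le> l" "l \<le> 1" for l x y using that by (simp add: W_def \<beta>_def)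
    \<comment> \<open>Since \<open>mi\<close> is continuous up to the boundary, the strict bound at
      l = 0 survives for some small positive l.\<close>
    have "continuous_on {0..1} (\<lambda>l. mi (($) (v l)))"
    proof (rule continuous_on_compose2[OF continuous_on_mi])
      show "continuous_on {0..1} v" unfolding v_def W_def by (intro continuous_intros)
      show "v ` {0..1} \<subseteq> {v. \<forall>z. 0 \<le> v $ z}" using Wnn by (auto simp: v_def)
    qed
    then have "((\<lambda>l. mi (($) (v l))) \<longlongrightarrow> mi (($) (v 0))) (at 0 within {0..1})"
      by (simp add: continuous_on_def)
    moreover have "at (0::real) within {0..1} = at_right 0"
      by (rule at_within_nhd[of _ "{-1<..<1}"]) auto
    ultimately have "((\<lambda>l. mi (($) (v l))) \<longlongrightarrow> mi (($) (v 0))) (at_right 0)" by simp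
    moreover have "mi (($) (v 0)) < c" using W0(2) by (simp add: vW W_def)
    ultimately have "\<forall>\<^sub>F l in at_right 0. mi (($) (v l)) < c" by (rule order_tendstoD(2))
    moreover have "\<forall>\<^sub>F l in at_right (0::real). 0 < l \<and> l < 1"
      unfolding eventually_at_right_field by (intro exI[of _ 1]) auto
    ultimately have "\<forall>\<^sub>F l in at_right 0. mi (($) (v l)) < c \<and> 0 < l \<and> l < 1"
      by (rule eventually_conj)
    then obtain l where l: "mi (($) (v l)) < c" "0 < l" "l < 1"
      using eventually_happens'[OF trivial_limit_at_right_real] by blast
    have "(\<Sum>x\<in>UNIV. pmf Q x * (\<Sum>y\<in>UNIV. W l x y * d x y))
        = (1 - l) * (\<Sum>x\<in>UNIV. pmf Q x * (\<Sum>y\<in>UNIV. pmf (W0 x) y * d x y)) + l * (\<Sum>x\<in>UNIV. pmf Q x * d x (b x))"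
    proof -
      have "(\<Sum>y\<in>UNIV. W l x y * d x y) = (1 - l) * (\<Sum>y\<in>UNIV. pmf (W0 x) y * d x y) + l * d x (b x)" for x
        by (simp add: W_def \<beta>s(2)[symmetric] distrib_right sum.distrib sum_distrib_left mult.assoc)
      then show ?thesis by (simp add: distrib_left sum.distrib sum_distrib_left mult_ac)
    qed
    also have "\<dots> < (1 - l) * D + l * D"
      using l True dist0 by (intro add_le_less_mono mult_left_mono mult_strict_left_mono) auto
    finally have dW: "(\<Sum>x\<in>UNIV. pmf Q x * (\<Sum>y\<in>UNIV. W l x y * d x y)) < D" by (simp add: algebra_simps)
    show thesis
    proof (rule that[of "W l"])
      show "0 \<le> W l x y" for x y using l by (intro Wnn) auto
      show "(\<Sum>y\<in>UNIV. W l x y) = 1" for x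
        by (simp add: W_def sum.distrib sum_distrib_left[symmetric] s0 \<beta>s)
      show "mi (\<lambda>(x, y). pmf Q x * W l x y) < c" using l(1) by (simp add: vW)
    qed (use dW in blast)
  next
    case False
    have "(\<Sum>x\<in>UNIV. pmf Q x * (D - d x (b x))) = D - (\<Sum>x\<in>UNIV. pmf Q x * d x (b x))"
      by (simp add: right_diff_distrib sum_subtractf sum_distrib_right[symmetric] sQ)
    also have "\<dots> \<le> 0" using False by simp
    finally have "(\<Sum>x\<in>UNIV. pmf Q x * (D - d x (b x))) = 0"
      using b_D by (intro antisym sum_nonneg) auto
    then have "pmf Q x * (D - d x (b x)) = 0" for x
      using b_D by (subst (asm) sum_nonneg_eq_0_iff) auto
    then have bD: "d x (b x) = D" if "pmf Q x > 0" for x using that by (metis eq_iff_diff_eq_0 less_irrefl mult_eq_0_iff)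
    \<comment> \<open>With all distortions at least \<open>D\<close> on the support and a mean of at
      most \<open>D\<close>, the excess is a sum of nonnegative terms that is at most 0, so each
      term vanishes.\<close>
    have dge: "D \<le> d x y" if "pmf Q x > 0" for x y using bD[OF that] b_le[of x y] by simp
    have nn: "0 \<le> pmf Q x * (\<Sum>y\<in>UNIV. pmf (W0 x) y * (d x y - D))" for x
      using dge[of x] by (cases "pmf Q x > 0") (auto intro!: mult_nonneg_nonneg sum_nonneg simp: not_less)
    have e: "(\<Sum>y\<in>UNIV. pmf (W0 x) y * (d x y - D)) = (\<Sum>y\<in>UNIV. pmf (W0 x) y * d x y) - D" for x
      by (simp add: right_diff_distrib sum_subtractf sum_distrib_right[symmetric] s0)
    have "(\<Sum>x\<in>UNIV. pmf Q x * (\<Sum>y\<in>UNIV. pmf (W0 x) y * (d x y - D)))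
        = (\<Sum>x\<in>UNIV. pmf Q x * (\<Sum>y\<in>UNIV. pmf (W0 x) y * d x y)) - D"
      unfolding e by (simp add: right_diff_distrib sum_subtractf sum_distrib_right[symmetric] sQ)
    then have "(\<Sum>x\<in>UNIV. pmf Q x * (\<Sum>y\<in>UNIV. pmf (W0 x) y * (d x y - D))) = 0"
      using dist0 nn by (intro antisym sum_nonneg) auto
    then have z: "pmf Q x * (\<Sum>y\<in>UNIV. pmf (W0 x) y * (d x y - D)) = 0" for x
      using nn by (subst (asm) sum_nonneg_eq_0_iff) auto
    have W0D: "d x y \<le> D" if "pmf Q x > 0" "pmf (W0 x) y > 0" for x y
    proof -
      have "(\<Sum>y\<in>UNIV. pmf (W0 x) y * (d x y - D)) = 0" using z[of x] that by simp
      then have "pmf (W0 x) y * (d x y - D) = 0"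
        using dge[OF that(1)] by (subst (asm) sum_nonneg_eq_0_iff) auto
      then show ?thesis using that by simp
    qed
    \<comment> \<open>Off the support of \<open>Q\<close> the channel can be changed without
      affecting the joint law; the best letter makes the constraint hold there too.\<close>
    define W where "W x y = (if pmf Q x > 0 then pmf (W0 x) y else \<beta> x y)" for x y
    have same: "pmf Q x * W x y = pmf Q x * pmf (W0 x) y" for x y
    using pmf_nonneg[of Q x] by (auto simp: W_def less_le)
    show thesis
    proof (rule that[of W])
      show "0 \<le> W x y" for x y by (simp add: W_def \<beta>_def)
      show "(\<Sum>y\<in>UNIV. W x y) = 1" for x by (cases "pmf Q x > 0") (simp_all add: W_def s0 \<beta>s)
      show "mi (\<lambda>(x, y). pmf Q x * W x y) < c" using W0(2) by (simp add: same)
      show "(\<forall>x y. W x y > 0 \<longrightarrow> d x y \<le> D) \<or> (\<Sum>x\<in>UNIV. pmf Q x * (\<Sum>y\<in>UNIV. W x y * d x y)) < D"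
        using W0D b_D by (auto simp: W_def \<beta>_def split: if_splits)
    qed
  qed
qed

text \<open>One test channel, chosen for \<open>Q\<close>, serves all types satisfying two strict
  linear inequalities, a rate bound and, unless the constraint holds surely, a distortion bound. The
  hitting probability then feeds the greedy cover.\<close>

lemma local_cover:
  fixes Q :: "'x::finite pmf" and d :: "'x \<Rightarrow> 'y::finite \<Rightarrow> real"
  assumes D: "D \<ge> (MAX x. MIN y. d x y)" and c: "rate_distortion d Q D < ereal c" and \<epsilon>: "\<epsilon> > 0"
  obtains U :: "(real^'x) set" where "open U" "(\<chi> x. pmf Q x) \<in> U"
    "\<forall>\<^sub>F n in sequentially. \<exists>C\<subseteq>words n. finite C \<and> real (card C) \<le> 2 powr (real n * (c + \<epsilon>)) \<and>
       (\<forall>xs\<in>words n. (\<chi> x. emp xs x) \<in> U \<longrightarrow> (\<exists>ys\<in>C. seq_distortion d n xs ys \<le> D))"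
proof -
  obtain W :: "'x \<Rightarrow> 'y \<Rightarrow> real" where W: "\<And>x y. 0 \<le> W x y" "\<And>x. (\<Sum>y\<in>UNIV. W x y) = 1"
    and miW: "mi (\<lambda>(x, y). pmf Q x * W x y) < c"
    and dW: "(\<forall>x y. W x y > 0 \<longrightarrow> d x y \<le> D) \<or> (\<Sum>x\<in>UNIV. pmf Q x * (\<Sum>y\<in>UNIV. W x y * d x y)) < D"
    by (rule test_channel[OF D c]) blast
  obtain q :: "'y \<Rightarrow> real" where q: "\<And>y. 0 < q y" "sum q UNIV = 1"
    and qc: "(\<Sum>x\<in>UNIV. pmf Q x * (\<Sum>y\<in>UNIV. W x y * log 2 (W x y / q y))) < c"
    by (rule positive_output_law[of "pmf Q" W c]) (use W miW in \<open>auto simp: sum_pmf_eq_1\<close>)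
  define h where "h x = (\<Sum>y\<in>UNIV. W x y * log 2 (W x y / q y))" for x
  define g where "g x = (\<Sum>y\<in>UNIV. W x y * d x y)" for x
  define sure where "sure \<longleftrightarrow> (\<forall>x y. W x y > 0 \<longrightarrow> d x y \<le> D)"
  \<comment> \<open>Half of the slack at \<open>Q\<close>. In the sure case any positive number will
    do.\<close>
  define s where "s = (if sure then 1 else (D - (\<Sum>x\<in>UNIV. pmf Q x * g x)) / 2)"
  have s: "s > 0" using dW by (auto simp: s_def g_def sure_def)
  define U where "U = {v :: real^'x. (\<Sum>x\<in>UNIV. v $ x * h x) < c} \<inter>
    (if sure then UNIV else {v. (\<Sum>x\<in>UNIV. v $ x * g x) < D - s})"
  have "open U" unfolding U_def
    by (auto intro!: open_Int open_Collect_less continuous_intros)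
  moreover have "(\<chi> x. pmf Q x) \<in> U"
  proof -
    have "(\<Sum>x\<in>UNIV. pmf Q x * g x) < D - s" if "\<not> sure"
    proof -
      have "(\<Sum>x\<in>UNIV. pmf Q x * g x) < D" using dW that unfolding sure_def g_def by blast
      then show ?thesis using that unfolding s_def by simp argo
    qed
    then show ?thesis using qc by (simp add: U_def h_def)
  qed
  moreover have "\<forall>\<^sub>F n in sequentially. \<exists>C\<subseteq>words n. finite C \<and> real (card C) \<le> 2 powr (real n * (c + \<epsilon>)) \<and>
       (\<forall>xs\<in>words n. (\<chi> x. emp xs x) \<in> U \<longrightarrow> (\<exists>ys\<in>C. seq_distortion d n xs ys \<le> D))"
  proof -
    \<comment> \<open>The logarithm in the covering bound grows only like nK, because |S| + 1 \<le>
      (|X| + 1)^n for n > 0. Half of \<epsilon> pays for this factor, the other half for the hitting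
      probability.\<close>
    define K where "K = ln (real CARD('x) + 1)"
    have "\<forall>\<^sub>F n in sequentially. 2 * real n * K + 1 \<le> 2 powr (real n * (\<epsilon> / 2))"
      using \<epsilon> by real_asymp
    moreover have "\<epsilon> / 2 > 0" using \<epsilon> by simp
    note hitting_probability[of W q "\<epsilon> / 2" s c d D, OF W q(1) this s]
    ultimately show ?thesis using eventually_gt_at_top[of "0::nat"]
    proof eventually_elim
      case (elim n)
      have "(0::ereal) < ereal c" using rate_distortion_nonneg c by (rule order.strict_trans1)
      then have c0: "0 \<le> c" by simp
      define S where "S = {xs \<in> words n. (\<chi> x. emp xs x) \<in> U}"
      have fS: "finite S" unfolding S_def by (rule finite_subset[OF _ finite_words[of n]]) auto
      define \<delta> where "\<delta> = 1 / 2 * 2 powr (- (real n * (c + \<epsilon> / 2)))"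
      have "2 powr (- (real n * (c + \<epsilon> / 2))) \<le> 2 powr 0" using c0 \<epsilon> by (intro powr_mono) auto
      then have \<delta>: "0 < \<delta>" "\<delta> \<le> 1" by (auto simp: \<delta>_def)
      have hit: "\<delta> \<le> (\<Sum>ys\<in>{ys \<in> words n. seq_distortion d n xs ys \<le> D}. prod_list (map q ys))" if "xs \<in> S" for xs
      proof -
        have "(\<Sum>x\<in>UNIV. emp xs x * (\<Sum>y\<in>UNIV. W x y * log 2 (W x y / q y))) \<le> c"
          "(\<forall>x y. W x y > 0 \<longrightarrow> d x y \<le> D) \<or> (\<Sum>x\<in>UNIV. emp xs x * (\<Sum>y\<in>UNIV. W x y * d x y)) \<le> D - s"
          using that by (auto simp: S_def U_def h_def g_def sure_def split: if_splits)
        then show ?thesis using elim(2) that unfolding \<delta>_def S_def by blast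
      qed
      have "\<exists>C\<subseteq>words n. finite C \<and> real (card C) \<le> ln (real (card S) + 1) / \<delta> + 1
          \<and> (\<forall>xs\<in>S. \<exists>ys\<in>C. seq_distortion d n xs ys \<le> D)"
        by (rule greedy_cover[where \<nu>="\<lambda>ys. prod_list (map q ys)", OF fS finite_words _ _ \<delta> hit])
          (use q in \<open>auto intro!: prod_list_nonneg less_imp_le[OF q(1)] simp: sum_prod_list\<close>)
      then obtain C where C: "C \<subseteq> words n" "finite C" "real (card C) \<le> ln (real (card S) + 1) / \<delta> + 1"
        "\<forall>xs\<in>S. \<exists>ys\<in>C. seq_distortion d n xs ys \<le> D" by blast
      have "card S \<le> CARD('x) ^ n"
        unfolding card_words[symmetric] by (intro card_mono finite_words) (auto simp: S_def)
      moreover have "CARD('x) ^ n + 1 \<le> (CARD('x) + 1) ^ n"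
      proof -
        have "CARD('x) ^ n < (CARD('x) + 1) ^ n" using elim(3) by (intro power_strict_mono) auto
        then show ?thesis by simp
      qed
      ultimately have "card S + 1 \<le> (CARD('x) + 1) ^ n" by linarith
      then have "real (card S + 1) \<le> real ((CARD('x) + 1) ^ n)" by (simp only: of_nat_le_iff)
      then have "real (card S) + 1 \<le> (real CARD('x) + 1) ^ n" by (simp add: add.commute)
      then have "ln (real (card S) + 1) \<le> ln ((real CARD('x) + 1) ^ n)" by simp
      also have "\<dots> = real n * K" by (simp add: K_def ln_realpow)
      finally have lnS: "ln (real (card S) + 1) \<le> real n * K" .
      have "real (card C) \<le> ln (real (card S) + 1) / \<delta> + 1" by (rule C(3))
      also have "\<dots> \<le> real n * K / \<delta> + 1" using lnS \<delta> by (simp add: divide_right_mono)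
      also have "real n * K / \<delta> = 2 * real n * K * 2 powr (real n * (c + \<epsilon> / 2))"
        unfolding \<delta>_def powr_minus_divide by simp
      also have "2 * real n * K * 2 powr (real n * (c + \<epsilon> / 2)) + 1
          \<le> 2 * real n * K * 2 powr (real n * (c + \<epsilon> / 2)) + 2 powr (real n * (c + \<epsilon> / 2))"
        using c0 \<epsilon> by (simp add: ge_one_powr_ge_zero)
      also have "\<dots> = (2 * real n * K + 1) * 2 powr (real n * (c + \<epsilon> / 2))" by (simp add: algebra_simps)
      also have "\<dots> \<le> 2 powr (real n * (\<epsilon> / 2)) * 2 powr (real n * (c + \<epsilon> / 2))"
        using elim(1) by (intro mult_right_mono) auto
      also have "\<dots> = 2 powr (real n * (c + \<epsilon>))"
        unfolding powr_add[symmetric] by (rule arg_cong[of _ _ "\<lambda>z. 2 powr z"]) (simp add: field_simps)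
      finally have "real (card C) \<le> 2 powr (real n * (c + \<epsilon>))" .
      moreover have "\<forall>xs\<in>words n. (\<chi> x. emp xs x) \<in> U \<longrightarrow> (\<exists>ys\<in>C. seq_distortion d n xs ys \<le> D)"
        using C(4) by (auto simp: S_def)
      ultimately show ?case using C(1,2) by blast
    qed
  qed
  ultimately show thesis by (rule that)
qed

section \<open>The divergence ball, its neighbourhoods and a cover of all nearby types\<close>

lemma prob_simplex_pmf:
  assumes "v \<in> prob_simplex"
  obtains Q :: "'x::finite pmf" where "v = (\<chi> x. pmf Q x)"
proof -
  obtain Q where "pmf Q = ($) v"
    by (rule exists_pmf[of "($) v"]) (use assms in \<open>auto simp: prob_simplex_def\<close>)
  then show thesis using that[of Q] by (simp add: vec_eq_iff)
qed

lemma continuous_on_kl: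
  fixes p :: "'x::finite \<Rightarrow> real"
  assumes "\<And>x. 0 < p x"
  shows "continuous_on prob_simplex (\<lambda>v. kl (($) v) p)"
proof -
  have "continuous_on prob_simplex (\<lambda>v::real^'x. \<Sum>x\<in>UNIV. xlog (v $ x) - v $ x * log 2 (p x))"
    by (intro continuous_intros continuous_on_xlog_comp) (auto simp: prob_simplex_def)
  moreover have "(\<Sum>x\<in>UNIV. xlog (v $ x) - v $ x * log 2 (p x)) = kl (($) v) p" if "v \<in> prob_simplex" for v
    unfolding kl_def
  proof (intro sum.cong refl)
    fix x
    show "xlog (v $ x) - v $ x * log 2 (p x) = v $ x * log 2 (v $ x / p x)"
      using assms[of x] that by (cases "v $ x = 0") (auto simp: xlog_def log_divide algebra_simps prob_simplex_def)
  qed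
  ultimately show ?thesis by (rule continuous_on_eq)
qed

definition divergence_ball :: "'x::finite pmf \<Rightarrow> ereal \<Rightarrow> (real^'x) set" where
  "divergence_ball P \<alpha> = {v \<in> prob_simplex. ereal (kl (($) v) (pmf P)) \<le> \<alpha>}"

lemma compact_divergence_ball:
  fixes P :: "'x::finite pmf"
  assumes P: "set_pmf P = UNIV" and \<alpha>: "\<alpha> > 0"
  shows "compact (divergence_ball P \<alpha>)"
proof (cases \<alpha>)
  case (real a)
  have "closed (prob_simplex \<inter> (\<lambda>v. kl (($) v) (pmf P)) -` {..a})"
    by (intro continuous_closed_preimage continuous_on_kl compact_imp_closed[OF compact_prob_simplex])
      (auto simp: pmf_positive P)
  moreover have "divergence_ball P \<alpha> = prob_simplex \<inter> (prob_simplex \<inter> (\<lambda>v. kl (($) v) (pmf P)) -` {..a})"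
    by (auto simp: divergence_ball_def real)
  ultimately show ?thesis by (simp only: compact_Int_closed[OF compact_prob_simplex])
next
  case PInf
  then have "divergence_ball P \<alpha> = prob_simplex" by (auto simp: divergence_ball_def)
  then show ?thesis by (simp add: compact_prob_simplex)
qed (use \<alpha> in auto)

lemma emp_in_simplex:
  fixes xs :: "'x::finite list"
  shows "length xs = n \<Longrightarrow> n > 0 \<Longrightarrow> (\<chi> x. emp xs x) \<in> prob_simplex"
  using sum_emp[of xs] by (auto simp: prob_simplex_def emp_nonneg)

text \<open>On the compact set of laws outside \<open>U\<close> the divergence attains a minimum a'
  above \<alpha>, and the resulting exponential gap beats the polynomial number of types. When no
  law lies outside \<open>U\<close>, as for \<alpha> = \<infinity>, the probability is exactly
  0.\<close>

lemma prob_atypical: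
  fixes P :: "'x::finite pmf"
  assumes P: "set_pmf P = UNIV" and \<alpha>: "\<alpha> > 0" and U: "open U" "divergence_ball P \<alpha> \<subseteq> U"
  shows "\<forall>\<^sub>F n in sequentially. (\<Sum>xs\<in>{xs \<in> words n. (\<chi> x. emp xs x) \<notin> U}. prod_list (map (pmf P) xs)) \<le> excess_bound \<alpha> n"
proof -
  have pos: "0 < pmf P x" for x using P by (simp add: pmf_positive)
  have enn: "0 \<le> excess_bound \<alpha> n" for n by (simp add: excess_bound_def)
  show ?thesis
  proof (cases "prob_simplex - U = {}")
    case True
    show ?thesis using eventually_gt_at_top[of "0::nat"]
    proof eventually_elim
      case (elim n)
      then have e: "{xs \<in> words n. (\<chi> x. emp xs x) \<notin> U} = {}"
        using True emp_in_simplex[of _ n] by blast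
      show ?case unfolding e using enn by simp
    qed
  next
    case False
    then have "\<alpha> \<noteq> \<infinity>" using U(2) by (auto simp: divergence_ball_def)
    then obtain a where a: "\<alpha> = ereal a" using \<alpha> by (cases \<alpha>) auto
    have "compact (prob_simplex - U)" using compact_prob_simplex U(1) by (rule compact_diff)
    moreover have "continuous_on (prob_simplex - U) (\<lambda>v. kl (($) v) (pmf P))"
      by (rule continuous_on_subset[OF continuous_on_kl[OF pos]]) auto
    ultimately obtain v where v: "v \<in> prob_simplex - U" "\<And>w. w \<in> prob_simplex - U \<Longrightarrow> kl (($) v) (pmf P) \<le> kl (($) w) (pmf P)"
      using continuous_attains_inf[of "prob_simplex - U"] False by blast
    define a' where "a' = kl (($) v) (pmf P)"
    have "v \<notin> divergence_ball P \<alpha>" using v(1) U(2) by blast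
    then have aa: "a < a'" using v(1) by (simp add: divergence_ball_def a a'_def)
    define k where "k = real CARD('x)"
    have "\<forall>\<^sub>F n in sequentially. (real n + 1) powr k * 2 powr (- (real n * a')) \<le> 2 powr (- (real n * a))"
    proof -
      have "((\<lambda>n::nat. (real n + 1) powr k * 2 powr (- (real n * (a' - a)))) \<longlongrightarrow> 0) sequentially"
      proof -
        define t where "t = a' - a"
        have "t > 0" using aa by (simp add: t_def)
        then show ?thesis unfolding t_def[symmetric] by real_asymp
      qed
      then have "\<forall>\<^sub>F n in sequentially. (real n + 1) powr k * 2 powr (- (real n * (a' - a))) < 1"
        by (rule order_tendstoD) simp
      then show ?thesis
      proof eventually_elim
        case (elim n)
        have "(real n + 1) powr k * 2 powr (- (real n * a'))
            = ((real n + 1) powr k * 2 powr (- (real n * (a' - a)))) * 2 powr (- (real n * a))"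
          unfolding mult.assoc powr_add[symmetric] by (simp add: algebra_simps)
        also have "\<dots> \<le> 1 * 2 powr (- (real n * a))" using elim by (intro mult_right_mono) auto
        finally show ?case by simp
      qed
    qed
    then show ?thesis using eventually_gt_at_top[of "0::nat"]
    proof eventually_elim
      case (elim n)
      let ?B = "{xs \<in> words n. (\<chi> x. emp xs x) \<notin> U}"
      have enn: "0 \<le> prod_list (map (emp xs) xs)" for xs :: "'x list"
        by (intro prod_list_nonneg) (auto simp: emp_nonneg)
      have "(\<Sum>xs\<in>?B. prod_list (map (pmf P) xs)) \<le> (\<Sum>xs\<in>?B. 2 powr (- (real n * a')) * prod_list (map (emp xs) xs))"
      proof (rule sum_mono)
        fix xs assume xs: "xs \<in> ?B"
        then have "a' \<le> kl (($) (\<chi> x. emp xs x)) (pmf P)"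
          unfolding a'_def using v(2) emp_in_simplex[of xs n] elim(2) by blast
        moreover have "($) (\<chi> x. emp xs x) = emp xs" by (simp add: fun_eq_iff)
        ultimately have "a' \<le> kl (emp xs) (pmf P)" by simp
        then have "2 powr (- (real n * kl (emp xs) (pmf P))) \<le> 2 powr (- (real n * a'))"
          by (intro powr_mono) (auto intro: mult_left_mono)
        then show "prod_list (map (pmf P) xs) \<le> 2 powr (- (real n * a')) * prod_list (map (emp xs) xs)"
          using xs prod_list_type[of "pmf P" xs, OF pos] enn[of xs] by (simp add: mult_right_mono)
      qed
      also have "\<dots> \<le> (\<Sum>xs\<in>(words n :: 'x list set). 2 powr (- (real n * a')) * prod_list (map (emp xs) xs))"
        using enn by (intro sum_mono2 finite_words) auto
      also have "\<dots> = 2 powr (- (real n * a')) * (\<Sum>xs\<in>(words n :: 'x list set). prod_list (map (emp xs) xs))"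
        by (simp add: sum_distrib_left)
      also have "\<dots> \<le> 2 powr (- (real n * a')) * real ((n + 1) ^ CARD('x))"
        by (intro mult_left_mono sum_prod_emp_le elim(2)) auto
      also have "real ((n + 1) ^ CARD('x)) = (real n + 1) powr k"
        by (simp add: k_def powr_realpow add.commute)
      finally show ?case using elim(1) by (simp add: excess_bound_def a mult.commute)
    qed
  qed
qed

text \<open>Finitely many of the local neighbourhoods cover the ball, and the union of their
  codebooks serves all types in the open union. Their number is a constant, which half of \<epsilon>
  absorbs for large n.\<close>

lemma global_cover:
  fixes P :: "'x::finite pmf" and d :: "'x \<Rightarrow> 'y::finite \<Rightarrow> real"
  assumes P: "set_pmf P = UNIV" and \<alpha>: "\<alpha> > 0" and D: "D \<ge> (MAX x. MIN y. d x y)"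
    and c: "\<And>Q. ereal (relative_entropy Q P) \<le> \<alpha> \<Longrightarrow> rate_distortion d Q D < ereal c" and \<epsilon>: "\<epsilon> > 0"
  obtains U :: "(real^'x) set" where "open U" "divergence_ball P \<alpha> \<subseteq> U"
    "\<forall>\<^sub>F n in sequentially. \<exists>C\<subseteq>words n. finite C \<and> real (card C) \<le> 2 powr (real n * (c + \<epsilon>)) \<and>
       (\<forall>xs\<in>words n. (\<chi> x. emp xs x) \<in> U \<longrightarrow> (\<exists>ys\<in>C. seq_distortion d n xs ys \<le> D))"
proof -
  define good where "good U \<longleftrightarrow> open U \<and> (\<forall>\<^sub>F n in sequentially. \<exists>C\<subseteq>words n. finite C \<and> real (card C) \<le> 2 powr (real n * (c + \<epsilon> / 2)) \<and>
       (\<forall>xs\<in>words n. (\<chi> x. emp xs x) \<in> U \<longrightarrow> (\<exists>ys\<in>C. seq_distortion d n xs ys \<le> D)))" for U :: "(real^'x) set"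
  have "\<exists>U. good U \<and> v \<in> U" if v: "v \<in> divergence_ball P \<alpha>" for v
  proof -
    from v obtain Q :: "'x pmf" where Q: "v = (\<chi> x. pmf Q x)"
      using prob_simplex_pmf[of v] by (auto simp: divergence_ball_def)
    have "($) v = pmf Q" by (auto simp: Q)
    then have "ereal (relative_entropy Q P) \<le> \<alpha>"
      using v by (simp add: divergence_ball_def relative_entropy_eq[OF P])
    then have "rate_distortion d Q D < ereal c" by (rule c)
    moreover have "\<epsilon> / 2 > 0" using \<epsilon> by simp
    ultimately show ?thesis
      by (rule local_cover[OF D]) (auto simp: good_def Q)
  qed
  then have "divergence_ball P \<alpha> \<subseteq> \<Union> {U. good U}" by blast
  moreover have "\<forall>B\<in>{U. good U}. open B" by (simp add: good_def)
  ultimately obtain \<U> where \<U>: "\<U> \<subseteq> {U. good U}" "finite \<U>" "divergence_ball P \<alpha> \<subseteq> \<Union>\<U>"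
    using compact_divergence_ball[OF P \<alpha>] by (meson compactE)
  have "\<forall>U\<in>\<U>. \<forall>\<^sub>F n in sequentially. \<exists>C\<subseteq>words n. finite C \<and> real (card C) \<le> 2 powr (real n * (c + \<epsilon> / 2)) \<and>
       (\<forall>xs\<in>words n. (\<chi> x. emp xs x) \<in> U \<longrightarrow> (\<exists>ys\<in>C. seq_distortion d n xs ys \<le> D))"
    using \<U>(1) by (auto simp: good_def)
  then have "\<forall>\<^sub>F n in sequentially. \<forall>U\<in>\<U>. \<exists>C\<subseteq>words n. finite C \<and> real (card C) \<le> 2 powr (real n * (c + \<epsilon> / 2)) \<and>
       (\<forall>xs\<in>words n. (\<chi> x. emp xs x) \<in> U \<longrightarrow> (\<exists>ys\<in>C. seq_distortion d n xs ys \<le> D))"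
    by (rule eventually_ball_finite[OF \<U>(2)])
  moreover define m where "m = real (card \<U>)"
  have "\<forall>\<^sub>F n in sequentially. m \<le> 2 powr (real n * (\<epsilon> / 2))" using \<epsilon> by real_asymp
  ultimately have "\<forall>\<^sub>F n in sequentially. \<exists>C\<subseteq>words n. finite C \<and> real (card C) \<le> 2 powr (real n * (c + \<epsilon>)) \<and>
       (\<forall>xs\<in>words n. (\<chi> x. emp xs x) \<in> \<Union>\<U> \<longrightarrow> (\<exists>ys\<in>C. seq_distortion d n xs ys \<le> D))"
  proof eventually_elim
    case (elim n)
    from bchoice[OF elim(1)] obtain C where C: "\<forall>U\<in>\<U>. C U \<subseteq> words n \<and> finite (C U) \<and> real (card (C U)) \<le> 2 powr (real n * (c + \<epsilon> / 2)) \<and>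
       (\<forall>xs\<in>words n. (\<chi> x. emp xs x) \<in> U \<longrightarrow> (\<exists>ys\<in>C U. seq_distortion d n xs ys \<le> D))" by blast
    have "real (card (\<Union>U\<in>\<U>. C U)) \<le> (\<Sum>U\<in>\<U>. real (card (C U)))"
      using card_UN_le[OF \<U>(2), of C] by (metis of_nat_le_iff of_nat_sum)
    also have "\<dots> \<le> (\<Sum>U\<in>\<U>. 2 powr (real n * (c + \<epsilon> / 2)))" using C by (intro sum_mono) auto
    also have "\<dots> = m * 2 powr (real n * (c + \<epsilon> / 2))" by (simp add: m_def)
    also have "\<dots> \<le> 2 powr (real n * (\<epsilon> / 2)) * 2 powr (real n * (c + \<epsilon> / 2))"
      using elim(2) by (intro mult_right_mono) auto
    also have "\<dots> = 2 powr (real n * (c + \<epsilon>))"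
      unfolding powr_add[symmetric] by (rule arg_cong[of _ _ "\<lambda>z. 2 powr z"]) (simp add: field_simps)
    finally have "real (card (\<Union>U\<in>\<U>. C U)) \<le> 2 powr (real n * (c + \<epsilon>))" .
    moreover have "(\<Union>U\<in>\<U>. C U) \<subseteq> words n" "finite (\<Union>U\<in>\<U>. C U)" using C \<U>(2) by blast+
    moreover have "\<forall>xs\<in>words n. (\<chi> x. emp xs x) \<in> \<Union>\<U> \<longrightarrow> (\<exists>ys\<in>(\<Union>U\<in>\<U>. C U). seq_distortion d n xs ys \<le> D)"
      using C by blast
    ultimately show ?case by blast
  qed
  moreover have "open (\<Union>\<U>)" using \<U>(1) by (auto simp: good_def)
  ultimately show thesis using that \<U>(3) by blast
qed

section \<open>The one-time pad and the resulting code\<close>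

abbreviation xor_list :: "bool list \<Rightarrow> bool list \<Rightarrow> bool list" where
  "xor_list \<equiv> map2 (\<noteq>)"

lemma xor_list_cancel: "length xs = length ys \<Longrightarrow> xor_list (xor_list xs ys) ys = xs"
  by (induction xs ys rule: list_induct2) auto

lemma xor_list_cancel_left: "length xs = length ys \<Longrightarrow> xor_list xs (xor_list xs ys) = ys"
  by (induction xs ys rule: list_induct2) auto

text \<open>Plaintext and ciphertext determine the first l' key bits; only the remaining l - l' are
  free.\<close>

lemma card_keys_le:
  fixes s s' :: "bool list"
  assumes "length s = l'" "l' \<le> l"
  shows "card {k \<in> words l. xor_list s (take l' k) = s'} \<le> 2 ^ (l - l')"
proof -
  let ?A = "{k \<in> words l. xor_list s (take l' k) = s'}"
  have tk: "take l' k = xor_list s s'" if "k \<in> ?A" for k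
    using that assms xor_list_cancel_left[of s "take l' k"] by auto
  have "inj_on (drop l') ?A"
  proof (rule inj_onI)
    fix k k' assume "k \<in> ?A" "k' \<in> ?A" "drop l' k = drop l' k'"
    then have "take l' k @ drop l' k = take l' k' @ drop l' k'" using tk[of k] tk[of k'] by simp
    then show "k = k'" by (simp only: append_take_drop_id)
  qed
  moreover have "drop l' ` ?A \<subseteq> (words (l - l') :: bool list set)" by auto
  ultimately have "card ?A \<le> card (words (l - l') :: bool list set)"
    by (rule card_inj_on_le) (rule finite_words)
  then show ?thesis by (simp add: card_words)
qed

text \<open>The index of a codeword is split into a prefix, sent in the clear, and a suffix of
  \<open>l' = min(nr, nR)\<close> bits, encrypted with the key as a one-time pad; only the prefix leaks.\<close>

lemma one_time_pad_code:
  fixes P :: "'x::finite pmf" and w :: "'x list \<Rightarrow> 'y::finite list"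
  assumes P: "set_pmf P = UNIV"
    and C: "finite C" "C \<subseteq> words n" "card C \<le> 2 ^ nat \<lfloor>real n * R\<rfloor>"
    and w: "\<And>xs. w xs \<in> C"
  obtains f g where "encoder n R r f" "decoder n R r g"
    "source_reproduction_law P n r f g = map_pmf (\<lambda>xs. (xs, w xs)) (replicate_pmf n P)"
    "(\<Sum>m\<in>bit_strings (real n * R). max_msg_prob n r f m) \<le> real (card C) / 2 ^ nat \<lfloor>real n * r\<rfloor> + 1"
proof -
  define l where "l = nat \<lfloor>real n * r\<rfloor>"
  define b where "b = nat \<lfloor>real n * R\<rfloor>"
  define l' where "l' = min l b"
  have l': "l' \<le> l" "l' \<le> b" by (auto simp: l'_def)
  have Cpos: "card C > 0" using C(1) w card_gt_0_iff by blast
  define t where "t = real (card C) / 2 ^ l'"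
  have t0: "0 \<le> t" by (simp add: t_def)
  \<comment> \<open>The number of prefixes required when each of them serves 2^l' suffixes.\<close>
  define a where "a = nat \<lceil>t\<rceil>"
  have a_ge: "real (card C) / 2 ^ l' \<le> real a" unfolding a_def t_def[symmetric] by linarith
  \<comment> \<open>If the key fits into the message, the ceiling accounts for the extra 1. If the
    key is longer, the whole message is encrypted and a single, empty prefix is enough.\<close>
  have a_le: "real a \<le> real (card C) / 2 ^ l + 1"
  proof (cases "l \<le> b")
    case True
    then have "t = real (card C) / 2 ^ l" by (simp add: l'_def t_def)
    moreover have "real a \<le> t + 1" unfolding a_def using t0 by linarith
    ultimately show ?thesis by simp
  next
    case False
    then have "l' = b" by (simp add: l'_def)
    then have "t \<le> 1" unfolding t_def
      using C(3) by (simp add: b_def[symmetric] divide_le_eq_1)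
    then have "\<lceil>t\<rceil> \<le> 1" by (simp add: ceiling_le_iff)
    then have "real a \<le> 1" unfolding a_def by linarith
    then show ?thesis by (simp add: add_increasing)
  qed
  have a_b: "a \<le> 2 ^ (b - l')"
  proof -
    have "real (card C) \<le> real (2 ^ b)" using C(3) unfolding b_def[symmetric] by (simp only: of_nat_le_iff)
    then have "real (card C) \<le> 2 ^ b" by simp
    then have "real (card C) / 2 ^ l' \<le> 2 ^ b / 2 ^ l'" by (intro divide_right_mono) auto
    also have "\<dots> = (2::real) ^ (b - l')" using l' by (simp add: power_diff)
    finally have "\<lceil>t\<rceil> \<le> int (2 ^ (b - l'))" by (simp add: ceiling_le_iff t_def)
    then show ?thesis unfolding a_def by linarith
  qed
  obtain A :: "bool list set" where A: "A \<subseteq> words (b - l')" "card A = a"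
    using obtain_subset_with_card_n[of a "words (b - l') :: bool list set"] a_b by (auto simp: card_words)
  have finA: "finite A" using A(1) finite_words finite_subset by blast
  have "real (card C) \<le> real a * 2 ^ l'" using a_ge by (simp add: pos_divide_le_eq)
  also have "\<dots> = real (card (A \<times> (words l' :: bool list set)))"
    using A by (simp add: card_cartesian_product card_words)
  finally have "card C \<le> card (A \<times> (words l' :: bool list set))" by (simp only: of_nat_le_iff)
  moreover have "finite (A \<times> (words l' :: bool list set))" by (intro finite_cartesian_product finA finite_words)
  ultimately obtain e where e: "e ` C \<subseteq> A \<times> (words l' :: bool list set)" "inj_on e C"
    using card_le_inj[OF C(1)] by blast
  define pre where "pre xs = fst (e (w xs))" for xs
  define suf where "suf xs = snd (e (w xs))" for xs
  have pre: "pre xs \<in> A" and suf: "length (suf xs) = l'" for xs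
  proof -
    have "e (w xs) \<in> A \<times> words l'" using e(1) w[of xs] by blast
    then show "pre xs \<in> A" "length (suf xs) = l'" by (auto simp: pre_def suf_def)
  qed
  have lpre: "length (pre xs) = b - l'" for xs using pre A(1) by blast
  define enc where "enc xs k = pre xs @ xor_list (suf xs) (take l' k)" for xs k
  define f where "f xs k = return_pmf (enc xs k)" for xs and k :: "bool list"
  \<comment> \<open>Pairs outside the image of \<open>e\<close> never come from the encoder; the
    default codeword merely keeps the output length right.\<close>
  define dec where "dec m k = (let p = (take (b - l') m, xor_list (drop (b - l') m) (take l' k)) in
     if p \<in> e ` C then inv_into C e p else (SOME c. c \<in> C))" for m k
  define g where "g m k = return_pmf (dec m k)" for m k
  have lk: "length (take l' k) = l'" if "k \<in> words l" for k :: "bool list" using that l' by simp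
  have K: "bit_strings (real n * r) = words l" and B: "bit_strings (real n * R) = words b"
    by (simp_all add: bit_strings_words l_def b_def)
  have enc_len: "length (enc xs k) = b" if "k \<in> words l" for xs k
    using lpre[of xs] suf[of xs] lk[OF that] l' by (simp add: enc_def)
  have f: "encoder n R r f"
    unfolding encoder_def K B f_def using enc_len by auto
  have decC: "dec m k \<in> C" for m k
  proof -
    have "C \<noteq> {}" using Cpos by auto
    then have "(SOME c. c \<in> C) \<in> C" by (simp add: some_in_eq)
    then show ?thesis by (auto simp: dec_def Let_def inv_into_into)
  qed
  have g: "decoder n R r g"
    unfolding decoder_def g_def using decC C(2) by auto
  have dec_enc: "dec (enc xs k) k = w xs" if k: "k \<in> words l" for xs k
  proof -
    have "xor_list (xor_list (suf xs) (take l' k)) (take l' k) = suf xs"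
      using suf[of xs] lk[OF k] by (intro xor_list_cancel) simp
    then have "(take (b - l') (enc xs k), xor_list (drop (b - l') (enc xs k)) (take l' k)) = e (w xs)"
      using lpre[of xs] by (simp add: enc_def pre_def suf_def)
    then show ?thesis using w[of xs] e(2) by (simp add: dec_def Let_def)
  qed
  have law: "source_reproduction_law P n r f g = map_pmf (\<lambda>xs. (xs, w xs)) (replicate_pmf n P)"
  proof -
    have "source_reproduction_law P n r f g
        = bind_pmf (replicate_pmf n P) (\<lambda>xs. bind_pmf (pmf_of_set (words l)) (\<lambda>k. return_pmf (xs, dec (enc xs k) k)))"
      by (simp add: source_reproduction_law_def K f_def g_def bind_return_pmf)
    also have "\<dots> = bind_pmf (replicate_pmf n P) (\<lambda>xs. bind_pmf (pmf_of_set (words l :: bool list set)) (\<lambda>k. return_pmf (xs, w xs)))"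
    proof (intro bind_pmf_cong refl)
      fix xs and k :: "bool list" assume "k \<in> set_pmf (pmf_of_set (words l))"
      then have "k \<in> words l" using set_pmf_of_set[OF words_nonempty finite_words, of l] by blast
      then show "return_pmf (xs, dec (enc xs k) k) = return_pmf (xs, w xs)" by (simp only: dec_enc)
    qed
    also have "\<dots> = map_pmf (\<lambda>xs. (xs, w xs)) (replicate_pmf n P)"
      by (simp add: map_pmf_def)
    finally show ?thesis .
  qed
  \<comment> \<open>A uniform key sends the suffix to any given string with probability at most
    2^(-l'), whatever xs is. The maximum over xs therefore costs nothing, and the sum over messages
    reduces to the number of prefixes.\<close>
  have msg: "msg_prob n r f xs m \<le> of_bool (take (b - l') m \<in> A) / 2 ^ l'" for xs :: "'x list" and m
  proof -
    have "(\<Sum>k\<in>words l. pmf (f xs k) m) = (\<Sum>k\<in>words l. of_bool (enc xs k = m))"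
      by (intro sum.cong) (auto simp: f_def indicator_def)
    also have "\<dots> = real (card {k \<in> words l. enc xs k = m})"
      by (simp add: Collect_conj_eq finite_words)
    also have "\<dots> \<le> of_bool (take (b - l') m \<in> A) * 2 ^ (l - l')"
    proof (cases "take (b - l') m \<in> A")
      case True
      have "{k \<in> words l. enc xs k = m} \<subseteq> {k \<in> words l. xor_list (suf xs) (take l' k) = drop (b - l') m}"
        using lpre[of xs] by (auto simp: enc_def)
      then have "card {k \<in> words l. enc xs k = m} \<le> card {k \<in> words l. xor_list (suf xs) (take l' k) = drop (b - l') m}"
        by (intro card_mono finite_subset[OF _ finite_words[of l]]) auto
      also have "\<dots> \<le> 2 ^ (l - l')" by (rule card_keys_le[OF suf l'(1)])
      finally have "real (card {k \<in> words l. enc xs k = m}) \<le> real (2 ^ (l - l'))" by (simp only: of_nat_le_iff)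
      then show ?thesis using True by simp
    next
      case False
      have e: "{k \<in> words l. enc xs k = m} = {}" using False pre[of xs] lpre[of xs] by (auto simp: enc_def)
      show ?thesis unfolding e by simp
    qed
    finally have "msg_prob n r f xs m \<le> (of_bool (take (b - l') m \<in> A) * 2 ^ (l - l')) / 2 ^ l"
      unfolding msg_prob_def K by (simp add: card_words divide_right_mono)
    also have "\<dots> = of_bool (take (b - l') m \<in> A) / 2 ^ l'"
      using l' by (simp add: power_diff)
    finally show ?thesis .
  qed
  have "(\<Sum>m\<in>words b. max_msg_prob n r f m) \<le> (\<Sum>m\<in>words b. of_bool (take (b - l') m \<in> A) / 2 ^ l')"
    unfolding max_msg_prob_def
  proof (intro sum_mono Max.boundedI finite_imageI finite_words)
    fix m c assume "c \<in> (\<lambda>xs. msg_prob n r f xs m) ` words n"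
    then obtain xs where "c = msg_prob n r f xs m" by blast
    then show "c \<le> of_bool (take (b - l') m \<in> A) / 2 ^ l'" using msg[of xs m] by (rule ord_eq_le_trans)
  next
    show "(\<lambda>xs. msg_prob n r f xs m) ` words n \<noteq> {}" for m using words_nonempty[of n] by blast
  qed
  also have "\<dots> = real (card {m \<in> words b. take (b - l') m \<in> A}) / 2 ^ l'"
    by (simp add: sum_divide_distrib[symmetric] Collect_conj_eq finite_words)
  also have "card {m \<in> words b. take (b - l') m \<in> A} \<le> card (A \<times> (words l' :: bool list set))"
  proof (rule card_inj_on_le)
    show "inj_on (\<lambda>m. (take (b - l') m, drop (b - l') m)) {m \<in> words b. take (b - l') m \<in> A}"
    proof (rule inj_onI)
      fix m m' :: "bool list"
      assume "(take (b - l') m, drop (b - l') m) = (take (b - l') m', drop (b - l') m')"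
      then have "take (b - l') m @ drop (b - l') m = take (b - l') m' @ drop (b - l') m'" by simp
      then show "m = m'" by (simp only: append_take_drop_id)
    qed
    show "(\<lambda>m. (take (b - l') m, drop (b - l') m)) ` {m \<in> words b. take (b - l') m \<in> A} \<subseteq> A \<times> words l'"
      using l' by auto
  qed (intro finite_cartesian_product finA finite_words)
  also have "real (card (A \<times> (words l' :: bool list set))) / 2 ^ l' = real a"
    using A by (simp add: card_cartesian_product card_words)
  also note a_le
  finally have "(\<Sum>m\<in>bit_strings (real n * R). max_msg_prob n r f m) \<le> real (card C) / 2 ^ nat \<lfloor>real n * r\<rfloor> + 1"
    unfolding B by (simp add: l_def divide_right_mono)
  then show thesis using that[OF f g law] by blast
qed

subsection \<open>The optimal limit\<close>

lemma relative_entropy_self: "set_pmf P = UNIV \<Longrightarrow> relative_entropy P (P :: 'x::finite pmf) = 0"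
  by (simp add: relative_entropy_eq kl_def pmf_eq_0_set_pmf)

text \<open>Here z is any number dominating the positive part of c - r. A codebook of about 2^(nc)
  words leaves about 2^(n(c - r)) prefixes in the clear, and never fewer than one.\<close>

lemma leakage_upper_bound:
  fixes P :: "'x::finite pmf" and d :: "'x \<Rightarrow> 'y::finite \<Rightarrow> real"
  assumes P: "set_pmf P = UNIV" and \<alpha>: "\<alpha> > 0" and D: "D \<ge> (MAX x. MIN y. d x y)"
    and c: "\<And>Q. ereal (relative_entropy Q P) \<le> \<alpha> \<Longrightarrow> rate_distortion d Q D < ereal c"
    and cR: "c < R" and z: "0 \<le> z" "c \<le> z + r" and r: "r > 0" and \<epsilon>: "\<epsilon> > 0"
  shows "\<forall>\<^sub>F n in sequentially. min_leakage_rate P d D R r \<alpha> n \<le> ereal (z + \<epsilon>)"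
proof -
  have "(0::ereal) \<le> rate_distortion d P D" by (rule rate_distortion_nonneg)
  also have "rate_distortion d P D < ereal c"
    using c[of P] \<alpha> by (simp add: relative_entropy_self[OF P] zero_ereal_def[symmetric])
  finally have c0: "0 < c" by simp
  \<comment> \<open>One term of the minimum bounds the loss in leakage; the other keeps the codebook
    rate c + e below \<open>R\<close>, with room for rounding nR down.\<close>
  define e where "e = min (\<epsilon> / 2) ((R - c) / 2)"
  have e: "e > 0" "e \<le> \<epsilon> / 2" "c + e < R" using \<epsilon> cR by (auto simp: e_def min_def field_simps)
  obtain U :: "(real^'x) set" where U: "open U" "divergence_ball P \<alpha> \<subseteq> U"
    and cover: "\<forall>\<^sub>F n in sequentially. \<exists>C\<subseteq>words n. finite C \<and> real (card C) \<le> 2 powr (real n * (c + e)) \<and>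
       (\<forall>xs\<in>words n. (\<chi> x. emp xs x) \<in> U \<longrightarrow> (\<exists>ys\<in>C. seq_distortion d n xs ys \<le> D))"
    by (rule global_cover[OF P \<alpha> D c e(1)]) blast+
  have "\<forall>\<^sub>F n in sequentially. 1 \<le> real n * (R - (c + e))"
  proof -
    define t where "t = R - (c + e)"
    have "t > 0" using e by (simp add: t_def)
    then show ?thesis unfolding t_def[symmetric] by real_asymp
  qed
  \<comment> \<open>Two bits are lost: one by rounding the key length down, one by absorbing the
    additive 1 in the bound on the exposed prefixes.\<close>
  moreover have "\<forall>\<^sub>F n in sequentially. 2 \<le> real n * (\<epsilon> / 2)" using \<epsilon> by real_asymp
  moreover note cover prob_atypical[OF P \<alpha> U]
  ultimately show ?thesis using eventually_gt_at_top[of "0::nat"]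
  proof eventually_elim
    case (elim n)
    obtain C0 :: "'y list set" where C0: "C0 \<subseteq> words n" "finite C0" "real (card C0) \<le> 2 powr (real n * (c + e))"
      "\<forall>xs\<in>words n. (\<chi> x. emp xs x) \<in> U \<longrightarrow> (\<exists>ys\<in>C0. seq_distortion d n xs ys \<le> D)"
      using elim(3) by blast
    obtain w0 :: "'y list" where w0: "length w0 = n" using Ex_list_of_length by blast
    \<comment> \<open>The cover may be empty when no word has its type in \<open>U\<close>; the code
      still needs a codeword, and a single one respects the size bound.\<close>
    define C where "C = (if C0 = {} then {w0} else C0)"
    have C: "C \<subseteq> words n" "finite C" "C \<noteq> {}" using C0 w0 by (auto simp: C_def)
    have cC: "real (card C) \<le> 2 powr (real n * (c + e))"
      using C0(3) c0 e by (auto simp: C_def intro!: ge_one_powr_ge_zero)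
    have "2 powr (real n * (c + e)) \<le> 2 powr (real n * R - 1)"
      using elim(1) by (intro powr_mono) (auto simp: algebra_simps)
    also have "\<dots> \<le> 2 powr real (nat \<lfloor>real n * R\<rfloor>)" by (intro powr_mono) (linarith, simp)
    also have "\<dots> = real (2 ^ nat \<lfloor>real n * R\<rfloor>)" by (simp add: powr_realpow)
    finally have "real (card C) \<le> real (2 ^ nat \<lfloor>real n * R\<rfloor>)" using cC by linarith
    then have cCR: "card C \<le> 2 ^ nat \<lfloor>real n * R\<rfloor>" by (simp only: of_nat_le_iff)
    define w where "w xs = (if \<exists>ys\<in>C. seq_distortion d n xs ys \<le> D then SOME ys. ys \<in> C \<and> seq_distortion d n xs ys \<le> D
       else SOME ys. ys \<in> C)" for xs
    have w_good: "w xs \<in> C \<and> seq_distortion d n xs (w xs) \<le> D" if "\<exists>ys\<in>C. seq_distortion d n xs ys \<le> D" for xs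
    proof -
      have "w xs = (SOME ys. ys \<in> C \<and> seq_distortion d n xs ys \<le> D)" using that by (simp add: w_def)
      then show ?thesis using someI_ex[of "\<lambda>ys. ys \<in> C \<and> seq_distortion d n xs ys \<le> D"] that by auto
    qed
    have wC: "w xs \<in> C" for xs
    proof (cases "\<exists>ys\<in>C. seq_distortion d n xs ys \<le> D")
      case True
      then show ?thesis using w_good by blast
    next
      case False
      then have "w xs = (SOME ys. ys \<in> C)" by (simp add: w_def)
      then show ?thesis using C(3) by (simp add: some_in_eq)
    qed
    obtain f g where f: "encoder n R r f" and g: "decoder n R r g"
      and law: "source_reproduction_law P n r f g = map_pmf (\<lambda>xs. (xs, w xs)) (replicate_pmf n P)"
      and leak: "(\<Sum>m\<in>bit_strings (real n * R). max_msg_prob n r f m) \<le> real (card C) / 2 ^ nat \<lfloor>real n * r\<rfloor> + 1"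
      by (rule one_time_pad_code[where w=w and r=r, OF P C(2,1) cCR wC]) blast
    have "measure_pmf.prob (source_reproduction_law P n r f g) {(xs, ys). seq_distortion d n xs ys > D}
        = measure_pmf.prob (replicate_pmf n P) {xs. seq_distortion d n xs (w xs) > D}"
      by (simp add: law vimage_def)
    also have "\<dots> = (\<Sum>xs\<in>words n. if xs \<in> {xs. seq_distortion d n xs (w xs) > D} then pmf (replicate_pmf n P) xs else 0)"
      by (rule prob_eq_sum_superset[OF finite_words]) (auto simp: set_replicate_pmf)
    also have "\<dots> \<le> (\<Sum>xs\<in>words n. if (\<chi> x. emp xs x) \<notin> U then prod_list (map (pmf P) xs) else 0)"
    proof (rule sum_mono)
      fix xs :: "'x list" assume xs: "xs \<in> words n"
      have "(\<chi> x. emp xs x) \<notin> U" if "seq_distortion d n xs (w xs) > D"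
      proof
        assume "(\<chi> x. emp xs x) \<in> U"
        then obtain ys where "ys \<in> C0" "seq_distortion d n xs ys \<le> D" using C0(4) xs by blast
        then have "\<exists>ys\<in>C. seq_distortion d n xs ys \<le> D" by (auto simp: C_def)
        then show False using w_good that by fastforce
      qed
      moreover have "0 \<le> prod_list (map (pmf P) xs)" by (intro prod_list_nonneg) auto
      ultimately show "(if xs \<in> {xs. seq_distortion d n xs (w xs) > D} then pmf (replicate_pmf n P) xs else 0)
          \<le> (if (\<chi> x. emp xs x) \<notin> U then prod_list (map (pmf P) xs) else 0)"
        using pmf_replicate_pmf[of xs n P] xs by auto
    qed
    also have "\<dots> = (\<Sum>xs\<in>{xs \<in> words n. (\<chi> x. emp xs x) \<notin> U}. prod_list (map (pmf P) xs))"
      by (rule sum.inter_filter[OF finite_words, symmetric])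
    also have "\<dots> \<le> excess_bound \<alpha> n" by (rule elim(4))
    finally have adm: "f \<in> admissible_encoders P d D R r \<alpha> n"
      using f g by (auto simp: admissible_encoders_def)
    let ?L = "\<Sum>m\<in>bit_strings (real n * R). max_msg_prob n r f m"
    have L1: "1 \<le> ?L" by (rule sum_max_msg_prob_ge_1[OF f])
    have "2 ^ nat \<lfloor>real n * r\<rfloor> = 2 powr real (nat \<lfloor>real n * r\<rfloor>)" by (simp add: powr_realpow)
    also have "\<dots> \<ge> 2 powr (real n * r - 1)" by (intro powr_mono) (linarith, simp)
    finally have key: "2 powr (real n * r - 1) \<le> 2 ^ nat \<lfloor>real n * r\<rfloor>" .
    have "real (card C) / 2 ^ nat \<lfloor>real n * r\<rfloor> \<le> 2 powr (real n * (c + e)) / 2 powr (real n * r - 1)"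
      using cC key by (intro frac_le) auto
    also have "\<dots> = 2 powr (real n * (c + e) - (real n * r - 1))" by (rule powr_diff[symmetric])
    also have "\<dots> \<le> 2 powr (real n * (z + e) + 1)"
    proof (intro powr_mono)
      have "real n * c \<le> real n * (z + r)" using z by (intro mult_left_mono) auto
      then show "real n * (c + e) - (real n * r - 1) \<le> real n * (z + e) + 1" by (simp add: algebra_simps)
    qed simp
    finally have "?L \<le> 2 powr (real n * (z + e) + 1) + 1" using leak by linarith
    moreover have "(1::real) \<le> 2 powr (real n * (z + e) + 1)" using z e by (intro ge_one_powr_ge_zero) auto
    moreover have "2 powr (real n * (z + e) + 1) + 2 powr (real n * (z + e) + 1) = 2 powr (real n * (z + e) + 2)"
      by (simp add: powr_add)
    ultimately have "?L \<le> 2 powr (real n * (z + e) + 2)" by linarith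
    then have "log 2 ?L \<le> log 2 (2 powr (real n * (z + e) + 2))" using L1 by (subst log_le_cancel_iff) auto
    also have "\<dots> = real n * (z + e) + 2" by simp
    also have "\<dots> \<le> real n * (z + \<epsilon> / 2) + real n * (\<epsilon> / 2)"
      using e elim(2) by (intro add_mono mult_left_mono) auto
    also have "\<dots> = real n * (z + \<epsilon>)" by (simp add: algebra_simps)
    finally have "log 2 ?L / real n \<le> z + \<epsilon>" using elim(5) by (simp add: pos_divide_le_eq mult.commute)
    moreover have "maximal_leakage (source_message_law P n r f) = ereal (log 2 ?L)"
      using L1 by (simp add: maximal_leakage_source_message[OF P f] elog2_def)
    ultimately have "maximal_leakage (source_message_law P n r f) / ereal (real n) \<le> ereal (z + \<epsilon>)"
      using elim(5) by simp
    then show ?case unfolding min_leakage_rate_def using adm by (intro INF_lower2[of f])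
  qed
qed

theorem theorem8:
  fixes P :: "'x::finite pmf"
    and d :: "'x \<Rightarrow> 'y::finite \<Rightarrow> real"
    and D D_max R r :: real
    and \<alpha> :: ereal
  assumes "set_pmf P = UNIV"
    and "\<And>x y. 0 \<le> d x y"
    and "\<And>x y. d x y \<le> D_max"
    and "D \<ge> (MAX x. MIN y. d x y)"
    and "\<alpha> > 0"
    and "r > 0"
    and "ereal R > (SUP Q \<in> {Q. ereal (relative_entropy Q P) \<le> \<alpha>}. rate_distortion d Q D)"
  shows "(\<lambda>n. min_leakage_rate P d D R r \<alpha> n) \<longlonglongrightarrow>
           (SUP Q \<in> {Q. ereal (relative_entropy Q P) \<le> \<alpha>}.
              max 0 (rate_distortion d Q D - ereal r))"
proof (rule order_tendstoI)
  let ?K = "{Q. ereal (relative_entropy Q P) \<le> \<alpha>}"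
  let ?\<sigma> = "SUP Q \<in> ?K. max 0 (rate_distortion d Q D - ereal r)"
  fix a assume "a < ?\<sigma>"
  then obtain Q where Q: "Q \<in> ?K" "a < max 0 (rate_distortion d Q D - ereal r)"
    by (auto simp: less_SUP_iff)
  have "rate_distortion d Q D \<le> (SUP Q \<in> ?K. rate_distortion d Q D)" using Q(1) by (intro SUP_upper)
  also have "\<dots> < ereal R" by (rule assms(7))
  finally have "rate_distortion d Q D < ereal R" .
  moreover have "0 \<le> rate_distortion d Q D" by (rule rate_distortion_nonneg)
  ultimately obtain \<rho> where \<rho>: "rate_distortion d Q D = ereal \<rho>" by (cases "rate_distortion d Q D") auto
  \<comment> \<open>For negative a the zero branch is enough, so any c below \<rho> serves.
    Otherwise the maximum exceeding a is \<rho> - r, and some c strictly below \<rho> still clears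
    a.\<close>
  have "\<exists>c. c < \<rho> \<and> a < ereal (max 0 (c - r))"
  proof (cases "a < 0")
    case True
    then have "a < ereal (max 0 (\<rho> - 1 - r))"
      by (rule order.strict_trans2) (simp add: zero_ereal_def)
    then show ?thesis by (intro exI[of _ "\<rho> - 1"]) simp
  next
    case False
    then have "a < ereal (\<rho> - r)" using Q(2) by (auto simp: \<rho> max_def split: if_splits)
    then obtain t where t: "a < ereal t" "ereal t < ereal (\<rho> - r)" using ereal_dense2 by blast
    then have "t + r < \<rho>" by simp
    moreover have "a < ereal (max 0 (t + r - r))" using t(1) by (rule order.strict_trans2) simp
    ultimately show ?thesis by blast
  qed
  then obtain c where c: "c < \<rho>" "a < ereal (max 0 (c - r))" by blast
  have "\<forall>\<^sub>F n in sequentially. ereal (max 0 (c - r)) \<le> min_leakage_rate P d D R r \<alpha> n"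
    using Q(1) c(1) by (intro leakage_lower_bound[OF assms(1-3,5) _ assms(6)]) (auto simp: \<rho>)
  then show "\<forall>\<^sub>F n in sequentially. a < min_leakage_rate P d D R r \<alpha> n"
    by eventually_elim (use c(2) in \<open>rule order.strict_trans2\<close>)
next
  let ?K = "{Q. ereal (relative_entropy Q P) \<le> \<alpha>}"
  let ?\<sigma> = "SUP Q \<in> ?K. max 0 (rate_distortion d Q D - ereal r)"
  fix a assume a: "?\<sigma> < a"
  obtain z where z: "?\<sigma> < ereal z" "ereal z < a" using ereal_dense2[OF a] by blast
  obtain z' where z': "ereal z < ereal z'" "ereal z' < a" using ereal_dense2[OF z(2)] by blast
  obtain R' where R': "(SUP Q \<in> ?K. rate_distortion d Q D) < ereal R'" "ereal R' < ereal R"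
    using ereal_dense2[OF assms(7)] by blast
  have PK: "P \<in> ?K" using assms(5) by (simp add: relative_entropy_self[OF assms(1)] zero_ereal_def[symmetric])
  have "0 \<le> max 0 (rate_distortion d P D - ereal r)" by simp
  also have "\<dots> \<le> ?\<sigma>" using PK by (rule SUP_upper)
  finally have z0: "0 \<le> z" using z(1) by (metis ereal_less_eq(5) less_imp_le order.trans)
  \<comment> \<open>The bound R' keeps the code within the channel rate, and z + r keeps the exposed
    rate at most z. Both lie strictly above every R(Q,D) in the ball, which is the room that the
    local covers consume.\<close>
  have c: "rate_distortion d Q D < ereal (min R' (z + r))" if Q: "ereal (relative_entropy Q P) \<le> \<alpha>" for Q
  proof -
    have 1: "rate_distortion d Q D < ereal R'"
      by (rule order.strict_trans1[OF SUP_upper R'(1)]) (use Q in simp)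
    have "max 0 (rate_distortion d Q D - ereal r) \<le> ?\<sigma>" by (rule SUP_upper) (use Q in simp)
    then have 2: "max 0 (rate_distortion d Q D - ereal r) < ereal z" using z(1) by (rule order.strict_trans1)
    show ?thesis using 1 2 by (cases "rate_distortion d Q D") (auto simp: max_def split: if_splits)
  qed
  have "\<forall>\<^sub>F n in sequentially. min_leakage_rate P d D R r \<alpha> n \<le> ereal (z + (z' - z))"
    by (rule leakage_upper_bound[OF assms(1,5,4) c]) (use R' z0 z' assms(6) in auto)
  then show "\<forall>\<^sub>F n in sequentially. min_leakage_rate P d D R r \<alpha> n < a"
    by eventually_elim (use z'(2) in \<open>auto intro: order.strict_trans1\<close>)
qed

end
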